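(* Let $\ell,n_c\ge 1$ be integers, $\rho>0$, $\epsilon\in(0,1)$, and consider the Rician memoryless block-fading channel described in the context, with mean $\mu_H$ and variance $\sigma_H^2$. Then $$R^*(\ell,n_c,\epsilon,\rho)\ \ge\ \max\Big\{\frac{\log_2 M}{n_c\ell}\ :\ \epsilon_{\rm ub}(\ell,n_c,M,\rho)\le\epsilon\Big\},$$ where the maximum is over positive integers $M$ and $$\epsilon_{\rm ub}(\ell,n_c,M,\rho)=\inf_{s>0}\ \mathbb E\Big[\exp\Big\{-\Big[\sum_{k=1}^{\ell}S_k^s-\log(M-1)\Big]^+\Big\}\Big],$$ with $$\begin{aligned}S_k^s={}&(n_c-2)\log s-\log\Big(\frac{1+\sigma_H^2n_c\rho}{\sigma_H^2}\Big)-\log\Gamma(n_c)-s\big(\|\mathbf W_k\|^2-\|\widetilde{\mathbf W}_k\|^2\big)+\frac{s|\mu_H|^2}{\sigma_H^2}\\&-\log\int_0^\infty\frac{\exp\big(-s(\rho n_c+\sigma_H^{-2})z\big)}{\big(\|\widetilde{\mathbf W}_k\|\sqrt{\rho n_cz}\big)^{n_c-1}}\,I_{n_c-1}\big(2s\|\widetilde{\mathbf W}_k\|\sqrt{\rho n_cz}\big)\,I_0\big(2s\sigma_H^{-2}\sqrt{z|\mu_H|^2}\big)\,dz.\end{aligned}$$ Here $\mathbf W_1,\dots,\mathbf W_\ell$ are i.i.d. $\mathcal{CN}(\mathbf 0,\mathbf I_{n_c})$ and, with $\odot$ the entrywise product and $\mathbf 0_{n},\mathbf 1_{n}$ the all-zero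 and all-one vectors of size $n$, $$\widetilde{\mathbf W}_k=\begin{bmatrix}\mu_H\sqrt{n_c\rho}\\ \mathbf 0_{n_c-1}\end{bmatrix}+\begin{bmatrix}\sqrt{\sigma_H^2n_c\rho+1}\\ \mathbf 1_{n_c-1}\end{bmatrix}\odot\mathbf W_k.$$
   Context: Channel. Fix a Rician factor $\kappa\in[0,\infty)$ and put $\mu_H=\sqrt{\kappa/(1+\kappa)}$, $\sigma_H^2=(1+\kappa)^{-1}$. The channel input is $\mathbf x^\ell=[\mathbf x_1,\dots,\mathbf x_\ell]$ with $\mathbf x_k\in\mathbb C^{n_c}$, and the output is $\mathbf Y^\ell=[\mathbf Y_1,\dots,\mathbf Y_\ell]$ with $\mathbf Y_k=H_k\mathbf x_k+\mathbf W_k$, $k=1,\dots,\ell$, where $H_k\sim\mathcal{CN}(\mu_H,\sigma_H^2)$ and $\mathbf W_k\sim\mathcal{CN}(\mathbf 0,\mathbf I_{n_c})$ are all mutually independent. The realizations of $H_k$ are known neither to the encoder nor to the decoder. $\mathcal{CN}$ denotes the circularly-symmetric complex Gaussian distribution. Code. An $(\ell,n_c,M,\epsilon,\rho)$-code consists of (i) an encoder $f:\{1,\dots,M\}\to\mathbb C^{n_c\ell}$, mapping message $m$ to a codeword $\mathbf c_m=[\mathbf c_{m,1},\dots,\mathbf c_{m,\ell}]$ with $\mathbf c_{m,k}\in\mathbb C^{n_c}$ and $\|\mathbf c_{m,k}\|^2=n_c\rho$ for all $m,k$; (ii) a decoder $g:\mathbb C^{n_c\ell}\to\{1,\dots,M\}$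 with average error probability $\frac1M\sum_{j=1}^M\Pr\{g(\mathbf Y^\ell)\ne j\mid \mathbf x^\ell=f(j)\}\le\epsilon$. Maximum coding rate (bits per channel use): $R^*(\ell,n_c,\epsilon,\rho)=\sup\{\frac{\log_2M}{\ell n_c}:\ \text{there exists an }(\ell,n_c,M,\epsilon,\rho)\text{-code}\}$. Notation: $\log$ is the natural logarithm, $[a]^+=\max\{0,a\}$, $\Gamma$ is the Gamma function, $I_\nu$ is the modified Bessel function of the first kind, $\|\cdot\|$ is the Euclidean norm. Conventions: $\log 0=-\infty$, $e^{-\infty}=0$; a maximum over an empty set makes the bound vacuous. *)

theory Defs
  imports "HOL-Probability.Probability"
begin

(* Vectors in C^n are functions nat => complex restricted to {..<n}; sequences of l blocks are
   functions nat => nat => complex restricted to {..<l} and {..<n}. Indices start at 0, so the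
   distinguished first entry of a vector has index 0. *)

definition vnorm :: "nat \<Rightarrow> (nat \<Rightarrow> complex) \<Rightarrow> real" where
  "vnorm n v = L2_set (\<lambda>i. cmod (v i)) {..<n}"

definition rician_mean :: "real \<Rightarrow> real" where
  "rician_mean \<kappa> = sqrt (\<kappa> / (1 + \<kappa>))"

definition rician_var :: "real \<Rightarrow> real" where
  "rician_var \<kappa> = 1 / (1 + \<kappa>)"

(* Circularly-symmetric complex Gaussian with mean m and variance v > 0, as a law on C = R^2:
   independent real and imaginary parts, each of variance v / 2. *)
definition complex_gaussian :: "complex \<Rightarrow> real \<Rightarrow> complex measure" where
  "complex_gaussian m v =
     density lborel (\<lambda>z. ennreal (exp (- (cmod (z - m))\<^sup>2 / v) / (pi * v)))"

(* l independent copies of the circularly-symmetric vector with mean 0 and covariance I_n. *)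
definition noise_law :: "nat \<Rightarrow> nat \<Rightarrow> (nat \<Rightarrow> nat \<Rightarrow> complex) measure" where
  "noise_law l n = (\<Pi>\<^sub>M k\<in>{..<l}. \<Pi>\<^sub>M i\<in>{..<n}. complex_gaussian 0 1)"

definition fading_law :: "real \<Rightarrow> nat \<Rightarrow> (nat \<Rightarrow> complex) measure" where
  "fading_law \<kappa> l = (\<Pi>\<^sub>M k\<in>{..<l}. complex_gaussian (of_real (rician_mean \<kappa>)) (rician_var \<kappa>))"

definition output_space :: "nat \<Rightarrow> nat \<Rightarrow> (nat \<Rightarrow> nat \<Rightarrow> complex) measure" where
  "output_space l n = (\<Pi>\<^sub>M k\<in>{..<l}. \<Pi>\<^sub>M i\<in>{..<n}. borel)"

definition channel_law ::
  "real \<Rightarrow> nat \<Rightarrow> nat \<Rightarrow> (nat \<Rightarrow> nat \<Rightarrow> complex) \<Rightarrow> (nat \<Rightarrow> nat \<Rightarrow> complex) measure" where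
  "channel_law \<kappa> l n x =
     distr (fading_law \<kappa> l \<Otimes>\<^sub>M noise_law l n) (output_space l n)
       (\<lambda>(H, W). \<lambda>k\<in>{..<l}. \<lambda>i\<in>{..<n}. H k * x k i + W k i)"

(* The decoder is required to be measurable, so that the error events have a probability. *)
definition is_code ::
  "real \<Rightarrow> nat \<Rightarrow> nat \<Rightarrow> nat \<Rightarrow> real \<Rightarrow> real \<Rightarrow>
   (nat \<Rightarrow> nat \<Rightarrow> nat \<Rightarrow> complex) \<Rightarrow> ((nat \<Rightarrow> nat \<Rightarrow> complex) \<Rightarrow> nat) \<Rightarrow> bool" where
  "is_code \<kappa> l n M \<epsilon> \<rho> f g \<longleftrightarrow>
     1 \<le> M \<and>
     (\<forall>m\<in>{1..M}. \<forall>k<l. (vnorm n (f m k))\<^sup>2 = real n * \<rho>) \<and>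
     g \<in> measurable (output_space l n) (count_space {1..M}) \<and>
     (1 / real M) * (\<Sum>j=1..M. measure (channel_law \<kappa> l n (f j))
        {y \<in> space (output_space l n). g y \<noteq> j}) \<le> \<epsilon>"

(* The supremum is taken in the extended reals, where it always exists. *)
definition max_coding_rate :: "real \<Rightarrow> nat \<Rightarrow> nat \<Rightarrow> real \<Rightarrow> real \<Rightarrow> ereal" where
  "max_coding_rate \<kappa> l n \<epsilon> \<rho> =
     Sup {ereal (log 2 (real M) / (real l * real n)) | M. \<exists>f g. is_code \<kappa> l n M \<epsilon> \<rho> f g}"

(* Modified Bessel function of the first kind of integer order nu >= 0. Natural-number powers
   give the correct value I_0(0) = 1, which powr would not (0 powr 0 = 0). *)
definition bessel_I :: "nat \<Rightarrow> real \<Rightarrow> real" where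
  "bessel_I \<nu> x = (\<Sum>m. (x / 2) ^ (2 * m + \<nu>) / (fact m * Gamma (real (m + \<nu> + 1))))"

definition W_tilde :: "real \<Rightarrow> nat \<Rightarrow> real \<Rightarrow> (nat \<Rightarrow> complex) \<Rightarrow> nat \<Rightarrow> complex" where
  "W_tilde \<kappa> n \<rho> w i =
     (if i = 0
      then of_real (rician_mean \<kappa> * sqrt (real n * \<rho>))
           + of_real (sqrt (rician_var \<kappa> * real n * \<rho> + 1)) * w i
      else w i)"

definition S_term :: "real \<Rightarrow> nat \<Rightarrow> real \<Rightarrow> real \<Rightarrow> (nat \<Rightarrow> complex) \<Rightarrow> real" where
  "S_term \<kappa> n \<rho> s w =
    (let \<mu> = rician_mean \<kappa>; v = rician_var \<kappa>; t = vnorm n (W_tilde \<kappa> n \<rho> w) in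
       (real n - 2) * ln s
       - ln ((1 + v * real n * \<rho>) / v)
       - ln (Gamma (real n))
       - s * ((vnorm n w)\<^sup>2 - t\<^sup>2)
       + s * \<bar>\<mu>\<bar>\<^sup>2 / v
       - ln (LINT z:{0<..}|lborel.
               exp (- s * (\<rho> * real n + 1 / v) * z) / (t * sqrt (\<rho> * real n * z)) ^ (n - 1)
               * bessel_I (n - 1) (2 * s * t * sqrt (\<rho> * real n * z))
               * bessel_I 0 (2 * s * (1 / v) * sqrt (z * \<bar>\<mu>\<bar>\<^sup>2))))"

(* The integrand is exp (- [sum_k S_k^s - log (M - 1)]^+). For M = 1, log 0 = -infinity makes it
   e^(-infinity) = 0; this case is separate because ln 0 = 0 in the library. *)
definition eps_ub :: "real \<Rightarrow> nat \<Rightarrow> nat \<Rightarrow> nat \<Rightarrow> real \<Rightarrow> real" where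
  "eps_ub \<kappa> l n M \<rho> =
     (INF s\<in>{0<..}. LINT W|noise_law l n.
        (if M = 1 then 0
         else exp (- max 0 ((\<Sum>k<l. S_term \<kappa> n \<rho> s (W k)) - ln (real M - 1)))))"

end

theory Submission
  imports Defs
begin

text \<open>
  Achievability is the random coding union bound with Gallager-type exponent \<open>s\<close>. The blocks of the codewords
  are independent and uniform on the sphere of radius \<open>\<surd>P\<close>, \<open>P = n\<rho>\<close>, realised as normalised Gaussian vectors,
  and decoding is by maximum likelihood. The log-likelihood of a block is, up to constants, minus the quadratic form
  \<open>Q(x, y) = \<parallel>y\<parallel>\<^sup>2 + \<mu>\<^sup>2 / v - \<bar>\<mu> / v + \<langle>y, x\<rangle>\<bar>\<^sup>2 / (1 / v + P)\<close>, where \<open>\<mu>\<close> and \<open>v\<close> are the mean and variance of the fading.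
  Since this decoder does not depend on \<open>s\<close>, its average error is below the bound for every \<open>s\<close>, hence below the
  infimum, and some codebook attains it.

  Two computations identify the bound with \<open>eps_ub\<close>. First, \<open>exp (-s Q(x, y))\<close> is a Gaussian integral over the fading
  coefficient; averaging over \<open>x\<close> and expanding in even moments gives the product of two Bessel functions under the
  integral. The moments of a uniform direction come from those of a Gaussian vector by homogeneity. Secondly, unitary
  invariance makes the law of \<open>(Q(x, y), \<parallel>y\<parallel>)\<close> independent of the direction of \<open>x\<close>, so one may take \<open>x = \<surd>P e\<^sub>0\<close>, for
  which \<open>(Q(x, y), \<parallel>y\<parallel>)\<close> is distributed as the pair formed by \<open>\<parallel>W\<parallel>\<^sup>2\<close> and the norm of \<open>W_tilde\<close>.

  The maximum is over a finite set because a code with error at most \<open>\<epsilon> < 1\<close> has boundedly many messages: for bounded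
  fading all output laws are dominated by a multiple of one fixed Gaussian law, on which the decoding regions are disjoint.
\<close>

subsection \<open>Circularly symmetric Gaussian vectors and unitary invariance\<close>

text \<open>Integrals are taken in \<open>ennreal\<close>, so that exchanging integrals and series
  rests on nonnegativity alone; the Bochner integrals in \<open>S_term\<close> and
  \<open>eps_ub\<close> are converted where the definitions are met.

  The shape of the proof comes from working with neither polar coordinates nor surface measure.
  Unitary invariance is obtained by merging coordinates two at a time, each 2 by 2 rotation being a
  product of shears. Division by a power of the squared norm R uses that \<open>R^(-m)\<close> is
  \<open>1/(m-1)!\<close> times the integral of \<open>t^(m-1) * exp (-t * R)\<close> over t > 0:
  the weight \<open>exp (-t * R)\<close> only rescales a Gaussian. The plane integral over the
  fading coefficient h becomes an integral over z = |h|^2 by comparing power series term by term.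

  The long formula for \<open>S_term\<close> is the logarithm of \<open>exp (-s * Q(x, y))\<close>
  divided by its average over an independent codeword. That average depends on y only through its
  norm, so the pair (Q, norm) carries everything that the bound needs.\<close>

lemma sets_complex_gaussian [measurable_cong, simp]: "sets (complex_gaussian m v) = sets borel"
  by (simp add: complex_gaussian_def)

lemma space_complex_gaussian [simp]: "space (complex_gaussian m v) = UNIV"
  by (simp add: complex_gaussian_def)

lemma measurable_Complex [measurable]: "(\<lambda>(x, y). Complex x y) \<in> borel \<Otimes>\<^sub>M borel \<rightarrow>\<^sub>M borel"
  unfolding Complex_eq by measurable

lemma lborel_complex_eq:
  "(lborel :: complex measure) = distr (lborel \<Otimes>\<^sub>M lborel) borel (\<lambda>(x, y). Complex x y)"
proof (rule lborel_eqI)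
  fix l u :: complex assume "\<And>b. b \<in> Basis \<Longrightarrow> l \<bullet> b \<le> u \<bullet> b"
  from this[of 1] this[of \<i>] have le: "Re l \<le> Re u" "Im l \<le> Im u"
    by (auto simp: Basis_complex_def)
  have box: "(\<lambda>(x, y). Complex x y) -` box l u = {Re l<..<Re u} \<times> {Im l<..<Im u}"
    by (auto simp: box_def Basis_complex_def)
  have "emeasure (distr (lborel \<Otimes>\<^sub>M lborel) borel (\<lambda>(x, y). Complex x y)) (box l u) =
        emeasure (lborel \<Otimes>\<^sub>M lborel) ({Re l<..<Re u} \<times> {Im l<..<Im u})"
    by (subst emeasure_distr) (auto simp: box space_pair_measure)
  also have "\<dots> = ennreal (Re u - Re l) * ennreal (Im u - Im l)"
    using le by (subst lborel.emeasure_pair_measure_Times) auto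
  also have "\<dots> = ennreal (\<Prod>b\<in>Basis. (u - l) \<bullet> b)"
    using le by (simp add: Basis_complex_def ennreal_mult)
  finally show "emeasure (distr (lborel \<Otimes>\<^sub>M lborel) borel (\<lambda>(x, y). Complex x y)) (box l u) =
    ennreal (\<Prod>b\<in>Basis. (u - l) \<bullet> b)" .
qed simp

lemma nn_integral_lborel_complex:
  assumes [measurable]: "f \<in> borel_measurable borel"
  shows "(\<integral>\<^sup>+z. f z \<partial>lborel) = (\<integral>\<^sup>+x. \<integral>\<^sup>+y. f (Complex x y) \<partial>lborel \<partial>lborel)"
proof -
  have [measurable]: "(\<lambda>(x, y). Complex x y) \<in> lborel \<Otimes>\<^sub>M lborel \<rightarrow>\<^sub>M borel" by measurable
  show ?thesis
    by (subst lborel_complex_eq) (simp add: nn_integral_distr lborel.nn_integral_fst[symmetric] split_beta')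
qed

lemma nn_integral_complex_gaussian:
  assumes [measurable]: "f \<in> borel_measurable borel"
  shows "(\<integral>\<^sup>+z. f z \<partial>complex_gaussian m v) =
    (\<integral>\<^sup>+z. ennreal (exp (- (cmod (z - m))\<^sup>2 / v) / (pi * v)) * f z \<partial>lborel)"
  unfolding complex_gaussian_def by (subst nn_integral_density) auto

abbreviation "std_gaussian \<equiv> complex_gaussian 0 1"

abbreviation "std_gaussian_vec J \<equiv> Pi\<^sub>M J (\<lambda>_. std_gaussian)"

text \<open>The density \<open>exp (-|z|^2) / pi\<close> factors into two real normal densities of
  variance 1/2, one for each part; hence the parameter \<open>sqrt (1/2)\<close>.\<close>

lemma nn_integral_std_gaussian_Complex:
  assumes [measurable]: "f \<in> borel_measurable borel"
  shows "(\<integral>\<^sup>+z. f z \<partial>std_gaussian) =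
    (\<integral>\<^sup>+x. ennreal (normal_density 0 (sqrt (1/2)) x) *
      (\<integral>\<^sup>+y. ennreal (normal_density 0 (sqrt (1/2)) y) * f (Complex x y) \<partial>lborel) \<partial>lborel)"
proof -
  have [measurable]: "(\<lambda>p. f (Complex (fst p) (snd p))) \<in> borel_measurable (lborel \<Otimes>\<^sub>M lborel)"
    unfolding Complex_eq by measurable
  have [measurable]: "(\<lambda>y. f (Complex x y)) \<in> borel_measurable lborel" for x
    unfolding Complex_eq by measurable
  have eq: "exp (- (cmod (Complex x y))\<^sup>2) / pi
      = normal_density 0 (sqrt (1/2)) x * normal_density 0 (sqrt (1/2)) y" for x y
    by (simp add: normal_density_def cmod_power2 exp_add[symmetric] algebra_simps)
  show ?thesis
    by (subst nn_integral_complex_gaussian, simp, subst nn_integral_lborel_complex)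
       (auto simp: eq ennreal_mult mult.assoc intro!: nn_integral_cong nn_integral_cmult)
qed

lemma nn_integral_std_gaussian_Re:
  assumes [measurable]: "f \<in> borel_measurable borel"
  shows "(\<integral>\<^sup>+z. f (Re z) \<partial>std_gaussian) =
    (\<integral>\<^sup>+x. ennreal (normal_density 0 (sqrt (1/2)) x) * f x \<partial>lborel)"
proof -
  have one: "(\<integral>\<^sup>+y. ennreal (normal_density 0 (sqrt (1/2)) y) \<partial>lborel) = 1"
    using prob_space.emeasure_space_1[OF prob_space_normal_density[of "sqrt (1/2)" 0]]
    by (simp add: emeasure_density)
  show ?thesis
    by (subst nn_integral_std_gaussian_Complex) (auto simp: one nn_integral_multc)
qed

lemma prob_space_std_gaussian: "prob_space std_gaussian"
proof
  have "emeasure std_gaussian UNIV = (\<integral>\<^sup>+z. 1 \<partial>std_gaussian)" by simp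
  also have "\<dots> = 1"
    using prob_space.emeasure_space_1[OF prob_space_normal_density[of "sqrt (1/2)" 0]]
    by (subst nn_integral_std_gaussian_Re) (auto simp: emeasure_density)
  finally show "emeasure std_gaussian (space std_gaussian) = 1" by simp
qed

text \<open>An even moment of a real normal variable carries \<open>(2 / sigma^2) ^ m\<close> in the
  denominator, and \<open>sigma^2 = 1/2\<close> turns this into \<open>4 ^ m\<close>.\<close>

lemma nn_integral_std_gaussian_moment:
  "(\<integral>\<^sup>+z. ennreal ((Re z) ^ (2 * m)) \<partial>std_gaussian) = ennreal (fact (2 * m) / (4 ^ m * fact m))"
proof -
  have "(\<integral>\<^sup>+z. ennreal ((Re z) ^ (2 * m)) \<partial>std_gaussian) =
    (\<integral>\<^sup>+x. ennreal (normal_density 0 (sqrt (1/2)) x * (x - 0) ^ (2 * m)) \<partial>lborel)"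
    by (subst nn_integral_std_gaussian_Re[where f="\<lambda>x. ennreal (x ^ (2*m))"]) (auto simp: ennreal_mult)
  also have "\<dots> = ennreal (fact (2 * m) / ((2 / (sqrt (1/2))\<^sup>2) ^ m * fact m))"
    using normal_moment_even[of "sqrt (1/2)" 0 m]
    by (subst nn_integral_eq_integral) (auto simp: has_bochner_integral_iff)
  finally show ?thesis by (simp add: real_sqrt_divide power_divide)
qed

text \<open>The plane substitution by \<open>m + sqrt v * z\<close> has Jacobian v, the square of
  the real scaling factor; it cancels the v in the normalisation of the density.\<close>

lemma complex_gaussian_affine:
  assumes v: "0 < v" and [measurable]: "f \<in> borel_measurable borel"
  shows "(\<integral>\<^sup>+z. f z \<partial>complex_gaussian m v) = (\<integral>\<^sup>+z. f (m + of_real (sqrt v) * z) \<partial>std_gaussian)"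
proof -
  let ?T = "\<lambda>z. m + of_real (sqrt v) * z"
  have "(\<integral>\<^sup>+z. f z \<partial>complex_gaussian m v) =
     (\<integral>\<^sup>+z. ennreal v * (ennreal (exp (- (cmod (?T z - m))\<^sup>2 / v) / (pi * v)) * f (?T z)) \<partial>lborel)"
    using v by (subst nn_integral_complex_gaussian, simp, subst lborel_affine[of "sqrt v" m])
      (auto simp: nn_integral_density nn_integral_distr scaleR_conv_of_real)
  also have "\<dots> = (\<integral>\<^sup>+z. ennreal (exp (- (cmod z)\<^sup>2) / pi) * f (?T z) \<partial>lborel)"
    using v by (intro nn_integral_cong)
      (auto simp: norm_mult power_mult_distrib ennreal_mult[symmetric] mult.assoc[symmetric])
  finally show ?thesis by (subst (2) nn_integral_complex_gaussian) auto
qed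

lemma prob_space_complex_gaussian: assumes "0 < v" shows "prob_space (complex_gaussian m v)"
proof
  have "emeasure (complex_gaussian m v) UNIV = (\<integral>\<^sup>+z. 1 \<partial>complex_gaussian m v)" by simp
  also have "\<dots> = 1"
    using prob_space.emeasure_space_1[OF prob_space_std_gaussian]
    by (subst complex_gaussian_affine[OF assms]) auto
  finally show "emeasure (complex_gaussian m v) (space (complex_gaussian m v)) = 1" by simp
qed

section \<open>Shears, unimodular maps and special unitary maps of C^2\<close>

lemma nn_integral_swap:
  assumes "prob_space M \<or> sigma_finite_measure M" "prob_space N \<or> sigma_finite_measure N"
    and "(\<lambda>(x, y). f x y) \<in> borel_measurable (M \<Otimes>\<^sub>M N)"
  shows "(\<integral>\<^sup>+x. \<integral>\<^sup>+y. f x y \<partial>N \<partial>M) = (\<integral>\<^sup>+y. \<integral>\<^sup>+x. f x y \<partial>M \<partial>N)"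
proof -
  have "sigma_finite_measure M" "sigma_finite_measure N"
    using assms by (auto simp: prob_space_imp_sigma_finite)
  then interpret pair_sigma_finite M N by (simp add: pair_sigma_finite_def)
  show ?thesis using Fubini'[OF assms(3)] by simp
qed

lemma nn_integral_lborel_shift:
  fixes c :: "'a::euclidean_space"
  assumes [measurable]: "f \<in> borel_measurable borel"
  shows "(\<integral>\<^sup>+z. f (z + c) \<partial>lborel) = (\<integral>\<^sup>+z. f z \<partial>lborel)"
  by (subst (2) lborel_distr_plus[of c, symmetric]) (simp add: nn_integral_distr add.commute)

lemma lborel_shear1:
  fixes F :: "complex \<Rightarrow> complex \<Rightarrow> ennreal"
  assumes [measurable]: "(\<lambda>(z, w). F z w) \<in> borel_measurable (borel \<Otimes>\<^sub>M borel)"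
  shows "(\<integral>\<^sup>+w. \<integral>\<^sup>+z. F (z + p * w) w \<partial>lborel \<partial>lborel) = (\<integral>\<^sup>+w. \<integral>\<^sup>+z. F z w \<partial>lborel \<partial>lborel)"
  by (intro nn_integral_cong nn_integral_lborel_shift) measurable

lemma lborel_shear2:
  fixes F :: "complex \<Rightarrow> complex \<Rightarrow> ennreal"
  assumes [measurable]: "(\<lambda>(z, w). F z w) \<in> borel_measurable (borel \<Otimes>\<^sub>M borel)"
  shows "(\<integral>\<^sup>+w. \<integral>\<^sup>+z. F z (w + p * z) \<partial>lborel \<partial>lborel) = (\<integral>\<^sup>+w. \<integral>\<^sup>+z. F z w \<partial>lborel \<partial>lborel)"
proof -
  have "(\<integral>\<^sup>+w. \<integral>\<^sup>+z. F z (w + p * z) \<partial>lborel \<partial>lborel) = (\<integral>\<^sup>+z. \<integral>\<^sup>+w. F z (w + p * z) \<partial>lborel \<partial>lborel)"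
    by (rule nn_integral_swap) (auto simp: sigma_finite_lborel)
  also have "\<dots> = (\<integral>\<^sup>+z. \<integral>\<^sup>+w. F z w \<partial>lborel \<partial>lborel)"
    by (intro nn_integral_cong nn_integral_lborel_shift) measurable
  also have "\<dots> = (\<integral>\<^sup>+w. \<integral>\<^sup>+z. F z w \<partial>lborel \<partial>lborel)"
    by (rule nn_integral_swap) (auto simp: sigma_finite_lborel)
  finally show ?thesis .
qed

text \<open>A matrix of determinant 1 with nonzero lower left entry is a product of three shears,
  and a shear is a translation of one variable while the other is held fixed.\<close>

lemma lborel_det1:
  fixes F :: "complex \<Rightarrow> complex \<Rightarrow> ennreal"
  assumes [measurable]: "(\<lambda>(z, w). F z w) \<in> borel_measurable (borel \<Otimes>\<^sub>M borel)"
    and c: "c \<noteq> 0" and det: "a * d - b * c = 1"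
  shows "(\<integral>\<^sup>+w. \<integral>\<^sup>+z. F (a * z + b * w) (c * z + d * w) \<partial>lborel \<partial>lborel)
    = (\<integral>\<^sup>+w. \<integral>\<^sup>+z. F z w \<partial>lborel \<partial>lborel)"
proof -
  \<comment> \<open>Upper shear by p, lower shear by c, upper shear by q: comparing the diagonal of
    the product with a and d gives these values, and the determinant condition then forces the entry
    b.\<close>
  define p q where "p = (a - 1) / c" and "q = (d - 1) / c"
  have *: "z + q * w + p * (c * z + d * w) = a * z + b * w" "w + c * (z + q * w) = c * z + d * w" for z w
  proof -
    have pq: "c * p = a - 1" "c * q = d - 1" using c by (auto simp: p_def q_def)
    show 2: "w + c * (z + q * w) = c * z + d * w"
      using pq(2) by (simp add: distrib_left mult.assoc[symmetric]) (simp add: algebra_simps)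
    have "c * (z + q * w + p * (c * z + d * w)) = c * z + (c * q) * w + (c * p) * (c * z + d * w)"
      by (simp add: algebra_simps)
    also have "\<dots> = a * c * z + (a * d - 1) * w" unfolding pq by (simp add: algebra_simps)
    also have "a * d - 1 = b * c" using det by (simp add: algebra_simps)
    finally have "c * (z + q * w + p * (c * z + d * w)) = c * (a * z + b * w)" by (simp add: algebra_simps)
    then show "z + q * w + p * (c * z + d * w) = a * z + b * w" using c by simp
  qed
  have "(\<integral>\<^sup>+w. \<integral>\<^sup>+z. F (z + q * w + p * (w + c * (z + q * w))) (w + c * (z + q * w)) \<partial>lborel \<partial>lborel)
    = (\<integral>\<^sup>+w. \<integral>\<^sup>+z. F (z + p * (w + c * z)) (w + c * z) \<partial>lborel \<partial>lborel)"
    by (rule lborel_shear1[of "\<lambda>z w. F (z + p * (w + c * z)) (w + c * z)"]) measurable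
  also have "\<dots> = (\<integral>\<^sup>+w. \<integral>\<^sup>+z. F (z + p * w) w \<partial>lborel \<partial>lborel)"
    by (rule lborel_shear2[of "\<lambda>z w. F (z + p * w) w"]) measurable
  also have "\<dots> = (\<integral>\<^sup>+w. \<integral>\<^sup>+z. F z w \<partial>lborel \<partial>lborel)"
    by (rule lborel_shear1) measurable
  finally show ?thesis by (simp only: *)
qed

lemma lborel_special_unitary:
  fixes F :: "complex \<Rightarrow> complex \<Rightarrow> ennreal"
  assumes [measurable]: "(\<lambda>(z, w). F z w) \<in> borel_measurable (borel \<Otimes>\<^sub>M borel)"
    and ab: "a * cnj a + b * cnj b = 1"
  shows "(\<integral>\<^sup>+w. \<integral>\<^sup>+z. F (a * z + b * w) (- cnj b * z + cnj a * w) \<partial>lborel \<partial>lborel)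
    = (\<integral>\<^sup>+w. \<integral>\<^sup>+z. F z w \<partial>lborel \<partial>lborel)"
proof (cases "b = 0")
  case False
  then show ?thesis using ab by (intro lborel_det1) auto
next
  case True
  with ab have a: "a * cnj a = 1" by simp
  \<comment> \<open>A diagonal matrix has lower left entry 0, so the three-shear factorisation does
    not reach it. It is written as a product of two antidiagonal matrices of determinant 1, to which
    the factorisation applies.\<close>
  have "(\<integral>\<^sup>+w. \<integral>\<^sup>+z. F (0 * (0 * z + (-1) * w) + a * (1 * z + 0 * w))
          (- cnj a * (0 * z + (-1) * w) + 0 * (1 * z + 0 * w)) \<partial>lborel \<partial>lborel)
    = (\<integral>\<^sup>+w. \<integral>\<^sup>+z. F (0 * z + a * w) (- cnj a * z + 0 * w) \<partial>lborel \<partial>lborel)"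
    by (rule lborel_det1[of "\<lambda>z w. F (0 * z + a * w) (- cnj a * z + 0 * w)"]) auto
  also have "\<dots> = (\<integral>\<^sup>+w. \<integral>\<^sup>+z. F z w \<partial>lborel \<partial>lborel)"
    using a by (intro lborel_det1) auto
  finally show ?thesis using True by simp
qed

lemma special_unitary_norm:
  assumes ab: "a * cnj a + b * cnj b = 1"
  shows "(cmod (a * z + b * w))\<^sup>2 + (cmod (- cnj b * z + cnj a * w))\<^sup>2 = (cmod z)\<^sup>2 + (cmod w)\<^sup>2"
proof -
  have "complex_of_real ((cmod (a * z + b * w))\<^sup>2 + (cmod (- cnj b * z + cnj a * w))\<^sup>2)
    = (a * cnj a + b * cnj b) * (z * cnj z + w * cnj w)"
    by (simp only: of_real_add complex_norm_square) (simp add: algebra_simps)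
  also have "\<dots> = complex_of_real ((cmod z)\<^sup>2 + (cmod w)\<^sup>2)"
    by (simp only: ab of_real_add complex_norm_square) simp
  finally show ?thesis by (simp only: of_real_eq_iff)
qed

text \<open>The joint density is a function of |z|^2 + |w|^2, which a unitary map preserves. It can
  therefore be absorbed into the integrand, as in \<open>H\<close>, and invariance of Lebesgue
  measure finishes the argument.\<close>

lemma std_gaussian_special_unitary:
  fixes K :: "complex \<Rightarrow> complex \<Rightarrow> ennreal"
  assumes [measurable]: "(\<lambda>(z, w). K z w) \<in> borel_measurable (borel \<Otimes>\<^sub>M borel)"
    and ab: "a * cnj a + b * cnj b = 1"
  shows "(\<integral>\<^sup>+z. \<integral>\<^sup>+w. K (a * z + b * w) (- cnj b * z + cnj a * w) \<partial>std_gaussian \<partial>std_gaussian)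
    = (\<integral>\<^sup>+z. \<integral>\<^sup>+w. K z w \<partial>std_gaussian \<partial>std_gaussian)"
proof -
  let ?G = "std_gaussian"
  note norm = special_unitary_norm[OF ab]
  have dens: "(\<integral>\<^sup>+z. \<integral>\<^sup>+w. K z w \<partial>?G \<partial>?G) =
    (\<integral>\<^sup>+w. \<integral>\<^sup>+z. ennreal (exp (- ((cmod z)\<^sup>2 + (cmod w)\<^sup>2)) / pi\<^sup>2) * K z w \<partial>lborel \<partial>lborel)"
    if [measurable]: "(\<lambda>(z, w). K z w) \<in> borel_measurable (borel \<Otimes>\<^sub>M borel)" for K :: "complex \<Rightarrow> complex \<Rightarrow> ennreal"
  proof -
    have "(\<integral>\<^sup>+z. \<integral>\<^sup>+w. K z w \<partial>?G \<partial>?G) = (\<integral>\<^sup>+w. \<integral>\<^sup>+z. K z w \<partial>?G \<partial>?G)"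
      by (rule nn_integral_swap) (auto simp: prob_space_std_gaussian)
    also have "\<dots> = (\<integral>\<^sup>+w. ennreal (exp (- (cmod w)\<^sup>2) / pi) *
       (\<integral>\<^sup>+z. ennreal (exp (- (cmod z)\<^sup>2) / pi) * K z w \<partial>lborel) \<partial>lborel)"
      by (simp add: nn_integral_complex_gaussian)
    also have "\<dots> = (\<integral>\<^sup>+w. \<integral>\<^sup>+z. ennreal (exp (- (cmod w)\<^sup>2) / pi) *
       (ennreal (exp (- (cmod z)\<^sup>2) / pi) * K z w) \<partial>lborel \<partial>lborel)"
      by (intro nn_integral_cong nn_integral_cmult[symmetric]) auto
    also have "\<dots> = (\<integral>\<^sup>+w. \<integral>\<^sup>+z. ennreal (exp (- ((cmod z)\<^sup>2 + (cmod w)\<^sup>2)) / pi\<^sup>2) * K z w \<partial>lborel \<partial>lborel)"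
      by (intro nn_integral_cong)
        (simp add: mult.assoc[symmetric] ennreal_mult[symmetric] exp_add[symmetric] power2_eq_square[of pi] add.commute)
    finally show ?thesis .
  qed
  define H where "H z w = ennreal (exp (- ((cmod z)\<^sup>2 + (cmod w)\<^sup>2)) / pi\<^sup>2) * K z w" for z w
  have [measurable]: "(\<lambda>(z, w). H z w) \<in> borel_measurable (borel \<Otimes>\<^sub>M borel)"
    unfolding H_def by measurable
  have "(\<integral>\<^sup>+z. \<integral>\<^sup>+w. K (a * z + b * w) (- cnj b * z + cnj a * w) \<partial>?G \<partial>?G)
     = (\<integral>\<^sup>+w. \<integral>\<^sup>+z. H (a * z + b * w) (- cnj b * z + cnj a * w) \<partial>lborel \<partial>lborel)"
    unfolding H_def norm by (rule dens) measurable
  also have "\<dots> = (\<integral>\<^sup>+w. \<integral>\<^sup>+z. H z w \<partial>lborel \<partial>lborel)"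
    by (rule lborel_special_unitary[OF _ ab]) measurable
  also have "\<dots> = (\<integral>\<^sup>+z. \<integral>\<^sup>+w. K z w \<partial>?G \<partial>?G)"
    unfolding H_def by (rule dens[symmetric]) measurable
  finally show ?thesis .
qed

text \<open>The vector (c, d) divided by its length is the first row of a special unitary matrix.
  The integrand sees only a linear form and the squared norm, the two quantities on which all later
  functionals depend.\<close>

lemma std_gaussian_rotation2:
  fixes F :: "complex \<Rightarrow> real \<Rightarrow> ennreal" and c d :: complex
  assumes [measurable]: "(\<lambda>(z, r). F z r) \<in> borel_measurable (borel \<Otimes>\<^sub>M borel)"
  shows "(\<integral>\<^sup>+z. \<integral>\<^sup>+w. F (c * z + d * w) ((cmod z)\<^sup>2 + (cmod w)\<^sup>2) \<partial>std_gaussian \<partial>std_gaussian)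
    = (\<integral>\<^sup>+z. \<integral>\<^sup>+w. F (of_real (sqrt ((cmod c)\<^sup>2 + (cmod d)\<^sup>2)) * z) ((cmod z)\<^sup>2 + (cmod w)\<^sup>2)
        \<partial>std_gaussian \<partial>std_gaussian)"
proof (cases "c = 0 \<and> d = 0")
  case False
  define r where "r = sqrt ((cmod c)\<^sup>2 + (cmod d)\<^sup>2)"
  have r2: "r\<^sup>2 = (cmod c)\<^sup>2 + (cmod d)\<^sup>2" by (simp add: r_def)
  have r: "r > 0"
    using False by (auto simp: r_def sum_power2_gt_zero_iff)
  define a b where "a = c / of_real r" and "b = d / of_real r"
  have cd: "c = of_real r * a" "d = of_real r * b" using r by (auto simp: a_def b_def)
  have "of_real (r\<^sup>2) * (a * cnj a + b * cnj b) = c * cnj c + d * cnj d"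
    by (simp add: cd power2_eq_square algebra_simps)
  also have "\<dots> = of_real (r\<^sup>2)" unfolding r2 by (simp only: of_real_add complex_norm_square)
  finally have ab: "a * cnj a + b * cnj b = 1" using r by simp
  note norm = special_unitary_norm[OF ab]
  have "c * z + d * w = of_real r * (a * z + b * w)" for z w by (simp add: cd algebra_simps)
  then show ?thesis
    using std_gaussian_special_unitary[OF _ ab, of "\<lambda>z w. F (of_real r * z) ((cmod z)\<^sup>2 + (cmod w)\<^sup>2)"]
    unfolding norm r_def[symmetric] by simp
qed auto

text \<open>Multiplication by a phase a has determinant a. A dummy second coordinate that receives
  the opposite phase restores determinant 1, and integrating it out changes nothing.\<close>

lemma std_gaussian_phase:
  fixes F :: "complex \<Rightarrow> real \<Rightarrow> ennreal" and c :: complex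
  assumes [measurable]: "(\<lambda>(z, r). F z r) \<in> borel_measurable (borel \<Otimes>\<^sub>M borel)"
  shows "(\<integral>\<^sup>+z. F (c * z) ((cmod z)\<^sup>2) \<partial>std_gaussian)
    = (\<integral>\<^sup>+z. F (of_real (cmod c) * z) ((cmod z)\<^sup>2) \<partial>std_gaussian)"
proof -
  interpret prob_space "std_gaussian" by (rule prob_space_std_gaussian)
  define a where "a = (if c = 0 then 1 else c / of_real (cmod c))"
  have na: "cmod a = 1" by (simp add: a_def norm_divide)
  then have a: "a * cnj a + 0 * cnj 0 = 1"
    using complex_norm_square[of a] by simp
  have c: "c = of_real (cmod c) * a" by (simp add: a_def)
  show ?thesis
    using std_gaussian_special_unitary[OF _ a, of "\<lambda>z w. F (of_real (cmod c) * z) ((cmod z)\<^sup>2)"] c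
    by (simp add: emeasure_space_1[simplified] norm_mult na mult.assoc[symmetric])
qed

section \<open>Rotation of Gaussian vectors over a finite index set\<close>

interpretation std: product_sigma_finite "\<lambda>_. std_gaussian"
  by (simp add: product_sigma_finite_def prob_space_std_gaussian prob_space_imp_sigma_finite)

lemma prob_space_std_vec: "prob_space (std_gaussian_vec J)"
  by (rule prob_space_PiM) (rule prob_space_std_gaussian)

interpretation std_vec: prob_space "std_gaussian_vec J" for J
  by (rule prob_space_std_vec)

text \<open>Induction over the coordinates: the new coordinate y is merged with z by a
  two-dimensional rotation, which replaces c by \<open>r\<close>, and the hypothesis then absorbs
  the remaining linear form. For this both c and F vary in the induction.\<close>

lemma std_gaussian_rotation:
  fixes F :: "complex \<Rightarrow> real \<Rightarrow> ennreal" and c :: complex and u :: "'i \<Rightarrow> complex"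
  assumes "finite J" and "(\<lambda>(z, r). F z r) \<in> borel_measurable (borel \<Otimes>\<^sub>M borel)"
  shows "(\<integral>\<^sup>+z. \<integral>\<^sup>+w. F (c * z + (\<Sum>i\<in>J. u i * w i)) ((cmod z)\<^sup>2 + (\<Sum>i\<in>J. (cmod (w i))\<^sup>2))
      \<partial>std_gaussian_vec J \<partial>std_gaussian)
    = (\<integral>\<^sup>+z. \<integral>\<^sup>+w. F (of_real (sqrt ((cmod c)\<^sup>2 + (\<Sum>i\<in>J. (cmod (u i))\<^sup>2))) * z)
        ((cmod z)\<^sup>2 + (\<Sum>i\<in>J. (cmod (w i))\<^sup>2)) \<partial>std_gaussian_vec J \<partial>std_gaussian)"
  using assms
proof (induction J arbitrary: F c)
  case (empty F c)
  note [measurable] = empty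
  have "(\<integral>\<^sup>+z. F (c * z) ((cmod z)\<^sup>2) \<partial>std_gaussian) =
    (\<integral>\<^sup>+z. F (of_real (cmod c) * z) ((cmod z)\<^sup>2) \<partial>std_gaussian)"
    by (rule std_gaussian_phase) measurable
  then show ?case by (simp add: prob_space.emeasure_space_1[OF prob_space_std_vec])
next
  case (insert j J F c)
  let ?G = "std_gaussian" and ?GJ = "std_gaussian_vec J"
  let ?R = "\<lambda>w::'i \<Rightarrow> complex. \<Sum>i\<in>J. (cmod (w i))\<^sup>2" and ?L = "\<lambda>w. \<Sum>i\<in>J. u i * w i"
  note [measurable] = insert.prems
  note fin = insert.hyps
  note sw = nn_integral_swap[OF disjI1 disjI1, OF prob_space_std_gaussian prob_space_std_vec]
  define r where "r = sqrt ((cmod c)\<^sup>2 + (cmod (u j))\<^sup>2)"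
  define r' where "r' = sqrt ((cmod c)\<^sup>2 + (\<Sum>i\<in>insert j J. (cmod (u i))\<^sup>2))"
  have [simp]: "(\<Sum>i\<in>J. u i * (if i = j then y else w i)) = ?L w"
    "(\<Sum>i\<in>J. (cmod (if i = j then y else w i))\<^sup>2) = ?R w" for w y
    using fin by (auto intro!: sum.cong)
  have "(\<integral>\<^sup>+z. \<integral>\<^sup>+w. F (c * z + (\<Sum>i\<in>insert j J. u i * w i)) ((cmod z)\<^sup>2 + (\<Sum>i\<in>insert j J. (cmod (w i))\<^sup>2))
      \<partial>std_gaussian_vec (insert j J) \<partial>?G)
     = (\<integral>\<^sup>+z. \<integral>\<^sup>+w. \<integral>\<^sup>+y. F (c * z + (u j * y + ?L w)) ((cmod z)\<^sup>2 + ((cmod y)\<^sup>2 + ?R w))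
      \<partial>?G \<partial>?GJ \<partial>?G)"
    using fin by (intro nn_integral_cong, subst std.product_nn_integral_insert) auto
  also have "\<dots> = (\<integral>\<^sup>+w. \<integral>\<^sup>+z. \<integral>\<^sup>+y. F (c * z + (u j * y + ?L w)) ((cmod z)\<^sup>2 + ((cmod y)\<^sup>2 + ?R w))
      \<partial>?G \<partial>?G \<partial>?GJ)"
    by (rule sw) measurable
  also have "\<dots> = (\<integral>\<^sup>+w. \<integral>\<^sup>+z. \<integral>\<^sup>+y. F (of_real r * z + ?L w) ((cmod z)\<^sup>2 + (cmod y)\<^sup>2 + ?R w)
      \<partial>?G \<partial>?G \<partial>?GJ)"
  proof (rule nn_integral_cong)
    fix w :: "'i \<Rightarrow> complex"
    show "(\<integral>\<^sup>+z. \<integral>\<^sup>+y. F (c * z + (u j * y + ?L w)) ((cmod z)\<^sup>2 + ((cmod y)\<^sup>2 + ?R w)) \<partial>?G \<partial>?G)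
      = (\<integral>\<^sup>+z. \<integral>\<^sup>+y. F (of_real r * z + ?L w) ((cmod z)\<^sup>2 + (cmod y)\<^sup>2 + ?R w) \<partial>?G \<partial>?G)"
      using std_gaussian_rotation2[of "\<lambda>a s. F (a + ?L w) (s + ?R w)" c "u j"]
      unfolding r_def by (simp add: add.assoc)
  qed
  also have "\<dots> = (\<integral>\<^sup>+z. \<integral>\<^sup>+w. \<integral>\<^sup>+y. F (of_real r * z + ?L w) ((cmod z)\<^sup>2 + (cmod y)\<^sup>2 + ?R w)
      \<partial>?G \<partial>?GJ \<partial>?G)"
    by (rule sw[symmetric]) measurable
  also have "\<dots> = (\<integral>\<^sup>+z. \<integral>\<^sup>+y. \<integral>\<^sup>+w. F (of_real r * z + ?L w) ((cmod z)\<^sup>2 + (cmod y)\<^sup>2 + ?R w)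
      \<partial>?GJ \<partial>?G \<partial>?G)"
    by (intro nn_integral_cong sw[symmetric]) measurable
  also have "\<dots> = (\<integral>\<^sup>+y. \<integral>\<^sup>+z. \<integral>\<^sup>+w. F (of_real r * z + ?L w) ((cmod z)\<^sup>2 + (cmod y)\<^sup>2 + ?R w)
      \<partial>?GJ \<partial>?G \<partial>?G)"
    by (rule nn_integral_swap) (auto simp: prob_space_std_gaussian prob_space_std_vec)
  also have "\<dots> = (\<integral>\<^sup>+y. \<integral>\<^sup>+z. \<integral>\<^sup>+w. F (of_real r' * z) ((cmod z)\<^sup>2 + (cmod y)\<^sup>2 + ?R w)
      \<partial>?GJ \<partial>?G \<partial>?G)"
  proof (rule nn_integral_cong)
    fix y :: complex
    have r2: "sqrt ((cmod (complex_of_real r))\<^sup>2 + (\<Sum>i\<in>J. (cmod (u i))\<^sup>2)) = r'"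
      using fin by (simp add: r_def r'_def add.assoc)
    show "(\<integral>\<^sup>+z. \<integral>\<^sup>+w. F (of_real r * z + ?L w) ((cmod z)\<^sup>2 + (cmod y)\<^sup>2 + ?R w) \<partial>?GJ \<partial>?G)
      = (\<integral>\<^sup>+z. \<integral>\<^sup>+w. F (of_real r' * z) ((cmod z)\<^sup>2 + (cmod y)\<^sup>2 + ?R w) \<partial>?GJ \<partial>?G)"
      \<comment> \<open>The hypothesis is used with y fixed, |y|^2 being a constant shift of the
        norm argument.\<close>
      using insert.IH[of "\<lambda>z s. F z (s + (cmod y)\<^sup>2)" "of_real r"] unfolding r2
      by (simp add: add_ac)
  qed
  also have "\<dots> = (\<integral>\<^sup>+z. \<integral>\<^sup>+y. \<integral>\<^sup>+w. F (of_real r' * z) ((cmod z)\<^sup>2 + (cmod y)\<^sup>2 + ?R w)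
      \<partial>?GJ \<partial>?G \<partial>?G)"
    by (rule nn_integral_swap) (auto simp: prob_space_std_gaussian prob_space_std_vec)
  also have "\<dots> = (\<integral>\<^sup>+z. \<integral>\<^sup>+w. F (of_real r' * z) ((cmod z)\<^sup>2 + (\<Sum>i\<in>insert j J. (cmod (w i))\<^sup>2))
      \<partial>std_gaussian_vec (insert j J) \<partial>?G)"
    using fin by (intro nn_integral_cong, subst std.product_nn_integral_insert_rev) (auto simp: add_ac)
  finally show ?case unfolding r'_def .
qed

subsection \<open>Moments of the direction of a Gaussian vector\<close>

lemma nn_integral_power_times_exp:
  assumes c: "0 < c"
  shows "(\<integral>\<^sup>+x. ennreal (x ^ k * exp (- c * x)) * indicator {0<..} x \<partial>lborel) = ennreal (fact k / c ^ Suc k)"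
proof -
  have "(\<integral>\<^sup>+x. ennreal (x ^ k * exp (- c * x)) * indicator {0<..} x \<partial>lborel) =
     (\<integral>\<^sup>+x. ennreal (x ^ k * exp (- c * x)) * indicator {0..} x \<partial>lborel)"
  proof (rule nn_integral_cong_AE)
    have "AE x in lborel. x \<noteq> (0::real)" by (rule AE_lborel_singleton)
    then show "AE x in lborel. ennreal (x ^ k * exp (- c * x)) * indicator {0<..} x =
      ennreal (x ^ k * exp (- c * x)) * indicator {0..} x"
      by eventually_elim (auto simp: indicator_def)
  qed
  also have "\<dots> = ennreal (1 / c) * (\<integral>\<^sup>+x. ennreal ((x / c) ^ k * exp (- x)) * indicator {0..} x \<partial>lborel)"
    using c by (subst nn_integral_real_affine[of _ "1 / c" 0])
      (auto intro!: arg_cong2[where f="(*)"] nn_integral_cong simp: indicator_def field_simps)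
  also have "\<dots> = ennreal (1 / c) * (\<integral>\<^sup>+x. ennreal (1 / c ^ k) * (ennreal (x ^ k * exp (- x)) * indicator {0..} x) \<partial>lborel)"
    using c by (intro arg_cong[where f="\<lambda>x. ennreal (1 / c) * x"] nn_integral_cong)
      (auto simp: indicator_def ennreal_mult[symmetric] power_divide)
  also have "\<dots> = ennreal (1 / c) * (ennreal (1 / c ^ k) * ennreal (fact k))"
    by (subst nn_integral_cmult) (auto simp: nn_intergal_power_times_exp_Ici)
  also have "\<dots> = ennreal (fact k / c ^ Suc k)"
    using c by (simp add: ennreal_mult[symmetric] del: ennreal_fact)
  finally show ?thesis .
qed

text \<open>This is the beta integral B(m + 1, n). The power
  \<open>1 / (1 + x) ^ (n + m + 1)\<close> is itself a Gamma integral in u, up to (n + m)!; after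
  exchanging the order, the integrals over x and then over u are Gamma integrals as well.\<close>

lemma nn_integral_beta_prime:
  assumes n: "1 \<le> n"
  shows "(\<integral>\<^sup>+x. ennreal (x ^ m * (1 / (1 + x)) ^ (n + Suc m)) * indicator {0<..} x \<partial>lborel)
    = ennreal (fact m * fact (n - 1) / fact (n + m))"
proof -
  let ?k = "\<lambda>x u. ennreal (1 / fact (n + m)) * (ennreal (x ^ m) * indicator {0<..} x * (ennreal (u ^ (n + m) * exp (- (1 + x) * u)) * indicator {0<..} u))"
  have "(\<integral>\<^sup>+x. ennreal (x ^ m * (1 / (1 + x)) ^ (n + Suc m)) * indicator {0<..} x \<partial>lborel) =
    (\<integral>\<^sup>+x. \<integral>\<^sup>+u. ?k x u \<partial>lborel \<partial>lborel)"
  proof (rule nn_integral_cong)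
    fix x :: real
    show "ennreal (x ^ m * (1 / (1 + x)) ^ (n + Suc m)) * indicator {0<..} x =
      (\<integral>\<^sup>+u. ?k x u \<partial>lborel)"
    proof (cases "0 < x")
      case True
      then show ?thesis
        by (subst nn_integral_cmult, simp, subst nn_integral_cmult, simp, subst nn_integral_power_times_exp)
          (auto simp: ennreal_mult[symmetric] power_one_over divide_simps)
    qed auto
  qed
  also have "\<dots> = (\<integral>\<^sup>+u. \<integral>\<^sup>+x. ?k x u \<partial>lborel \<partial>lborel)"
    by (rule nn_integral_swap) (auto simp: sigma_finite_lborel)
  also have "\<dots> = (\<integral>\<^sup>+u. ennreal (1 / fact (n + m)) * ennreal (fact m) * (ennreal (u ^ (n - 1) * exp (- 1 * u)) * indicator {0<..} u) \<partial>lborel)"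
  proof (rule nn_integral_cong)
    fix u :: real
    show "(\<integral>\<^sup>+x. ?k x u \<partial>lborel)
      = ennreal (1 / fact (n + m)) * ennreal (fact m) * (ennreal (u ^ (n - 1) * exp (- 1 * u)) * indicator {0<..} u)"
    proof (cases "0 < u")
      case True
      have "u ^ (n + m) = u ^ (n - 1) * u ^ Suc m" using n by (simp del: power_Suc flip: power_add)
      then have *: "u ^ (n + m) * exp (- (1 + x) * u) * x ^ m = (u ^ (n - 1) * exp (- u) * u ^ Suc m) * (x ^ m * exp (- u * x))" for x
        by (simp add: algebra_simps exp_add[symmetric])
      have "(\<integral>\<^sup>+x. ?k x u \<partial>lborel)
        = (\<integral>\<^sup>+x. ennreal (1 / fact (n + m)) * (ennreal (u ^ (n - 1) * exp (- u) * u ^ Suc m) * (ennreal (x ^ m * exp (- u * x)) * indicator {0<..} x)) \<partial>lborel)"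
      proof (rule nn_integral_cong)
        fix x :: real
        show "?k x u
          = ennreal (1 / fact (n + m)) * (ennreal (u ^ (n - 1) * exp (- u) * u ^ Suc m) * (ennreal (x ^ m * exp (- u * x)) * indicator {0<..} x))"
        proof (cases "0 < x")
          case x: True
          have "ennreal (x ^ m) * ennreal (u ^ (n + m) * exp (- (1 + x) * u)) =
            ennreal (u ^ (n - 1) * exp (- u) * u ^ Suc m) * ennreal (x ^ m * exp (- u * x))"
            using x True *[of x] by (simp only: ennreal_mult[symmetric] zero_le_power less_imp_le mult_nonneg_nonneg exp_ge_zero mult.commute)
          then show ?thesis using x True by simp
        qed simp
      qed
      also have "\<dots> = ennreal (1 / fact (n + m)) * (ennreal (u ^ (n - 1) * exp (- u) * u ^ Suc m) * ennreal (fact m / u ^ Suc m))"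
        using True by (subst nn_integral_cmult, simp, subst nn_integral_cmult, simp, subst nn_integral_power_times_exp) auto
      also have "\<dots> = ennreal (1 / fact (n + m)) * ennreal (fact m) * (ennreal (u ^ (n - 1) * exp (- 1 * u)) * indicator {0<..} u)"
        using True by (simp add: ennreal_mult[symmetric] mult_ac del: ennreal_fact)
      finally show ?thesis .
    qed auto
  qed
  also have "\<dots> = ennreal (1 / fact (n + m)) * ennreal (fact m) * ennreal (fact (n - 1))"
    by (subst nn_integral_cmult, simp, subst nn_integral_power_times_exp) auto
  also have "\<dots> = ennreal (fact m * fact (n - 1) / fact (n + m))"
    by (simp add: ennreal_mult[symmetric] del: ennreal_fact)
  finally show ?thesis .
qed

text \<open>\<open>R^(-m)\<close> is replaced by its Gamma integral over t, \<open>scale\<close>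
  evaluates the inner average, and the beta integral in t remains. In the applications R is the
  squared norm of n Gaussian coordinates and F is homogeneous of degree 2m, so that
  \<open>scale\<close> holds and the left side averages a function of the direction alone.
  Independence of norm and direction is never invoked.\<close>

lemma nn_integral_divide_homogeneous:
  fixes F :: "'a \<Rightarrow> ennreal" and R :: "'a \<Rightarrow> real"
  assumes M: "prob_space M" and [measurable]: "F \<in> borel_measurable M" "R \<in> borel_measurable M"
    and R: "AE x in M. 0 < R x" and n: "1 \<le> n"
    and scale: "\<And>t. 0 < t \<Longrightarrow> (\<integral>\<^sup>+x. F x * ennreal (exp (- t * R x)) \<partial>M) = ennreal ((1 / (1 + t)) ^ (n + m)) * (\<integral>\<^sup>+x. F x \<partial>M)"
  shows "(\<integral>\<^sup>+x. F x * ennreal ((1 / R x) ^ m) \<partial>M) = ennreal (fact (n - 1) / fact (n + m - 1)) * (\<integral>\<^sup>+x. F x \<partial>M)"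
\<comment> \<open>The Gamma integral represents \<open>R^(-m)\<close> only for m \<ge> 1, with
  \<open>t^(m - 1)\<close>, hence \<open>k = m - 1\<close>; for m = 0 both sides coincide.\<close>
proof (cases m)
  case (Suc k)
  interpret prob_space M by fact
  let ?k = "\<lambda>x t. F x * ennreal (1 / fact k) * (ennreal (t ^ k * exp (- R x * t)) * indicator {0<..} t)"
  have "(\<integral>\<^sup>+x. F x * ennreal ((1 / R x) ^ m) \<partial>M) =
    (\<integral>\<^sup>+x. \<integral>\<^sup>+t. ?k x t \<partial>lborel \<partial>M)"
  proof (rule nn_integral_cong_AE)
    show "AE x in M. F x * ennreal ((1 / R x) ^ m) =
      (\<integral>\<^sup>+t. ?k x t \<partial>lborel)"
      using R
    proof eventually_elim
      case (elim x)
      then show ?case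
        by (subst nn_integral_cmult, simp, subst nn_integral_power_times_exp)
          (auto simp: Suc mult.assoc ennreal_mult[symmetric] power_one_over divide_simps)
    qed
  qed
  also have "\<dots> = (\<integral>\<^sup>+t. \<integral>\<^sup>+x. ?k x t \<partial>M \<partial>lborel)"
    by (rule nn_integral_swap) (auto simp: sigma_finite_lborel M)
  also have "\<dots> = (\<integral>\<^sup>+t. (ennreal (1 / fact k) * (\<integral>\<^sup>+x. F x \<partial>M)) * (ennreal (t ^ k * (1 / (1 + t)) ^ (n + Suc k)) * indicator {0<..} t) \<partial>lborel)"
  proof (rule nn_integral_cong)
    fix t :: real
    show "(\<integral>\<^sup>+x. ?k x t \<partial>M)
      = (ennreal (1 / fact k) * (\<integral>\<^sup>+x. F x \<partial>M)) * (ennreal (t ^ k * (1 / (1 + t)) ^ (n + Suc k)) * indicator {0<..} t)"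
    proof (cases "0 < t")
      case True
      have "(\<integral>\<^sup>+x. ?k x t \<partial>M)
        = (\<integral>\<^sup>+x. (ennreal (1 / fact k) * ennreal (t ^ k)) * (F x * ennreal (exp (- t * R x))) \<partial>M)"
        using True by (intro nn_integral_cong) (auto simp: ennreal_mult mult_ac)
      also have "\<dots> = (ennreal (1 / fact k) * ennreal (t ^ k)) * (ennreal ((1 / (1 + t)) ^ (n + m)) * (\<integral>\<^sup>+x. F x \<partial>M))"
        using scale[OF True] by (subst nn_integral_cmult) auto
      also have "\<dots> = (ennreal (1 / fact k) * (\<integral>\<^sup>+x. F x \<partial>M)) * (ennreal (t ^ k * (1 / (1 + t)) ^ (n + Suc k)) * indicator {0<..} t)"
        using True by (simp add: Suc ennreal_mult mult_ac del: power_Suc)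
      finally show ?thesis .
    qed auto
  qed
  also have "\<dots> = (ennreal (1 / fact k) * (\<integral>\<^sup>+x. F x \<partial>M)) * ennreal (fact k * fact (n - 1) / fact (n + k))"
    using n by (subst nn_integral_cmult, simp, subst nn_integral_beta_prime) auto
  also have "\<dots> = ennreal (1 / fact k * (fact k * fact (n - 1) / fact (n + k))) * (\<integral>\<^sup>+x. F x \<partial>M)"
    by (subst ennreal_mult) (auto simp: mult_ac)
  also have "1 / fact k * (fact k * fact (n - 1) / fact (n + k)) = (fact (n - 1) / fact (n + m - 1) :: real)"
    by (simp add: Suc)
  finally show ?thesis .
qed simp

section \<open>Exponential tilting and moments of normalised Gaussian vectors\<close>

lemma AE_std_gaussian_nonzero: "AE z in std_gaussian. z \<noteq> 0"
  unfolding complex_gaussian_def by (subst AE_density) (use AE_lborel_singleton[of "0::complex"] in auto)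

lemma AE_std_vec_nonzero: "finite J \<Longrightarrow> j \<in> J \<Longrightarrow> AE w in std_gaussian_vec J. 0 < (\<Sum>i\<in>J. (cmod (w i))\<^sup>2)"
proof -
  assume J: "finite J" "j \<in> J"
  have "AE w in std_gaussian_vec J. w j \<noteq> 0"
    using J by (intro AE_PiM_component prob_space_std_gaussian AE_std_gaussian_nonzero) auto
  then show ?thesis
  proof eventually_elim
    case (elim w)
    then have "0 < (cmod (w j))\<^sup>2" by simp
    also have "\<dots> \<le> (\<Sum>i\<in>J. (cmod (w i))\<^sup>2)" using J by (intro member_le_sum) auto
    finally show ?case .
  qed
qed

text \<open>The weight turns the density of variance 1 into that of variance 1/(1+t), up to the
  quotient 1/(1+t) of the normalising constants.\<close>

lemma std_gaussian_tilt:
  assumes t: "0 < t" and [measurable]: "f \<in> borel_measurable borel"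
  shows "(\<integral>\<^sup>+z. f z * ennreal (exp (- t * (cmod z)\<^sup>2)) \<partial>std_gaussian) =
    ennreal (1 / (1 + t)) * (\<integral>\<^sup>+z. f (of_real (sqrt (1 / (1 + t))) * z) \<partial>std_gaussian)"
proof -
  have "(\<integral>\<^sup>+z. f z * ennreal (exp (- t * (cmod z)\<^sup>2)) \<partial>std_gaussian) =
    (\<integral>\<^sup>+z. ennreal (1 / (1 + t)) * (ennreal (exp (- (cmod (z - 0))\<^sup>2 / (1 / (1 + t))) / (pi * (1 / (1 + t)))) * f z) \<partial>lborel)"
  proof (subst nn_integral_complex_gaussian, measurable, rule nn_integral_cong)
    fix z :: complex
    have "exp (- (cmod (z - 0))\<^sup>2 / 1) / (pi * 1) * exp (- t * (cmod z)\<^sup>2) =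
      1 / (1 + t) * (exp (- (cmod (z - 0))\<^sup>2 / (1 / (1 + t))) / (pi * (1 / (1 + t))))" (is "?a * ?b = ?c * ?d")
      using t by (simp add: exp_add[symmetric]) (simp add: field_simps flip: exp_add)
    then have *: "ennreal ?a * ennreal ?b = ennreal ?c * ennreal ?d"
      using t by (simp add: ennreal_mult[symmetric] del: div_by_1)
    have "ennreal ?a * (f z * ennreal ?b) = (ennreal ?a * ennreal ?b) * f z" by (simp only: mult_ac)
    then show "ennreal ?a * (f z * ennreal ?b) = ennreal ?c * (ennreal ?d * f z)"
      by (simp only: * mult.assoc)
  qed
  also have "\<dots> = ennreal (1 / (1 + t)) * (\<integral>\<^sup>+z. f z \<partial>complex_gaussian 0 (1 / (1 + t)))"
    by (subst nn_integral_cmult) (auto simp: nn_integral_complex_gaussian)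
  also have "(\<integral>\<^sup>+z. f z \<partial>complex_gaussian 0 (1 / (1 + t))) = (\<integral>\<^sup>+z. f (of_real (sqrt (1 / (1 + t))) * z) \<partial>std_gaussian)"
    using t by (subst complex_gaussian_affine) auto
  finally show ?thesis .
qed

lemma std_gaussian_tilt_homogeneous:
  assumes t: "0 < t" and [measurable]: "f \<in> borel_measurable borel"
    and hom: "\<And>a z. 0 \<le> a \<Longrightarrow> f (of_real a * z) = ennreal (a ^ (2 * m)) * f z"
  shows "(\<integral>\<^sup>+z. f z * ennreal (exp (- t * (cmod z)\<^sup>2)) \<partial>std_gaussian) =
    ennreal ((1 / (1 + t)) ^ (1 + m)) * (\<integral>\<^sup>+z. f z \<partial>std_gaussian)"
proof -
  have "(\<integral>\<^sup>+z. f z * ennreal (exp (- t * (cmod z)\<^sup>2)) \<partial>std_gaussian) =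
    ennreal (1 / (1 + t)) * (ennreal ((1 / (1 + t)) ^ m) * (\<integral>\<^sup>+z. f z \<partial>std_gaussian))"
    using t by (subst std_gaussian_tilt) (auto simp: hom power_mult nn_integral_cmult simp del: real_sqrt_inverse)
  also have "\<dots> = ennreal (1 / (1 + t) * (1 / (1 + t)) ^ m) * (\<integral>\<^sup>+z. f z \<partial>std_gaussian)"
    using t by (subst ennreal_mult) (auto simp: mult.assoc)
  finally show ?thesis by simp
qed

text \<open>Dividing by |z|^(2(j+m)) leaves (Re z)^(2m) / |z|^(2m) whatever j is. The moment for j
  and the known one for j = 0 thus agree after multiplication by 1/(j+m)! and 1/m!
  respectively.\<close>

lemma nn_integral_std_gaussian_mixed_moment:
  "(\<integral>\<^sup>+z. ennreal ((cmod z) ^ (2 * j) * (Re z) ^ (2 * m)) \<partial>std_gaussian) =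
   ennreal (fact (j + m) / fact m * (fact (2 * m) / (4 ^ m * fact m)))"
proof -
  let ?F = "\<lambda>j z. ennreal ((cmod z) ^ (2 * j) * (Re z) ^ (2 * m))"
  have *: "(\<integral>\<^sup>+z. ?F j z * ennreal ((1 / (cmod z)\<^sup>2) ^ (j + m)) \<partial>std_gaussian)
    = ennreal (fact (1 - 1) / fact (1 + (j + m) - 1)) * (\<integral>\<^sup>+z. ?F j z \<partial>std_gaussian)" for j
  proof (rule nn_integral_divide_homogeneous[OF prob_space_std_gaussian])
    show "AE x in std_gaussian. 0 < (cmod x)\<^sup>2"
      using AE_std_gaussian_nonzero by eventually_elim simp
    show "(\<integral>\<^sup>+z. ?F j z * ennreal (exp (- t * (cmod z)\<^sup>2)) \<partial>std_gaussian) =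
         ennreal ((1 / (1 + t)) ^ (1 + (j + m))) * (\<integral>\<^sup>+z. ?F j z \<partial>std_gaussian)" if "0 < t" for t
    proof (rule std_gaussian_tilt_homogeneous[OF that])
      fix a :: real and z :: complex assume "0 \<le> a"
      then have "cmod (of_real a * z) ^ (2 * j) * Re (of_real a * z) ^ (2 * m) =
        a ^ (2 * (j + m)) * (cmod z ^ (2 * j) * Re z ^ (2 * m))"
        by (simp add: norm_mult power_mult_distrib power_add algebra_simps)
      then show "?F j (of_real a * z) = ennreal (a ^ (2 * (j + m))) * ?F j z"
        using \<open>0 \<le> a\<close> by (simp only:) (rule ennreal_mult, auto)
    qed measurable
  qed auto
  have "(\<integral>\<^sup>+z. ?F j z * ennreal ((1 / (cmod z)\<^sup>2) ^ (j + m)) \<partial>std_gaussian) =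
    (\<integral>\<^sup>+z. ?F 0 z * ennreal ((1 / (cmod z)\<^sup>2) ^ (0 + m)) \<partial>std_gaussian)"
  proof (rule nn_integral_cong_AE)
    show "AE z in std_gaussian. ?F j z * ennreal ((1 / (cmod z)\<^sup>2) ^ (j + m)) = ?F 0 z * ennreal ((1 / (cmod z)\<^sup>2) ^ (0 + m))"
      using AE_std_gaussian_nonzero
      by eventually_elim (simp add: ennreal_mult[symmetric] power_one_over power_add power_mult)
  qed
  then have "ennreal (1 / fact (j + m)) * (\<integral>\<^sup>+z. ?F j z \<partial>std_gaussian) =
    ennreal (1 / fact m * (fact (2 * m) / (4 ^ m * fact m)))"
    unfolding * using nn_integral_std_gaussian_moment[of m] by (simp add: ennreal_mult[symmetric])
  then have "ennreal (fact (j + m)) * (ennreal (1 / fact (j + m)) * (\<integral>\<^sup>+z. ?F j z \<partial>std_gaussian)) =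
    ennreal (fact (j + m)) * ennreal (1 / fact m * (fact (2 * m) / (4 ^ m * fact m)))" by simp
  moreover have "ennreal (fact (j + m)) * ennreal (1 / fact (j + m)) = 1"
    by (subst ennreal_mult[symmetric]) auto
  moreover have "ennreal (fact (j + m)) * ennreal (1 / fact m * (fact (2 * m) / (4 ^ m * fact m))) =
    ennreal (fact (j + m) / fact m * (fact (2 * m) / (4 ^ m * fact m)))"
    by (subst ennreal_mult[symmetric]) auto
  ultimately show ?thesis by (simp only: mult.assoc[symmetric] mult_1)
qed

text \<open>The tilting weight factors over the independent coordinates: each contributes 1/(1+t),
  and the coordinate with the moment contributes a further m-th power of it.\<close>

lemma nn_integral_std_vec_direction_moment:
  assumes J: "finite J" "j \<in> J"
  shows "(\<integral>\<^sup>+w. ennreal ((Re (w j)) ^ (2 * m)) * ennreal ((1 / (\<Sum>i\<in>J. (cmod (w i))\<^sup>2)) ^ m) \<partial>std_gaussian_vec J)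
    = ennreal (fact (card J - 1) / fact (card J + m - 1) * (fact (2 * m) / (4 ^ m * fact m)))"
proof -
  let ?R = "\<lambda>w. \<Sum>i\<in>J. (cmod (w i))\<^sup>2" and ?g = "std_gaussian_vec J" and ?h = "\<lambda>z. ennreal ((Re z) ^ (2 * m))"
  let ?m = "fact (2 * m) / (4 ^ m * fact m) :: real"
  \<comment> \<open>Isolates the factor j, the only one that carries the moment, so that the product
    formula for independent coordinates applies.\<close>
  have prod: "(\<Prod>i\<in>J. if i = j then f i else g i) = f j * (\<Prod>i\<in>J - {j}. g i)" for f g :: "_ \<Rightarrow> ennreal"
    using J by (subst prod.remove[of J j]) (auto intro!: arg_cong2[where f="(*)"] prod.cong)
  have moment: "(\<integral>\<^sup>+w. ?h (w j) \<partial>?g) = ennreal (?m)"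
  proof -
    have "(\<integral>\<^sup>+w. ?h (w j) \<partial>?g) =
      (\<integral>\<^sup>+w. (\<Prod>i\<in>J. if i = j then ?h (w i) else 1) \<partial>?g)"
      by (simp only: prod) simp
    also have "\<dots> = (\<Prod>i\<in>J. \<integral>\<^sup>+z. (if i = j then ?h z else 1) \<partial>std_gaussian)"
      using J by (intro std.product_nn_integral_prod) auto
    also have "\<dots> = (\<Prod>i\<in>J. if i = j then ennreal (?m) else 1)"
      using prob_space.emeasure_space_1[OF prob_space_std_gaussian]
      by (intro prod.cong) (auto simp: nn_integral_std_gaussian_moment)
    finally show ?thesis by (simp only: prod) simp
  qed
  have "(\<integral>\<^sup>+w. ?h (w j) * ennreal ((1 / ?R w) ^ m) \<partial>?g)
    = ennreal (fact (card J - 1) / fact (card J + m - 1)) * (\<integral>\<^sup>+w. ?h (w j) \<partial>?g)"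
  proof (rule nn_integral_divide_homogeneous[OF prob_space_std_vec])
    show "(\<lambda>w. ?h (w j)) \<in> borel_measurable (?g)" using J by measurable
    show "(\<lambda>w. \<Sum>i\<in>J. (cmod (w i))\<^sup>2) \<in> borel_measurable (?g)" by measurable
    show "AE w in ?g. 0 < ?R w" using J by (rule AE_std_vec_nonzero)
    show "1 \<le> card J" using J by (metis One_nat_def Suc_leI card_gt_0_iff empty_iff)
    fix t :: real assume t: "0 < t"
    have "(\<integral>\<^sup>+w. ?h (w j) * ennreal (exp (- t * ?R w)) \<partial>?g) =
      (\<integral>\<^sup>+w. (\<Prod>i\<in>J. (if i = j then ?h (w i) else 1) * ennreal (exp (- t * (cmod (w i))\<^sup>2))) \<partial>?g)"
    proof (rule nn_integral_cong)
      fix w :: "'a \<Rightarrow> complex"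
      have "exp (- t * ?R w) = (\<Prod>i\<in>J. exp (- t * (cmod (w i))\<^sup>2))"
        using J by (subst sum_distrib_left) (rule exp_sum)
      then show "?h (w j) * ennreal (exp (- t * ?R w)) =
        (\<Prod>i\<in>J. (if i = j then ?h (w i) else 1) * ennreal (exp (- t * (cmod (w i))\<^sup>2)))"
        by (simp only: prod.distrib prod prod_ennreal exp_ge_zero) simp
    qed
    also have "\<dots> = (\<Prod>i\<in>J. \<integral>\<^sup>+z. (if i = j then ?h z else 1) * ennreal (exp (- t * (cmod z)\<^sup>2)) \<partial>std_gaussian)"

    proof (rule std.product_nn_integral_prod[OF J(1)])
      fix i show "(\<lambda>z. (if i = j then ?h z else 1) * ennreal (exp (- t * (cmod z)\<^sup>2))) \<in> borel_measurable std_gaussian"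
        by (cases "i = j") auto
    qed
    also have "\<dots> = (\<Prod>i\<in>J. (if i = j then ennreal ((1 / (1 + t)) ^ m * (?m)) else 1) * ennreal (1 / (1 + t)))"
    proof (intro prod.cong refl)
      fix i assume "i \<in> J"
      show "(\<integral>\<^sup>+z. (if i = j then ?h z else 1) * ennreal (exp (- t * (cmod z)\<^sup>2)) \<partial>std_gaussian)
       = (if i = j then ennreal ((1 / (1 + t)) ^ m * (?m)) else 1) * ennreal (1 / (1 + t))"
      proof (cases "i = j")
        case True
        have "(\<integral>\<^sup>+z. ?h z * ennreal (exp (- t * (cmod z)\<^sup>2)) \<partial>std_gaussian) =
          ennreal ((1 / (1 + t)) ^ (1 + m)) * ennreal (?m)"
          unfolding nn_integral_std_gaussian_moment[symmetric]
          by (rule std_gaussian_tilt_homogeneous[OF t]) (auto simp: power_mult_distrib ennreal_mult)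
        also have "\<dots> = ennreal ((1 / (1 + t)) ^ m * (?m)) * ennreal (1 / (1 + t))"
          using t by (simp add: ennreal_mult[symmetric])
        finally show ?thesis using True by simp
      next
        case False
        then show ?thesis
          using std_gaussian_tilt_homogeneous[OF t, of "\<lambda>z. 1" 0] prob_space.emeasure_space_1[OF prob_space_std_gaussian]
          by simp
      qed
    qed
    also have "\<dots> = ennreal ((1 / (1 + t)) ^ (card J + m)) * (\<integral>\<^sup>+w. ?h (w j) \<partial>?g)"
      unfolding moment prod.distrib prod using t
      by (simp add: ennreal_power ennreal_mult[symmetric] power_add mult_ac)
    finally show "(\<integral>\<^sup>+w. ?h (w j) * ennreal (exp (- t * ?R w)) \<partial>?g)
      = ennreal ((1 / (1 + t)) ^ (card J + m)) * (\<integral>\<^sup>+w. ?h (w j) \<partial>?g)" .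
  qed
  then show ?thesis by (simp only: moment) (simp add: ennreal_mult[symmetric])
qed

subsection \<open>Uniform points on the complex sphere\<close>

lemma vnorm_nonneg [simp]: "0 \<le> vnorm n w"
  by (simp add: vnorm_def L2_set_nonneg)

lemma vnorm_power2: "(vnorm n w)\<^sup>2 = (\<Sum>i<n. (cmod (w i))\<^sup>2)"
  by (simp add: vnorm_def L2_set_def sum_nonneg)

lemma vnorm_scale: "vnorm n (\<lambda>i. c * w i) = cmod c * vnorm n w"
  by (simp add: vnorm_def norm_mult L2_set_right_distrib)

lemma vnorm_unit: "1 \<le> n \<Longrightarrow> vnorm n (\<lambda>i. if i = 0 then c else 0) = cmod c"
proof -
  assume "1 \<le> n"
  then have "(\<Sum>i<n. (cmod (if i = 0 then c else 0))\<^sup>2) = (cmod c)\<^sup>2"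
    by (subst sum.remove[of _ 0]) (auto intro!: sum.neutral)
  then show ?thesis by (simp add: vnorm_def L2_set_def)
qed

text \<open>Norm 0 has probability 0. The fixed point chosen there makes the power constraint hold
  for every w and not just almost surely, as the definition of a code demands.\<close>

definition sphere_point :: "nat \<Rightarrow> real \<Rightarrow> (nat \<Rightarrow> complex) \<Rightarrow> nat \<Rightarrow> complex" where
  "sphere_point n P w i =
    (if vnorm n w = 0 then (if i = 0 then of_real (sqrt P) else 0) else of_real (sqrt P / vnorm n w) * w i)"

lemma vnorm_sphere_point: "1 \<le> n \<Longrightarrow> 0 \<le> P \<Longrightarrow> (vnorm n (sphere_point n P w))\<^sup>2 = P"
proof (cases "vnorm n w = 0")
  case True
  assume "1 \<le> n" "0 \<le> P"
  moreover have "sphere_point n P w = (\<lambda>i. if i = 0 then of_real (sqrt P) else 0)"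
    using True by (auto simp: sphere_point_def)
  ultimately show ?thesis by (simp only: vnorm_unit) simp
next
  case False
  assume "1 \<le> n" "0 \<le> P"
  moreover have "sphere_point n P w = (\<lambda>i. of_real (sqrt P / vnorm n w) * w i)"
    using False by (auto simp: sphere_point_def)
  ultimately show ?thesis using False by (simp only: vnorm_scale) (simp add: power_mult_distrib norm_divide)
qed

lemma std_vec_rotation:
  fixes F :: "complex \<Rightarrow> real \<Rightarrow> ennreal" and u :: "'i \<Rightarrow> complex"
  assumes J: "finite J" "j \<in> J" and [measurable]: "(\<lambda>(z, r). F z r) \<in> borel_measurable (borel \<Otimes>\<^sub>M borel)"
  shows "(\<integral>\<^sup>+w. F (\<Sum>i\<in>J. u i * w i) (\<Sum>i\<in>J. (cmod (w i))\<^sup>2) \<partial>std_gaussian_vec J)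
    = (\<integral>\<^sup>+w. F (of_real (sqrt (\<Sum>i\<in>J. (cmod (u i))\<^sup>2)) * w j) (\<Sum>i\<in>J. (cmod (w i))\<^sup>2) \<partial>std_gaussian_vec J)"
proof -
  define K where "K = J - {j}"
  have K: "finite K" "j \<notin> K" and JK: "J = insert j K" using J by (auto simp: K_def)
  have [simp]: "(\<Sum>i\<in>K. u i * (if i = j then y else w i)) = (\<Sum>i\<in>K. u i * w i)"
    "(\<Sum>i\<in>K. (cmod (if i = j then y else w i))\<^sup>2) = (\<Sum>i\<in>K. (cmod (w i))\<^sup>2)" for w y
    using K by (auto intro!: sum.cong)
  have "(\<integral>\<^sup>+w. F (\<Sum>i\<in>J. u i * w i) (\<Sum>i\<in>J. (cmod (w i))\<^sup>2) \<partial>std_gaussian_vec J)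
    = (\<integral>\<^sup>+z. \<integral>\<^sup>+w. F (u j * z + (\<Sum>i\<in>K. u i * w i)) ((cmod z)\<^sup>2 + (\<Sum>i\<in>K. (cmod (w i))\<^sup>2))
      \<partial>std_gaussian_vec K \<partial>std_gaussian)"
    unfolding JK using K by (subst std.product_nn_integral_insert_rev) auto
  also have "\<dots> = (\<integral>\<^sup>+z. \<integral>\<^sup>+w. F (of_real (sqrt ((cmod (u j))\<^sup>2 + (\<Sum>i\<in>K. (cmod (u i))\<^sup>2))) * z)
        ((cmod z)\<^sup>2 + (\<Sum>i\<in>K. (cmod (w i))\<^sup>2)) \<partial>std_gaussian_vec K \<partial>std_gaussian)"
    using K by (intro std_gaussian_rotation) auto
  also have "\<dots> = (\<integral>\<^sup>+w. F (of_real (sqrt (\<Sum>i\<in>J. (cmod (u i))\<^sup>2)) * w j) (\<Sum>i\<in>J. (cmod (w i))\<^sup>2) \<partial>std_gaussian_vec J)"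
    unfolding JK using K by (subst std.product_nn_integral_insert_rev) auto
  finally show ?thesis .
qed

section \<open>Moment generating function of a uniform point of the sphere\<close>

lemma cosh_sums: "(\<lambda>m. x ^ (2 * m) / fact (2 * m)) sums cosh (x :: real)"
proof -
  have "(\<lambda>n. if even n then x ^ n / fact n else 0) sums cosh x"
    using cosh_converges[of x] by (simp add: divide_inverse mult.commute cong: if_cong)
  moreover have "strict_mono (\<lambda>m::nat. 2 * m)" by (simp add: strict_mono_def)
  ultimately have "(\<lambda>m. (\<lambda>n. if even n then x ^ n / fact n else 0) (2 * m)) sums cosh x"
    by (subst sums_mono_reindex) (auto elim!: evenE)
  then show ?thesis by simp
qed

text \<open>Symmetry lets cosh take the place of exp. Unlike that of exp, the series of cosh has
  nonnegative terms for either sign of X and may be integrated term by term.\<close>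

lemma nn_integral_exp_symmetric:
  fixes X :: "'a \<Rightarrow> real"
  assumes [measurable]: "X \<in> borel_measurable M" "g \<in> borel_measurable M"
    and sym: "(\<integral>\<^sup>+x. g x * ennreal (exp (- X x)) \<partial>M) = (\<integral>\<^sup>+x. g x * ennreal (exp (X x)) \<partial>M)"
  shows "(\<integral>\<^sup>+x. g x * ennreal (exp (X x)) \<partial>M) = (\<Sum>m. \<integral>\<^sup>+x. g x * ennreal ((X x) ^ (2 * m) / fact (2 * m)) \<partial>M)"
proof -
  have "2 * (\<integral>\<^sup>+x. g x * ennreal (exp (X x)) \<partial>M) =
    (\<integral>\<^sup>+x. g x * ennreal (exp (X x)) \<partial>M) + (\<integral>\<^sup>+x. g x * ennreal (exp (- X x)) \<partial>M)"
    by (simp add: sym mult_2)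
  also have "\<dots> = (\<integral>\<^sup>+x. g x * (ennreal (exp (X x)) + ennreal (exp (- X x))) \<partial>M)"
    by (subst nn_integral_add[symmetric]) (auto simp: distrib_left)
  also have "\<dots> = (\<integral>\<^sup>+x. 2 * (g x * ennreal (cosh (X x))) \<partial>M)"
  proof (rule nn_integral_cong)
    fix x
    have "exp (X x) + exp (- X x) = 2 * cosh (X x)" by (simp add: cosh_def)
    then have "ennreal (exp (X x)) + ennreal (exp (- X x)) = ennreal (2 * cosh (X x))"
      by (metis ennreal_plus exp_ge_zero)
    then have "ennreal (exp (X x)) + ennreal (exp (- X x)) = 2 * ennreal (cosh (X x))"
      by (simp add: ennreal_mult')
    then show "g x * (ennreal (exp (X x)) + ennreal (exp (- X x))) = 2 * (g x * ennreal (cosh (X x)))"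
      by (simp add: mult_ac)
  qed
  also have "\<dots> = 2 * (\<integral>\<^sup>+x. g x * ennreal (cosh (X x)) \<partial>M)"
    unfolding cosh_def by (rule nn_integral_cmult) measurable
  finally have "(\<integral>\<^sup>+x. g x * ennreal (exp (X x)) \<partial>M) = (\<integral>\<^sup>+x. g x * ennreal (cosh (X x)) \<partial>M)"
    by (simp add: ennreal_mult_cancel_left)
  also have "\<dots> = (\<integral>\<^sup>+x. (\<Sum>m. g x * ennreal ((X x) ^ (2 * m) / fact (2 * m))) \<partial>M)"
  proof (rule nn_integral_cong)
    fix x
    have "(\<Sum>m. ennreal ((X x) ^ (2 * m) / fact (2 * m))) = ennreal (cosh (X x))"
      by (rule suminf_ennreal_eq[OF _ cosh_sums]) simp
    then show "g x * ennreal (cosh (X x)) = (\<Sum>m. g x * ennreal ((X x) ^ (2 * m) / fact (2 * m)))"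
      by (simp only: ennreal_suminf_cmult)
  qed
  also have "\<dots> = (\<Sum>m. \<integral>\<^sup>+x. g x * ennreal ((X x) ^ (2 * m) / fact (2 * m)) \<partial>M)"
    by (rule nn_integral_suminf) measurable
  finally show ?thesis .
qed

text \<open>By rotation the linear form may be replaced by r times coordinate 0, with r the norm of
  u, and then only even moments of one direction coordinate are needed. For r and P positive the
  series is \<open>fact (n - 1) * I_(n-1)(2 * a) / a^(n-1)\<close> at
  \<open>a = sqrt P * r\<close>.\<close>

lemma sphere_point_mgf:
  assumes n: "1 \<le> n" and P: "0 \<le> P"
  shows "(\<integral>\<^sup>+w. ennreal (exp (2 * Re (\<Sum>i<n. u i * sphere_point n P w i))) \<partial>std_gaussian_vec {..<n})
    = (\<Sum>m. ennreal (fact (n - 1) / (fact m * fact (n + m - 1)) * (P * (\<Sum>i<n. (cmod (u i))\<^sup>2)) ^ m))"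
proof -
  let ?G = "std_gaussian_vec {..<n}"
  have J: "finite {..<n}" "0 \<in> {..<n}" using n by auto
  define r where "r = sqrt (\<Sum>i<n. (cmod (u i))\<^sup>2)"
  have r2: "r\<^sup>2 = (\<Sum>i<n. (cmod (u i))\<^sup>2)" by (simp add: r_def sum_nonneg)
  define X where "X w = 2 * sqrt P * r * Re (w 0) * sqrt (1 / (\<Sum>i<n. (cmod (w i))\<^sup>2))" for w :: "nat \<Rightarrow> complex"
  define F where "F \<sigma> a s = ennreal (exp (\<sigma> * (2 * sqrt P * Re a * sqrt (1 / s))))" for \<sigma> :: real and a :: complex and s :: real
  have [measurable]: "(\<lambda>(z, r). F \<sigma> z r) \<in> borel_measurable (borel \<Otimes>\<^sub>M borel)" for \<sigma>
    unfolding F_def by measurable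
  have [measurable]: "X \<in> borel_measurable ?G" unfolding X_def using J by measurable
  have Q: "(\<integral>\<^sup>+w. F \<sigma> (\<Sum>i<n. u i * w i) (\<Sum>i<n. (cmod (w i))\<^sup>2) \<partial>?G) = (\<integral>\<^sup>+w. ennreal (exp (\<sigma> * X w)) \<partial>?G)" for \<sigma>
    by (subst std_vec_rotation[OF J]) (auto simp: F_def X_def r_def mult_ac)
  \<comment> \<open>Replacing u by -u does not change its norm; together with \<open>Q\<close> this
    gives the symmetry of X.\<close>
  have Qm: "(\<integral>\<^sup>+w. F \<sigma> (\<Sum>i<n. - u i * w i) (\<Sum>i<n. (cmod (w i))\<^sup>2) \<partial>?G) = (\<integral>\<^sup>+w. ennreal (exp (\<sigma> * X w)) \<partial>?G)" for \<sigma>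
    by (subst std_vec_rotation[OF J]) (auto simp: F_def X_def r_def mult_ac)
  have "(\<integral>\<^sup>+w. ennreal (exp (2 * Re (\<Sum>i<n. u i * sphere_point n P w i))) \<partial>?G) =
    (\<integral>\<^sup>+w. F 1 (\<Sum>i<n. u i * w i) (\<Sum>i<n. (cmod (w i))\<^sup>2) \<partial>?G)"
  proof (rule nn_integral_cong_AE)
    show "AE w in ?G. ennreal (exp (2 * Re (\<Sum>i<n. u i * sphere_point n P w i))) = F 1 (\<Sum>i<n. u i * w i) (\<Sum>i<n. (cmod (w i))\<^sup>2)"
      using AE_std_vec_nonzero[OF J]
    proof eventually_elim
      case (elim w)
      have "0 < (vnorm n w)\<^sup>2" using elim by (simp add: vnorm_power2)
      then have pos: "vnorm n w \<noteq> 0" by auto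
      then have "(\<Sum>i<n. u i * sphere_point n P w i) = of_real (sqrt P / vnorm n w) * (\<Sum>i<n. u i * w i)"
        by (simp add: sphere_point_def sum_distrib_left mult_ac)
      then show ?case
        by (simp add: F_def vnorm_power2[symmetric] real_sqrt_divide)
    qed
  qed
  also have "\<dots> = (\<integral>\<^sup>+w. 1 * ennreal (exp (X w)) \<partial>?G)"
    by (subst Q) simp
  also have "\<dots> = (\<Sum>m. \<integral>\<^sup>+w. 1 * ennreal ((X w) ^ (2 * m) / fact (2 * m)) \<partial>?G)"
    using Q[of "-1"] Qm[of 1]
    by (intro nn_integral_exp_symmetric) (auto simp: F_def sum_negf)
  also have "\<dots> = (\<Sum>m. ennreal (fact (n - 1) / (fact m * fact (n + m - 1)) * (P * (\<Sum>i<n. (cmod (u i))\<^sup>2)) ^ m))"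
  proof (rule suminf_cong)
    fix m
    have "1 * ennreal ((X w) ^ (2 * m) / fact (2 * m)) = ennreal ((4 * P * r\<^sup>2) ^ m / fact (2 * m)) *
      (ennreal ((Re (w 0)) ^ (2 * m)) * ennreal ((1 / (\<Sum>i<n. (cmod (w i))\<^sup>2)) ^ m))" for w
    proof -
      have "(X w) ^ (2 * m) = (4 * P * r\<^sup>2) ^ m * ((Re (w 0)) ^ (2 * m) * (1 / (\<Sum>i<n. (cmod (w i))\<^sup>2)) ^ m)"
        using P by (simp add: X_def power_mult power_mult_distrib sum_nonneg real_sqrt_divide power_divide)
      then show ?thesis using P by (simp add: ennreal_mult[symmetric] sum_nonneg)
    qed
    then have "(\<integral>\<^sup>+w. 1 * ennreal ((X w) ^ (2 * m) / fact (2 * m)) \<partial>?G) =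
      ennreal ((4 * P * r\<^sup>2) ^ m / fact (2 * m)) * ennreal (fact (n - 1) / fact (n + m - 1) * (fact (2 * m) / (4 ^ m * fact m)))"
      unfolding nn_integral_std_vec_direction_moment[OF J, of m, unfolded card_lessThan, symmetric]
      using J by (simp only:) (rule nn_integral_cmult, measurable)
    also have "\<dots> = ennreal ((4 * P * r\<^sup>2) ^ m / fact (2 * m) * (fact (n - 1) / fact (n + m - 1) * (fact (2 * m) / (4 ^ m * fact m))))"
      using P by (intro ennreal_mult[symmetric]) auto
    also have "(4 * P * r\<^sup>2) ^ m / fact (2 * m) * (fact (n - 1) / fact (n + m - 1) * (fact (2 * m) / (4 ^ m * fact m)))
      = fact (n - 1) / (fact m * fact (n + m - 1)) * (P * (\<Sum>i<n. (cmod (u i))\<^sup>2)) ^ m"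
      unfolding r2[symmetric] by (simp add: power_mult_distrib mult_ac)
    finally show "(\<integral>\<^sup>+w. 1 * ennreal ((X w) ^ (2 * m) / fact (2 * m)) \<partial>?G) =
      ennreal (fact (n - 1) / (fact m * fact (n + m - 1)) * (P * (\<Sum>i<n. (cmod (u i))\<^sup>2)) ^ m)" .
  qed
  finally show ?thesis .
qed

section \<open>Gaussian integrals over the plane as radial integrals\<close>

lemma nn_integral_gaussian_weight:
  assumes c: "0 < c" and [measurable]: "f \<in> borel_measurable borel"
  shows "(\<integral>\<^sup>+h. ennreal (exp (- c * (cmod (h - m))\<^sup>2)) * f h \<partial>lborel)
    = ennreal (pi / c) * (\<integral>\<^sup>+h. f (m + of_real (sqrt (1 / c)) * h) \<partial>std_gaussian)"
proof -
  have "(\<integral>\<^sup>+h. ennreal (exp (- c * (cmod (h - m))\<^sup>2)) * f h \<partial>lborel) =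
    (\<integral>\<^sup>+h. ennreal (pi / c) * (ennreal (exp (- (cmod (h - m))\<^sup>2 / (1 / c)) / (pi * (1 / c))) * f h) \<partial>lborel)"
  proof (rule nn_integral_cong)
    fix h :: complex
    have "exp (- c * (cmod (h - m))\<^sup>2) = pi / c * (exp (- (cmod (h - m))\<^sup>2 / (1 / c)) / (pi * (1 / c)))"
      using c by (simp add: mult.commute)
    then have "ennreal (exp (- c * (cmod (h - m))\<^sup>2)) = ennreal (pi / c) * ennreal (exp (- (cmod (h - m))\<^sup>2 / (1 / c)) / (pi * (1 / c)))"
      using c by (subst ennreal_mult[symmetric]) auto
    then show "ennreal (exp (- c * (cmod (h - m))\<^sup>2)) * f h =
      ennreal (pi / c) * (ennreal (exp (- (cmod (h - m))\<^sup>2 / (1 / c)) / (pi * (1 / c))) * f h)"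
      by (simp only: mult.assoc)
  qed
  also have "\<dots> = ennreal (pi / c) * (\<integral>\<^sup>+h. f h \<partial>complex_gaussian m (1 / c))"
    by (subst nn_integral_cmult) (auto simp: nn_integral_complex_gaussian)
  finally show ?thesis using c by (subst (asm) complex_gaussian_affine) auto
qed

text \<open>In polar coordinates with z = |h|^2, the angular integral of
  \<open>exp (2 * a * Re h)\<close> would produce the series of \<open>I_0(2 * a * sqrt z)\<close>
  and the factor pi. Here both sides are expanded instead: the terms on the left are mixed Gaussian
  moments, those on the right Gamma integrals.\<close>

lemma nn_integral_polar_series:
  assumes c: "0 < c" and b: "\<And>j. 0 \<le> b j"
  shows "(\<integral>\<^sup>+h. ennreal (exp (- c * (cmod h)\<^sup>2)) * (\<Sum>j. ennreal (b j * ((cmod h)\<^sup>2) ^ j)) * ennreal (exp (2 * a * Re h)) \<partial>lborel)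
    = ennreal pi * (\<integral>\<^sup>+z. ennreal (exp (- c * z)) * (\<Sum>j. ennreal (b j * z ^ j)) * (\<Sum>m. ennreal ((a\<^sup>2 * z) ^ m / (fact m)\<^sup>2))
        * indicator {0<..} z \<partial>lborel)"
proof -
  define g where "g h = ennreal (exp (- c * (cmod h)\<^sup>2)) * (\<Sum>j. ennreal (b j * ((cmod h)\<^sup>2) ^ j))" for h
  have [measurable]: "g \<in> borel_measurable lborel" unfolding g_def by measurable
  let ?r = "\<lambda>h. of_real (sqrt (1 / c)) * h"
  let ?K = "\<lambda>j m z. ennreal (exp (- c * z)) * ennreal (b j * z ^ j) * ennreal ((a\<^sup>2 * z) ^ m / (fact m)\<^sup>2) * indicator {0<..} z"
  let ?C = "\<lambda>j m h. ennreal (exp (- c * (cmod h)\<^sup>2)) * ennreal (b j * ((cmod h)\<^sup>2) ^ j) * ennreal ((2 * a * Re h) ^ (2 * m) / fact (2 * m))"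
  have summand: "(\<integral>\<^sup>+h. ?C j m h \<partial>lborel)
    = ennreal pi * (\<integral>\<^sup>+z. ?K j m z \<partial>lborel)"
    (is "?L = ennreal pi * ?R") for j m
  proof -
    \<comment> \<open>\<open>(2 * a * Re h) ^ (2 * m)\<close> contributes
      \<open>(4 * a^2) ^ m\<close>; its \<open>4 ^ m\<close> and the (2m)! cancel against the moment
      of the real part and leave \<open>a ^ (2 * m) / (fact m)^2\<close>.\<close>
    let ?k = "b j * (4 * a\<^sup>2) ^ m / fact (2 * m)"
    have k: "0 \<le> ?k" using b by simp
    have k': "0 \<le> ?k * (1 / c) ^ (j + m)" using b c by simp
    have "?L = (\<integral>\<^sup>+h. ennreal (exp (- c * (cmod (h - 0))\<^sup>2)) * ennreal (?k * ((cmod h) ^ (2 * j) * (Re h) ^ (2 * m))) \<partial>lborel)"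
    proof (rule nn_integral_cong)
      fix h :: complex
      have "b j * ((cmod h)\<^sup>2) ^ j * ((2 * a * Re h) ^ (2 * m) / fact (2 * m)) = ?k * ((cmod h) ^ (2 * j) * (Re h) ^ (2 * m))"
        by (simp add: power_mult power_mult_distrib)
      moreover have "ennreal (b j * ((cmod h)\<^sup>2) ^ j) * ennreal ((2 * a * Re h) ^ (2 * m) / fact (2 * m)) =
        ennreal (b j * ((cmod h)\<^sup>2) ^ j * ((2 * a * Re h) ^ (2 * m) / fact (2 * m)))"
        using b by (intro ennreal_mult[symmetric]) auto
      ultimately show "?C j m h =
        ennreal (exp (- c * (cmod (h - 0))\<^sup>2)) * ennreal (?k * ((cmod h) ^ (2 * j) * (Re h) ^ (2 * m)))"
        by (simp only: mult.assoc diff_zero)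
    qed
    also have "\<dots> = ennreal (pi / c) * (\<integral>\<^sup>+h. ennreal (?k * ((cmod (?r h)) ^ (2 * j) * (Re (?r h)) ^ (2 * m))) \<partial>std_gaussian)"
      using c by (subst nn_integral_gaussian_weight) auto
    also have "\<dots> = ennreal (pi / c) * (\<integral>\<^sup>+h. ennreal (?k * (1 / c) ^ (j + m)) * ennreal ((cmod h) ^ (2 * j) * (Re h) ^ (2 * m)) \<partial>std_gaussian)"
    proof (intro arg_cong[where f="\<lambda>x. ennreal (pi / c) * x"] nn_integral_cong)
      fix h :: complex
      have "?k * ((cmod (?r h)) ^ (2 * j) * (Re (?r h)) ^ (2 * m))
        = ?k * (1 / c) ^ (j + m) * ((cmod h) ^ (2 * j) * (Re h) ^ (2 * m))"
      proof -
        have "(cmod (?r h))\<^sup>2 = 1 / c * (cmod h)\<^sup>2" "(Re (?r h))\<^sup>2 = 1 / c * (Re h)\<^sup>2"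
          using c by (simp_all add: norm_mult power_mult_distrib norm_divide power_divide real_sqrt_divide)
        then show ?thesis by (simp only: power_mult) (simp only: power_mult_distrib power_add mult_ac)
      qed
      then show "ennreal (?k * ((cmod (?r h)) ^ (2 * j) * (Re (?r h)) ^ (2 * m)))
        = ennreal (?k * (1 / c) ^ (j + m)) * ennreal ((cmod h) ^ (2 * j) * (Re h) ^ (2 * m))"
        using k' by (simp only: ennreal_mult')
    qed
    also have "\<dots> = ennreal (pi / c) * (ennreal (?k * (1 / c) ^ (j + m)) * ennreal (fact (j + m) / fact m * (fact (2 * m) / (4 ^ m * fact m))))"
      by (subst nn_integral_cmult) (auto simp only: nn_integral_std_gaussian_mixed_moment, measurable)
    also have "\<dots> = ennreal (pi / c * (?k * (1 / c) ^ (j + m) * (fact (j + m) / fact m * (fact (2 * m) / (4 ^ m * fact m)))))"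
    proof -
      have split: "ennreal (x * (y * z)) = ennreal x * (ennreal y * ennreal z)" if "0 \<le> x" "0 \<le> y" "0 \<le> z" for x y z :: real
        using that by (simp add: ennreal_mult)
      show ?thesis using k' c by (intro split[symmetric]) auto
    qed
    also have "pi / c * (?k * (1 / c) ^ (j + m) * (fact (j + m) / fact m * (fact (2 * m) / (4 ^ m * fact m))))
      = pi * (b j * a ^ (2 * m) / (fact m)\<^sup>2 * (fact (j + m) / c ^ Suc (j + m)))"
      by (simp add: power_mult_distrib power_mult power_one_over power2_eq_square mult_ac)
    also have "ennreal \<dots> = ennreal pi * (ennreal (b j * a ^ (2 * m) / (fact m)\<^sup>2) * ennreal (fact (j + m) / c ^ Suc (j + m)))"
      using b c by (subst ennreal_mult, simp, simp, subst ennreal_mult) auto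
    also have "ennreal (b j * a ^ (2 * m) / (fact m)\<^sup>2) * ennreal (fact (j + m) / c ^ Suc (j + m)) =
      (\<integral>\<^sup>+z. ennreal (b j * a ^ (2 * m) / (fact m)\<^sup>2) * (ennreal (z ^ (j + m) * exp (- c * z)) * indicator {0<..} z) \<partial>lborel)"
      using c by (subst nn_integral_cmult, simp, subst nn_integral_power_times_exp) auto
    also have "\<dots> = ?R"
    proof (rule nn_integral_cong)
      fix z :: real
      show "ennreal (b j * a ^ (2 * m) / (fact m)\<^sup>2) * (ennreal (z ^ (j + m) * exp (- c * z)) * indicator {0<..} z) =
        ?K j m z"
        using b unfolding power_mult by (cases "0 < z") (simp_all add: ennreal_mult[symmetric] power_mult_distrib power_add mult_ac)
    qed
    finally show ?thesis .
  qed
  have "(\<integral>\<^sup>+h. g h * ennreal (exp (2 * a * Re h)) \<partial>lborel) =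
    (\<Sum>m. \<integral>\<^sup>+h. g h * ennreal ((2 * a * Re h) ^ (2 * m) / fact (2 * m)) \<partial>lborel)"
  proof (rule nn_integral_exp_symmetric)
    have "(\<integral>\<^sup>+h. g h * ennreal (exp (2 * a * Re h)) \<partial>lborel) =
      (\<integral>\<^sup>+h. g (- h) * ennreal (exp (2 * a * Re (- h))) \<partial>lborel)"
      by (subst lborel_affine[of "-1" 0]) (auto simp: nn_integral_density nn_integral_distr)
    then show "(\<integral>\<^sup>+h. g h * ennreal (exp (- (2 * a * Re h))) \<partial>lborel) = (\<integral>\<^sup>+h. g h * ennreal (exp (2 * a * Re h)) \<partial>lborel)"
      by (simp add: g_def)
  qed auto
  also have "\<dots> = (\<Sum>m. \<Sum>j. \<integral>\<^sup>+h. ?C j m h \<partial>lborel)"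
    unfolding g_def
    by (intro suminf_cong, subst nn_integral_suminf[symmetric])
      (auto intro!: nn_integral_cong)
  also have "\<dots> = (\<Sum>m. \<Sum>j. ennreal pi * (\<integral>\<^sup>+z. ?K j m z \<partial>lborel))"
    by (simp only: summand)
  also have "\<dots> = ennreal pi * (\<Sum>m. \<Sum>j. (\<integral>\<^sup>+z. ?K j m z \<partial>lborel))"
    by (simp only: ennreal_suminf_cmult)
  also have "\<dots> = ennreal pi * (\<integral>\<^sup>+z. (\<Sum>m. \<Sum>j. ?K j m z) \<partial>lborel)"
  proof -
    have "(\<integral>\<^sup>+z. (\<Sum>m. \<Sum>j. ?K j m z) \<partial>lborel)
      = (\<Sum>m. \<integral>\<^sup>+z. (\<Sum>j. ?K j m z) \<partial>lborel)"
      by (rule nn_integral_suminf) measurable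
    also have "\<dots> = (\<Sum>m. \<Sum>j. \<integral>\<^sup>+z. ?K j m z \<partial>lborel)"
      by (intro suminf_cong nn_integral_suminf) measurable
    finally show ?thesis by (simp only:)
  qed
  also have "\<dots> = ennreal pi * (\<integral>\<^sup>+z. ennreal (exp (- c * z)) * (\<Sum>j. ennreal (b j * z ^ j)) * (\<Sum>m. ennreal ((a\<^sup>2 * z) ^ m / (fact m)\<^sup>2))
        * indicator {0<..} z \<partial>lborel)"
    by (simp only: ennreal_suminf_cmult ennreal_suminf_multc)
  finally show ?thesis unfolding g_def .
qed

subsection \<open>The single-block decoding metric\<close>

text \<open>With unit noise, minimising \<open>block_metric\<close> over \<open>x\<close> with \<open>\<parallel>x\<parallel>\<^sup>2 = P\<close> is maximum likelihood decoding of one block.\<close>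

definition block_metric :: "real \<Rightarrow> real \<Rightarrow> real \<Rightarrow> nat \<Rightarrow> (nat \<Rightarrow> complex) \<Rightarrow> (nat \<Rightarrow> complex) \<Rightarrow> real" where
  "block_metric \<mu> v P n x y =
    (vnorm n y)\<^sup>2 + \<mu>\<^sup>2 / v - (cmod (of_real (\<mu> / v) + (\<Sum>i<n. x i * cnj (y i))))\<^sup>2 / (1 / v + P)"

lemma cmod_diff_power2: "(cmod (a - b))\<^sup>2 = (cmod a)\<^sup>2 + (cmod b)\<^sup>2 - 2 * Re (a * cnj b)"
  by (simp add: cmod_power2 power2_diff)

lemma complete_square:
  fixes h b :: complex and B :: real
  assumes B: "0 < B"
  shows "B * (cmod h)\<^sup>2 - 2 * Re (h * b) = B * (cmod (h - cnj b / of_real B))\<^sup>2 - (cmod b)\<^sup>2 / B"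
proof -
  have "Re (h * cnj (cnj b / of_real B)) = Re (h * b) / B"
    by (simp only: complex_cnj_divide complex_cnj_cnj complex_cnj_complex_of_real times_divide_eq_right Re_divide_of_real)
  moreover have "(cmod (cnj b / of_real B))\<^sup>2 = (cmod b)\<^sup>2 / B\<^sup>2"
    by (simp add: norm_divide power_divide)
  ultimately have "B * (cmod (h - cnj b / of_real B))\<^sup>2 = B * ((cmod h)\<^sup>2 + (cmod b)\<^sup>2 / B\<^sup>2 - 2 * (Re (h * b) / B))"
    by (simp only: cmod_diff_power2)
  also have "\<dots> = B * (cmod h)\<^sup>2 + (B * (1 / B\<^sup>2)) * (cmod b)\<^sup>2 - 2 * ((B * (1 / B)) * Re (h * b))"
    by (simp only: right_diff_distrib distrib_left) simp
  also have "B * (1 / B\<^sup>2) = 1 / B" using B by (simp add: power2_eq_square)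
  also have "B * (1 / B) = 1" using B by simp
  finally show ?thesis by simp
qed

text \<open>Up to sign and normalisation, the left side is the log-density of fading h and output y
  for the input x. As a quadratic in h its leading coefficient \<open>1 / v + P\<close> is the same
  for all x on the sphere, so integrating h out yields a factor that does not discriminate between
  codewords.\<close>

lemma channel_exponent_expand:
  assumes "0 < v" and x: "(vnorm n x)\<^sup>2 = P"
  shows "(cmod (h - of_real \<mu>))\<^sup>2 / v + (vnorm n (\<lambda>i. y i - h * x i))\<^sup>2 = (1 / v + P) * (cmod h)\<^sup>2
    - 2 * Re (h * (of_real (\<mu> / v) + (\<Sum>i<n. x i * cnj (y i)))) + (\<mu>\<^sup>2 / v + (vnorm n y)\<^sup>2)"
proof -
  have "(cmod (y i - h * x i))\<^sup>2 = (cmod (y i))\<^sup>2 + (cmod h)\<^sup>2 * (cmod (x i))\<^sup>2 - 2 * Re (h * (x i * cnj (y i)))" for i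
    unfolding norm_minus_commute[of "y i"] cmod_diff_power2 by (simp add: norm_mult power_mult_distrib mult.assoc)
  then have "(vnorm n (\<lambda>i. y i - h * x i))\<^sup>2 = (vnorm n y)\<^sup>2 + (cmod h)\<^sup>2 * P - 2 * Re (h * (\<Sum>i<n. x i * cnj (y i)))"
    using x[symmetric] by (simp only: vnorm_power2 sum.distrib sum_subtractf sum_distrib_left Re_sum)
  moreover have "(cmod (h - of_real \<mu>))\<^sup>2 / v = (cmod h)\<^sup>2 / v + \<mu>\<^sup>2 / v - 2 * Re (h * of_real (\<mu> / v))"
    using assms by (simp add: cmod_diff_power2 diff_divide_distrib add_divide_distrib)
  ultimately show ?thesis by (simp add: algebra_simps)
qed

text \<open>\<open>block_metric\<close> is thus the minimum of the exponent over h, and it is the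
  part that survives integration over h.\<close>

lemma block_metric_complete_square:
  assumes v: "0 < v" and P: "0 \<le> P" and x: "(vnorm n x)\<^sup>2 = P"
  shows "(cmod (h - of_real \<mu>))\<^sup>2 / v + (vnorm n (\<lambda>i. y i - h * x i))\<^sup>2 =
    (1 / v + P) * (cmod (h - cnj (of_real (\<mu> / v) + (\<Sum>i<n. x i * cnj (y i))) / of_real (1 / v + P)))\<^sup>2 + block_metric \<mu> v P n x y"
proof -
  have "0 < 1 / v + P" using v P by (simp add: add_pos_nonneg)
  from complete_square[OF this, of h "of_real (\<mu> / v) + (\<Sum>i<n. x i * cnj (y i))"] show ?thesis
    unfolding channel_exponent_expand[OF v x] block_metric_def by linarith
qed

lemma block_metric_nonneg:
  assumes "0 < v" "0 \<le> P" "(vnorm n x)\<^sup>2 = P"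
  shows "0 \<le> block_metric \<mu> v P n x y"
proof -
  let ?h = "cnj (of_real (\<mu> / v) + (\<Sum>i<n. x i * cnj (y i))) / of_real (1 / v + P)"
  have "block_metric \<mu> v P n x y = (cmod (?h - of_real \<mu>))\<^sup>2 / v + (vnorm n (\<lambda>i. y i - ?h * x i))\<^sup>2"
    by (subst block_metric_complete_square[OF assms]) (simp only: diff_self norm_zero power2_eq_square mult_zero_right add_0)
  then show ?thesis using assms by simp
qed

text \<open>The average of \<open>exp (-s * Q)\<close> over random x as a function of the output
  norm t. The two series are those of \<open>I_(n-1)\<close>, with the power of its argument divided
  out, and of \<open>I_0\<close>; in this form t = 0 is a regular point and all terms are
  nonnegative.\<close>

definition metric_transform :: "real \<Rightarrow> real \<Rightarrow> real \<Rightarrow> nat \<Rightarrow> real \<Rightarrow> real \<Rightarrow> ennreal" where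
  "metric_transform \<mu> v P n s t = ennreal (s * (1 / v + P) * exp (- s * (\<mu>\<^sup>2 / v + t\<^sup>2))) *
    (\<integral>\<^sup>+z. ennreal (exp (- (s * (1 / v + P)) * z)) *
       (\<Sum>j. ennreal (fact (n - 1) / (fact j * fact (n + j - 1)) * (P * s\<^sup>2 * t\<^sup>2) ^ j * z ^ j)) *
       (\<Sum>m. ennreal (((s * \<mu> / v)\<^sup>2 * z) ^ m / (fact m)\<^sup>2)) * indicator {0<..} z \<partial>lborel)"

lemma measurable_sphere_point:
  assumes "i < n"
  shows "(\<lambda>w. sphere_point n P w i) \<in> borel_measurable (std_gaussian_vec {..<n})"
proof -
  have i: "i \<in> {..<n}" using assms by simp
  show ?thesis
  proof (cases "i = 0")
    case True
    then have "0 \<in> {..<n}" using i by simp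
    then show ?thesis unfolding sphere_point_def vnorm_def L2_set_def True if_True by measurable
  next
    case False
    then show ?thesis using i unfolding sphere_point_def vnorm_def L2_set_def by (simp only: if_False) measurable
  qed
qed

text \<open>Reading the completed square backwards gives an integral over h in which x enters the
  exponent linearly. Averaging over x first is then a moment generating function on the sphere,
  which depends on h only through |h|; the remaining factor
  \<open>exp (2 * (s * mu / v) * Re h)\<close> fits the radial integral.\<close>

lemma nn_integral_metric_transform:
  assumes v: "0 < v" and P: "0 \<le> P" and n: "1 \<le> n" and s: "0 < s"
  shows "(\<integral>\<^sup>+w. ennreal (exp (- s * block_metric \<mu> v P n (sphere_point n P w) y)) \<partial>std_gaussian_vec {..<n})
    = metric_transform \<mu> v P n s (vnorm n y)"
proof -
  let ?G = "std_gaussian_vec {..<n}"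
  let ?x = "sphere_point n P" and ?c = "s * (1 / v + P)" and ?t = "vnorm n y"
  have B: "0 < 1 / v + P" using v P by (simp add: add_pos_nonneg)
  then have c: "0 < ?c" using s by simp
  have x_measurable [measurable]: "(\<lambda>w. ?x w i) \<in> borel_measurable ?G" if "i \<in> {..<n}" for i
    using that measurable_sphere_point by simp
  let ?e = "\<lambda>h. exp (- ?c * (cmod h)\<^sup>2 + 2 * (s * \<mu> / v) * Re h - s * (\<mu>\<^sup>2 / v + ?t\<^sup>2))"
  let ?d = "\<lambda>h w. \<Sum>i<n. of_real s * h * cnj (y i) * ?x w i"
  let ?A = "\<lambda>h::complex. \<Sum>j. ennreal (fact (n - 1) / (fact j * fact (n + j - 1)) * (P * (\<Sum>i<n. (cmod (of_real s * h * cnj (y i)))\<^sup>2)) ^ j)"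
  let ?B = "\<lambda>h::complex. \<Sum>j. ennreal (fact (n - 1) / (fact j * fact (n + j - 1)) * (P * s\<^sup>2 * ?t\<^sup>2) ^ j * ((cmod h)\<^sup>2) ^ j)"
  have "(\<integral>\<^sup>+w. ennreal (exp (- s * block_metric \<mu> v P n (?x w) y)) \<partial>?G)
    = (\<integral>\<^sup>+w. \<integral>\<^sup>+h. ennreal (?c / pi) * (ennreal (?e h) * ennreal (exp (2 * Re (?d h w)))) \<partial>lborel \<partial>?G)"
  proof (rule nn_integral_cong)
    fix w
    define x where "x = ?x w"
    have x: "(vnorm n x)\<^sup>2 = P" unfolding x_def using n P by (rule vnorm_sphere_point)
    \<comment> \<open>The minimiser in h: the Gaussian weight centred at m integrates to
      \<open>pi / ?c\<close>, which the factor \<open>?c / pi\<close> cancels.\<close>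
    define m where "m = cnj (of_real (\<mu> / v) + (\<Sum>i<n. x i * cnj (y i))) / of_real (1 / v + P)"
    have eq: "?e h * exp (2 * Re (\<Sum>i<n. of_real s * h * cnj (y i) * x i)) = exp (- s * block_metric \<mu> v P n x y) * exp (- ?c * (cmod (h - m))\<^sup>2)" for h
    proof -
      have 1: "(cmod (h - of_real \<mu>))\<^sup>2 / v + (vnorm n (\<lambda>i. y i - h * x i))\<^sup>2 = (1 / v + P) * (cmod (h - m))\<^sup>2 + block_metric \<mu> v P n x y"
        unfolding m_def by (rule block_metric_complete_square[OF v P x])
      have "(\<Sum>i<n. of_real s * h * cnj (y i) * x i) = of_real s * (h * (\<Sum>i<n. x i * cnj (y i)))"
        by (simp add: sum_distrib_left mult_ac)
      then have 2: "Re (\<Sum>i<n. of_real s * h * cnj (y i) * x i) = s * Re (h * (\<Sum>i<n. x i * cnj (y i)))"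
        by (simp only: Re_complex_of_real Im_complex_of_real times_complex.sel mult_zero_left diff_zero)
      have 3: "Re (h * (of_real (\<mu> / v) + (\<Sum>i<n. x i * cnj (y i)))) = \<mu> / v * Re h + Re (h * (\<Sum>i<n. x i * cnj (y i)))"
        by (simp only: distrib_left plus_complex.sel times_complex.sel Re_complex_of_real Im_complex_of_real) simp
      have 4: "- (s * B) * a + 2 * (s * \<mu> / v) * b - s * e + 2 * (s * q) = - s * (B * a - 2 * (\<mu> / v * b + q) + e)" for B a b e q
        by (simp add: algebra_simps)
      have "- ?c * (cmod h)\<^sup>2 + 2 * (s * \<mu> / v) * Re h - s * (\<mu>\<^sup>2 / v + ?t\<^sup>2) + 2 * Re (\<Sum>i<n. of_real s * h * cnj (y i) * x i)
        = - s * ((cmod (h - of_real \<mu>))\<^sup>2 / v + (vnorm n (\<lambda>i. y i - h * x i))\<^sup>2)"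
        unfolding channel_exponent_expand[OF v x] 2 3 by (rule 4)
      also have "\<dots> = - s * block_metric \<mu> v P n x y + - ?c * (cmod (h - m))\<^sup>2"
        unfolding 1 by (simp add: algebra_simps)
      finally show ?thesis by (simp only: exp_add[symmetric])
    qed
    have "(\<integral>\<^sup>+h. ennreal (?c / pi) * (ennreal (?e h) * ennreal (exp (2 * Re (\<Sum>i<n. of_real s * h * cnj (y i) * x i)))) \<partial>lborel)
      = (\<integral>\<^sup>+h. ennreal (?c / pi) * ennreal (exp (- s * block_metric \<mu> v P n x y)) * (ennreal (exp (- ?c * (cmod (h - m))\<^sup>2)) * 1) \<partial>lborel)"
    proof (rule nn_integral_cong)
      fix h
      have "ennreal (?e h) * ennreal (exp (2 * Re (\<Sum>i<n. of_real s * h * cnj (y i) * x i))) =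
        ennreal (exp (- s * block_metric \<mu> v P n x y)) * ennreal (exp (- ?c * (cmod (h - m))\<^sup>2))"
        unfolding ennreal_mult[OF exp_ge_zero exp_ge_zero, symmetric] eq ..
      then show "ennreal (?c / pi) * (ennreal (?e h) * ennreal (exp (2 * Re (\<Sum>i<n. of_real s * h * cnj (y i) * x i)))) =
        ennreal (?c / pi) * ennreal (exp (- s * block_metric \<mu> v P n x y)) * (ennreal (exp (- ?c * (cmod (h - m))\<^sup>2)) * 1)"
        by (simp only: mult.assoc mult_1_right)
    qed
    also have "\<dots> = ennreal (?c / pi) * ennreal (exp (- s * block_metric \<mu> v P n x y)) * (ennreal (pi / ?c))"
      using c prob_space.emeasure_space_1[OF prob_space_std_gaussian]
      by (subst nn_integral_cmult, simp, subst nn_integral_gaussian_weight) auto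
    also have "\<dots> = ennreal (?c / pi) * ennreal (pi / ?c) * ennreal (exp (- s * block_metric \<mu> v P n x y))"
      by (simp only: mult_ac)
    also have "ennreal (?c / pi) * ennreal (pi / ?c) = 1"
      using c by (subst ennreal_mult[symmetric]) auto
    finally show "ennreal (exp (- s * block_metric \<mu> v P n (?x w) y)) =
      (\<integral>\<^sup>+h. ennreal (?c / pi) * (ennreal (?e h) * ennreal (exp (2 * Re (?d h w)))) \<partial>lborel)"
      by (simp only: x_def mult_1)
  qed
  also have "\<dots> = (\<integral>\<^sup>+h. \<integral>\<^sup>+w. ennreal (?c / pi) * (ennreal (?e h) * ennreal (exp (2 * Re (?d h w)))) \<partial>?G \<partial>lborel)"
  proof (rule nn_integral_swap)
    show "(\<lambda>(w, h). ennreal (?c / pi) * (ennreal (?e h) * ennreal (exp (2 * Re (?d h w)))))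
      \<in> borel_measurable (?G \<Otimes>\<^sub>M lborel)" by measurable
  qed (simp_all only: prob_space_std_vec sigma_finite_lborel simp_thms)
  also have "\<dots> = (\<integral>\<^sup>+h. ennreal (?c / pi) * (ennreal (?e h) *
      ?A h) \<partial>lborel)"
  proof (rule nn_integral_cong)
    fix h :: complex
    have "(\<lambda>w. ennreal (exp (2 * Re (?d h w)))) \<in> borel_measurable ?G" by measurable
    then show "(\<integral>\<^sup>+w. ennreal (?c / pi) * (ennreal (?e h) * ennreal (exp (2 * Re (?d h w)))) \<partial>?G) =
      ennreal (?c / pi) * (ennreal (?e h) *
      ?A h)"
      unfolding sphere_point_mgf[OF n P, of "\<lambda>i. of_real s * h * cnj (y i)", symmetric]
      by (simp only: mult.assoc[symmetric] nn_integral_cmult)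
  qed
  also have "\<dots> = (\<integral>\<^sup>+h. ennreal (?c / pi) * (ennreal (exp (- s * (\<mu>\<^sup>2 / v + ?t\<^sup>2))) * (ennreal (exp (- ?c * (cmod h)\<^sup>2)) *
      ?B h *
      ennreal (exp (2 * (s * \<mu> / v) * Re h)))) \<partial>lborel)"
  proof (intro nn_integral_cong arg_cong[where f="\<lambda>x. ennreal (?c / pi) * x"])
    fix h :: complex
    have e: "ennreal (?e h) = ennreal (exp (- s * (\<mu>\<^sup>2 / v + ?t\<^sup>2))) * (ennreal (exp (- ?c * (cmod h)\<^sup>2)) * ennreal (exp (2 * (s * \<mu> / v) * Re h)))"
      by (simp only: ennreal_mult[symmetric] exp_ge_zero mult_nonneg_nonneg exp_add[symmetric]) (simp add: algebra_simps)
    have "P * (\<Sum>i<n. (cmod (of_real s * h * cnj (y i)))\<^sup>2) = (P * s\<^sup>2 * ?t\<^sup>2) * (cmod h)\<^sup>2"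
      by (simp add: vnorm_power2 norm_mult power_mult_distrib sum_distrib_left mult_ac)
    then have q: "(P * (\<Sum>i<n. (cmod (of_real s * h * cnj (y i)))\<^sup>2)) ^ j = (P * s\<^sup>2 * ?t\<^sup>2) ^ j * ((cmod h)\<^sup>2) ^ j" for j
      by (simp only: power_mult_distrib)
    show "ennreal (?e h) * ?A h =
      ennreal (exp (- s * (\<mu>\<^sup>2 / v + ?t\<^sup>2))) * (ennreal (exp (- ?c * (cmod h)\<^sup>2)) *
      ?B h *
      ennreal (exp (2 * (s * \<mu> / v) * Re h)))"
      unfolding e q by (simp only: mult.assoc) (simp only: mult_ac)
  qed
  also have "\<dots> = ennreal (?c / pi) * (ennreal (exp (- s * (\<mu>\<^sup>2 / v + ?t\<^sup>2))) * (\<integral>\<^sup>+h. ennreal (exp (- ?c * (cmod h)\<^sup>2)) *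
      ?B h *
      ennreal (exp (2 * (s * \<mu> / v) * Re h)) \<partial>lborel))"
    by (subst nn_integral_cmult, measurable, subst nn_integral_cmult) (auto)
  also have "\<dots> = (ennreal (?c / pi) * ennreal pi) * ennreal (exp (- s * (\<mu>\<^sup>2 / v + ?t\<^sup>2))) *
    (\<integral>\<^sup>+z. ennreal (exp (- ?c * z)) *
       (\<Sum>j. ennreal (fact (n - 1) / (fact j * fact (n + j - 1)) * (P * s\<^sup>2 * ?t\<^sup>2) ^ j * z ^ j)) *
       (\<Sum>m. ennreal (((s * \<mu> / v)\<^sup>2 * z) ^ m / (fact m)\<^sup>2)) * indicator {0<..} z \<partial>lborel)"
    using P by (subst nn_integral_polar_series[OF c]) (simp, simp only: mult.assoc mult.left_commute[of "ennreal pi"])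
  also have "ennreal (?c / pi) * ennreal pi = ennreal ?c"
    using c by (subst ennreal_mult[symmetric]) auto
  finally show ?thesis unfolding metric_transform_def using c
    by (subst ennreal_mult) auto
qed

section \<open>Bessel functions and the integral in the bound\<close>

lemma bessel_I_sums:
  assumes "0 \<le> x"
  shows "(\<lambda>m. (x / 2) ^ (2 * m + \<nu>) / (fact m * fact (m + \<nu>))) sums bessel_I \<nu> x"
proof -
  define y where "y = x / 2"
  have y: "0 \<le> y" using assms by (simp add: y_def)
  have "summable (\<lambda>m. y ^ \<nu> * (inverse (fact m) * (y\<^sup>2) ^ m))"
    by (rule summable_mult) (rule summable_exp)
  then have "summable (\<lambda>m. y ^ (2 * m + \<nu>) / (fact m * fact (m + \<nu>)))"
  proof (rule summable_comparison_test'[where N=0])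
    fix m
    have "(1::real) \<le> fact (m + \<nu>)" by (rule fact_ge_1)
    then have "y ^ (2 * m + \<nu>) / fact m / fact (m + \<nu>) \<le> y ^ (2 * m + \<nu>) / fact m / 1"
      using y by (intro divide_left_mono) auto
    also have "\<dots> = y ^ \<nu> * (inverse (fact m) * (y\<^sup>2) ^ m)"
      unfolding power_add power_mult by (simp add: divide_inverse)
    finally show "norm (y ^ (2 * m + \<nu>) / (fact m * fact (m + \<nu>))) \<le> y ^ \<nu> * (inverse (fact m) * (y\<^sup>2) ^ m)"
      using y by simp
  qed
  moreover have "Gamma (real (m + \<nu> + 1)) = fact (m + \<nu>)" for m
    using Gamma_fact[of "m + \<nu>", where 'a=real] by (simp only: of_nat_add of_nat_1 add.commute add.left_commute)
  ultimately show ?thesis unfolding bessel_I_def y_def by (simp only: summable_sums)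
qed

lemma ennreal_bessel_I:
  "0 \<le> x \<Longrightarrow> ennreal (bessel_I \<nu> x) = (\<Sum>m. ennreal ((x / 2) ^ (2 * m + \<nu>) / (fact m * fact (m + \<nu>))))"
  by (rule suminf_ennreal_eq[symmetric]) (auto intro: bessel_I_sums)

lemma bessel_I_nonneg: "0 \<le> x \<Longrightarrow> 0 \<le> bessel_I \<nu> x"
  by (rule sums_le[OF _ sums_zero bessel_I_sums]) auto

lemma borel_measurable_bessel_I [measurable]: "bessel_I \<nu> \<in> borel_measurable borel"
  unfolding bessel_I_def[abs_def] by measurable

lemma borel_measurable_metric_transform [measurable]: "metric_transform \<mu> v P n s \<in> borel_measurable borel"
  unfolding metric_transform_def[abs_def] by measurable

lemma borel_measurable_block_metric:
  "(\<lambda>w. block_metric \<mu> v P n (sphere_point n P w) y) \<in> borel_measurable (std_gaussian_vec {..<n})"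
proof -
  have [measurable]: "(\<lambda>w. sphere_point n P w i) \<in> borel_measurable (std_gaussian_vec {..<n})" if "i \<in> {..<n}" for i
    using that by (simp add: measurable_sphere_point)
  show ?thesis unfolding block_metric_def by measurable
qed

text \<open>A mean of values in (0, 1], evaluated at an output of norm t, lies in (0, 1]. This makes
  the logarithm of the transform meaningful.\<close>

lemma metric_transform_bounds:
  assumes v: "0 < v" and P: "0 \<le> P" and n: "1 \<le> n" and s: "0 < s" and t: "0 \<le> t"
  shows "0 < metric_transform \<mu> v P n s t" "metric_transform \<mu> v P n s t \<le> 1"
proof -
  let ?y = "\<lambda>i. if i = 0 then complex_of_real t else 0"
  let ?f = "\<lambda>w. ennreal (exp (- s * block_metric \<mu> v P n (sphere_point n P w) ?y))"
  have mt: "metric_transform \<mu> v P n s t = (\<integral>\<^sup>+w. ?f w \<partial>std_gaussian_vec {..<n})"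
    using t by (simp only: nn_integral_metric_transform[OF v P n s] vnorm_unit[OF n]) simp
  have f_measurable: "?f \<in> borel_measurable (std_gaussian_vec {..<n})"
  proof -
    have "(\<lambda>x. ennreal (exp (- s * x))) \<in> borel_measurable borel" by measurable
    from measurable_compose[OF borel_measurable_block_metric this] show ?thesis .
  qed
  have "?f w \<le> 1" for w
    using s block_metric_nonneg[OF v P vnorm_sphere_point[OF n P], of \<mu> w ?y] by (simp add: ennreal_le_1)
  then have "(\<integral>\<^sup>+w. ?f w \<partial>std_gaussian_vec {..<n}) \<le> (\<integral>\<^sup>+w. 1 \<partial>std_gaussian_vec {..<n})"
    by (intro nn_integral_mono) auto
  then show "metric_transform \<mu> v P n s t \<le> 1"
    unfolding mt by (simp add: std_vec.emeasure_space_1)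
  have "(\<integral>\<^sup>+w. ?f w \<partial>std_gaussian_vec {..<n}) \<noteq> 0"
    unfolding nn_integral_0_iff_AE[OF f_measurable] by simp
  then show "0 < metric_transform \<mu> v P n s t" unfolding mt by (simp add: zero_less_iff_neq_zero)
qed

lemma enn2real_metric_transform:
  assumes "0 < v" "0 \<le> P" "1 \<le> n" "0 < s" "0 \<le> t"
  shows "0 < enn2real (metric_transform \<mu> v P n s t)"
    "ennreal (enn2real (metric_transform \<mu> v P n s t)) = metric_transform \<mu> v P n s t"
proof -
  note bounds = metric_transform_bounds[OF assms, of \<mu>]
  have "metric_transform \<mu> v P n s t < top" by (rule le_less_trans[OF bounds(2)]) simp
  then show "0 < enn2real (metric_transform \<mu> v P n s t)"
    "ennreal (enn2real (metric_transform \<mu> v P n s t)) = metric_transform \<mu> v P n s t"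
    using bounds(1) by (simp_all add: enn2real_positive_iff)
qed

text \<open>For n \<ge> 2 and t = 0 the quotient in the integrand is a division by zero and
  evaluates to 0, while the series has a positive value there; hence the condition on t. The factor
  \<open>s ^ (n - 1) / fact (n - 1)\<close> arises from
  \<open>I_(n-1)(2 * s * q) / q ^ (n - 1)\<close> with \<open>q = t * sqrt (P * z)\<close>.\<close>

lemma bessel_integral_eq_metric_transform:
  assumes v: "0 < v" and P': "0 < P" and n: "1 \<le> n" and s: "0 < s" and t: "0 < t \<or> n = 1 \<and> t = 0"
  shows "(LINT z:{0<..}|lborel. exp (- s * (P + 1 / v) * z) / (t * sqrt (P * z)) ^ (n - 1)
               * bessel_I (n - 1) (2 * s * t * sqrt (P * z)) * bessel_I 0 (2 * s * (1 / v) * sqrt (z * \<bar>\<mu>\<bar>\<^sup>2)))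
    = s ^ (n - 1) / fact (n - 1) * (enn2real (metric_transform \<mu> v P n s t) / (s * (1 / v + P) * exp (- s * (\<mu>\<^sup>2 / v + t\<^sup>2))))"
    (is "(LINT z:{0<..}|lborel. ?f z) = _")
proof -
  define N where "N = (\<integral>\<^sup>+z. ennreal (exp (- (s * (1 / v + P)) * z)) *
       (\<Sum>j. ennreal (fact (n - 1) / (fact j * fact (n + j - 1)) * (P * s\<^sup>2 * t\<^sup>2) ^ j * z ^ j)) *
       (\<Sum>m. ennreal (((s * \<mu> / v)\<^sup>2 * z) ^ m / (fact m)\<^sup>2)) * indicator {0<..} z \<partial>lborel)"
  define k where "k = s * (1 / v + P) * exp (- s * (\<mu>\<^sup>2 / v + t\<^sup>2))"
  have t0: "0 \<le> t" using t by auto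
  have P: "0 \<le> P" using P' by simp
  have k: "0 < k" using v P s by (simp add: k_def add_pos_nonneg)
  have mt: "metric_transform \<mu> v P n s t = ennreal k * N"
    by (simp only: metric_transform_def k_def N_def)
  have eq: "ennreal (indicator {0<..} z *\<^sub>R ?f z) = ennreal (s ^ (n - 1) / fact (n - 1)) *
      (ennreal (exp (- (s * (1 / v + P)) * z)) *
       (\<Sum>j. ennreal (fact (n - 1) / (fact j * fact (n + j - 1)) * (P * s\<^sup>2 * t\<^sup>2) ^ j * z ^ j)) *
       (\<Sum>m. ennreal (((s * \<mu> / v)\<^sup>2 * z) ^ m / (fact m)\<^sup>2)) * indicator {0<..} z)" for z
  proof (cases "0 < z")
    case True
    define q where "q = t * sqrt (P * z)"
    \<comment> \<open>Either q can be cancelled, or \<open>q ^ (n - 1)\<close> is the constant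
      1.\<close>
    have q: "0 \<le> q" "q \<noteq> 0 \<or> n = 1" using t t0 True P' by (auto simp: q_def)
    have sq: "(s * q)\<^sup>2 = P * s\<^sup>2 * t\<^sup>2 * z" using True P by (simp add: q_def power_mult_distrib)
    have b1: "ennreal (bessel_I (n - 1) (2 * s * t * sqrt (P * z)) / q ^ (n - 1)) = ennreal (s ^ (n - 1) / fact (n - 1)) *
        (\<Sum>j. ennreal (fact (n - 1) / (fact j * fact (n + j - 1)) * (P * s\<^sup>2 * t\<^sup>2) ^ j * z ^ j))"
    proof -
      have "ennreal (bessel_I (n - 1) (2 * s * t * sqrt (P * z)) / q ^ (n - 1)) =
        ennreal (bessel_I (n - 1) (2 * (s * q))) * ennreal (1 / q ^ (n - 1))"
        using q s by (subst ennreal_mult[symmetric]) (auto simp: bessel_I_nonneg q_def mult_ac)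
      also have "\<dots> = (\<Sum>j. ennreal ((s * q) ^ (2 * j + (n - 1)) / (fact j * fact (j + (n - 1)))) * ennreal (1 / q ^ (n - 1)))"
        using q s by (subst ennreal_bessel_I) (auto simp: ennreal_suminf_multc)
      also have "\<dots> = (\<Sum>j. ennreal (s ^ (n - 1) / fact (n - 1)) * ennreal (fact (n - 1) / (fact j * fact (n + j - 1)) * (P * s\<^sup>2 * t\<^sup>2) ^ j * z ^ j))"
      proof (rule suminf_cong)
        fix j
        have j: "j + (n - 1) = n + j - 1" using n by simp
        have "(s * q) ^ (2 * j + (n - 1)) = (P * s\<^sup>2 * t\<^sup>2) ^ j * z ^ j * (s ^ (n - 1) * q ^ (n - 1))"
        proof -
          have "(s * q) ^ (2 * j + (n - 1)) = ((s * q)\<^sup>2) ^ j * (s * q) ^ (n - 1)" by (simp only: power_add power_mult)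
          then show ?thesis unfolding sq by (simp only: power_mult_distrib mult_ac)
        qed
        moreover have "q ^ (n - 1) * (1 / q ^ (n - 1)) = 1" using q by auto
        ultimately have "(s * q) ^ (2 * j + (n - 1)) / (fact j * fact (j + (n - 1))) * (1 / q ^ (n - 1)) =
          s ^ (n - 1) / fact (n - 1) * (fact (n - 1) / (fact j * fact (n + j - 1)) * (P * s\<^sup>2 * t\<^sup>2) ^ j * z ^ j)"
          unfolding j by (auto simp: field_simps)
        then show "ennreal ((s * q) ^ (2 * j + (n - 1)) / (fact j * fact (j + (n - 1)))) * ennreal (1 / q ^ (n - 1)) =
          ennreal (s ^ (n - 1) / fact (n - 1)) * ennreal (fact (n - 1) / (fact j * fact (n + j - 1)) * (P * s\<^sup>2 * t\<^sup>2) ^ j * z ^ j)"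
          using q s P True by (simp add: ennreal_mult[symmetric] del: ennreal_fact)
      qed
      finally show ?thesis by (simp only: ennreal_suminf_cmult)
    qed
    have b2: "ennreal (bessel_I 0 (2 * s * (1 / v) * sqrt (z * \<bar>\<mu>\<bar>\<^sup>2))) = (\<Sum>m. ennreal (((s * \<mu> / v)\<^sup>2 * z) ^ m / (fact m)\<^sup>2))"
    proof -
      have "(2 * s * (1 / v) * sqrt (z * \<bar>\<mu>\<bar>\<^sup>2) / 2)\<^sup>2 = (s * \<mu> / v)\<^sup>2 * z"
        using True by (simp add: power_mult_distrib power_divide)
      then have "(2 * s * (1 / v) * sqrt (z * \<bar>\<mu>\<bar>\<^sup>2) / 2) ^ (2 * m + 0) / (fact m * fact (m + 0)) = ((s * \<mu> / v)\<^sup>2 * z) ^ m / (fact m)\<^sup>2" for m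
        by (simp only: add_0_right power_mult) (simp add: power2_eq_square)
      then show ?thesis using s v True by (subst ennreal_bessel_I) auto
    qed
    have n1: "0 \<le> bessel_I (n - 1) (2 * s * t * sqrt (P * z)) / q ^ (n - 1)"
      using s t0 P True q by (intro divide_nonneg_nonneg bessel_I_nonneg) auto
    have n2: "0 \<le> bessel_I 0 (2 * s * (1 / v) * sqrt (z * \<bar>\<mu>\<bar>\<^sup>2))"
      using s v True by (intro bessel_I_nonneg) auto
    have "indicator {0<..} z *\<^sub>R ?f z = exp (- (s * (1 / v + P)) * z) * ((bessel_I (n - 1) (2 * s * t * sqrt (P * z)) / q ^ (n - 1)) * bessel_I 0 (2 * s * (1 / v) * sqrt (z * \<bar>\<mu>\<bar>\<^sup>2)))"
      using True by (simp add: q_def algebra_simps)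
    then have "ennreal (indicator {0<..} z *\<^sub>R ?f z) = ennreal (exp (- (s * (1 / v + P)) * z)) * (ennreal (bessel_I (n - 1) (2 * s * t * sqrt (P * z)) / q ^ (n - 1)) *
      ennreal (bessel_I 0 (2 * s * (1 / v) * sqrt (z * \<bar>\<mu>\<bar>\<^sup>2))))"
      by (simp only: ennreal_mult n1 n2 mult_nonneg_nonneg exp_ge_zero)
    then show ?thesis using True unfolding b1 b2 by (simp only: mult_ac indicator_simps greaterThan_iff mult_1)
  qed simp
  have nonneg: "0 \<le> indicator {0<..} z *\<^sub>R ?f z" for z
    using s v P t0 by (cases "0 < z") (auto intro!: mult_nonneg_nonneg bessel_I_nonneg divide_nonneg_nonneg simp: indicator_def)
  \<comment> \<open>For a nonnegative integrand the Bochner integral is always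
    \<open>enn2real\<close> of the \<open>ennreal\<close> integral, an infinite value giving 0 on
    either side.\<close>
  have "(LINT z:{0<..}|lborel. ?f z) = enn2real (\<integral>\<^sup>+z. ennreal (indicator {0<..} z *\<^sub>R ?f z) \<partial>lborel)"
    unfolding set_lebesgue_integral_def using nonneg by (intro integral_eq_nn_integral) auto
  also have "\<dots> = enn2real (ennreal (s ^ (n - 1) / fact (n - 1)) * N)"
    unfolding eq N_def by (subst nn_integral_cmult) auto
  also have "\<dots> = s ^ (n - 1) / fact (n - 1) * enn2real N"
    using s by (simp add: enn2real_mult)
  also have "enn2real N = enn2real (metric_transform \<mu> v P n s t) / k"
    using k unfolding mt by (simp add: enn2real_mult)
  finally show ?thesis unfolding k_def .
qed

text \<open>The generalised information density of mismatched decoding: the logarithm of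
  \<open>exp (-s * q)\<close> over its mean for an independent codeword. It takes two real numbers
  because the joint law of metric and output norm is what can be computed.\<close>

definition info_density :: "real \<Rightarrow> real \<Rightarrow> real \<Rightarrow> nat \<Rightarrow> real \<Rightarrow> real \<Rightarrow> real \<Rightarrow> real" where
  "info_density \<mu> v P n s q t = - s * q - ln (enn2real (metric_transform \<mu> v P n s t))"

lemma borel_measurable_info_density [measurable]:
  "(\<lambda>(q, t). info_density \<mu> v P n s q t) \<in> borel_measurable (borel \<Otimes>\<^sub>M borel)"
  unfolding info_density_def by measurable

lemma rician_pos: "0 \<le> \<kappa> \<Longrightarrow> 0 < rician_var \<kappa>" "0 \<le> \<kappa> \<Longrightarrow> 0 \<le> rician_mean \<kappa>"
  by (auto simp: rician_var_def rician_mean_def)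

text \<open>All terms but \<open>- s * q\<close> and the logarithm of the transform cancel against
  the prefactors. The coefficient n - 2 of \<open>ln s\<close> is made of n - 1 powers of s from the
  Bessel function and one in the prefactor \<open>s * (1 / v + P)\<close>, which enters with the
  opposite sign.\<close>

lemma S_term_eq_info_density:
  assumes \<kappa>: "0 \<le> \<kappa>" and \<rho>: "0 < \<rho>" and n: "1 \<le> n" and s: "0 < s"
    and t: "vnorm n (W_tilde \<kappa> n \<rho> w) \<noteq> 0 \<or> n = 1"
  shows "S_term \<kappa> n \<rho> s w = info_density (rician_mean \<kappa>) (rician_var \<kappa>) (real n * \<rho>) n s ((vnorm n w)\<^sup>2) (vnorm n (W_tilde \<kappa> n \<rho> w))"
proof -
  define \<mu> v P t where "\<mu> = rician_mean \<kappa>" and "v = rician_var \<kappa>" and "P = \<rho> * real n" and "t = vnorm n (W_tilde \<kappa> n \<rho> w)"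
  have v: "0 < v" and \<mu>: "0 \<le> \<mu>" using \<kappa> by (auto simp: v_def \<mu>_def rician_pos)
  have P: "0 < P" using \<rho> n by (simp add: P_def)
  have t0: "0 \<le> t" and t1: "0 < t \<or> n = 1 \<and> t = 0" using t by (auto simp: t_def less_le)
  define D where "D = enn2real (metric_transform \<mu> v P n s t)"
  have D: "0 < D" unfolding D_def using v P n s t0 by (intro enn2real_metric_transform) auto
  define B where "B = 1 / v + P"
  have B: "0 < B" using v P by (simp add: B_def add_pos_nonneg)
  let ?L = "s ^ (n - 1) / fact (n - 1) * (D / (s * B * exp (- s * (\<mu>\<^sup>2 / v + t\<^sup>2))))"
  have L: "(LINT z:{0<..}|lborel. exp (- s * (P + 1 / v) * z) / (t * sqrt (P * z)) ^ (n - 1)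
               * bessel_I (n - 1) (2 * s * t * sqrt (P * z)) * bessel_I 0 (2 * s * (1 / v) * sqrt (z * \<bar>\<mu>\<bar>\<^sup>2))) = ?L"
    unfolding D_def B_def using v P n s \<mu> t1 by (intro bessel_integral_eq_metric_transform) auto
  have lnL: "ln ?L = real (n - 1) * ln s - ln (fact (n - 1)) + (ln D - (ln s + ln B + - s * (\<mu>\<^sup>2 / v + t\<^sup>2)))"
  proof -
    have "ln ?L = ln (s ^ (n - 1) / fact (n - 1)) + ln (D / (s * B * exp (- s * (\<mu>\<^sup>2 / v + t\<^sup>2))))"
      using s B D by (intro ln_mult_pos) auto
    moreover have "ln (s ^ (n - 1) / fact (n - 1)) = real (n - 1) * ln s - ln (fact (n - 1))"
      using s by (simp add: ln_divide_pos ln_realpow)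
    moreover have "ln (D / (s * B * exp (- s * (\<mu>\<^sup>2 / v + t\<^sup>2)))) = ln D - (ln s + ln B + - s * (\<mu>\<^sup>2 / v + t\<^sup>2))"
      using s B D by (simp add: ln_divide_pos ln_mult_pos)
    ultimately show ?thesis by simp
  qed
  have G: "Gamma (real n) = fact (n - 1)" using Gamma_fact[of "n - 1", where 'a=real] n by (simp add: of_nat_diff)
  have B': "(1 + v * real n * \<rho>) / v = B" using v by (simp add: B_def P_def field_simps)
  have "S_term \<kappa> n \<rho> s w = (real n - 2) * ln s - ln B - ln (fact (n - 1)) - s * ((vnorm n w)\<^sup>2 - t\<^sup>2) + s * \<mu>\<^sup>2 / v - ln ?L"
    unfolding S_term_def Let_def \<mu>_def[symmetric] v_def[symmetric] t_def[symmetric] P_def[symmetric] L B' G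
    by simp
  also have "\<dots> = - s * (vnorm n w)\<^sup>2 - ln D"
    unfolding lnL using n by (simp add: of_nat_diff algebra_simps)
  finally show ?thesis by (simp add: info_density_def D_def \<mu>_def v_def P_def t_def mult.commute)
qed

section \<open>Joint law of the metric and the output norm in one block\<close>

lemma borel_measurable_cnj [measurable (raw)]:
  "f \<in> borel_measurable M \<Longrightarrow> (\<lambda>x. cnj (f x)) \<in> borel_measurable M"
  by (rule measurable_compose[where N=borel]) (auto intro!: borel_measurable_continuous_onI continuous_intros)

text \<open>A sum of independent circular Gaussians: rotating the pair of fading and noise with
  coefficients \<open>sqrt (v * P)\<close> and 1 leaves a single coordinate of variance
  \<open>v * P + 1\<close>.\<close>

lemma nn_integral_faded_gaussian:
  assumes v: "0 < v" and P: "0 \<le> P" and [measurable]: "f \<in> borel_measurable borel"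
  shows "(\<integral>\<^sup>+h. \<integral>\<^sup>+w. f (of_real (sqrt P) * h + w) \<partial>std_gaussian \<partial>complex_gaussian (of_real \<mu>) v)
    = (\<integral>\<^sup>+z. f (of_real (\<mu> * sqrt P) + of_real (sqrt (v * P + 1)) * z) \<partial>std_gaussian)"
proof -
  let ?G = "std_gaussian"
  have "(\<integral>\<^sup>+h. \<integral>\<^sup>+w. f (of_real (sqrt P) * h + w) \<partial>?G \<partial>complex_gaussian (of_real \<mu>) v) =
    (\<integral>\<^sup>+z. \<integral>\<^sup>+w. f (of_real (sqrt P) * (of_real \<mu> + of_real (sqrt v) * z) + w) \<partial>?G \<partial>?G)"
    by (rule complex_gaussian_affine[OF v]) measurable
  also have "\<dots> = (\<integral>\<^sup>+z. \<integral>\<^sup>+w. f (of_real (\<mu> * sqrt P) + (of_real (sqrt (v * P)) * z + 1 * w)) \<partial>?G \<partial>?G)"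
    by (intro nn_integral_cong arg_cong[where f=f]) (simp add: real_sqrt_mult algebra_simps)
  also have "\<dots> = (\<integral>\<^sup>+z. \<integral>\<^sup>+w. f (of_real (\<mu> * sqrt P) + of_real (sqrt (v * P + 1)) * z) \<partial>?G \<partial>?G)"
    using std_gaussian_rotation2[of "\<lambda>a r. f (of_real (\<mu> * sqrt P) + a)" "of_real (sqrt (v * P))" 1] v P
    by simp
  also have "\<dots> = (\<integral>\<^sup>+z. f (of_real (\<mu> * sqrt P) + of_real (sqrt (v * P + 1)) * z) \<partial>?G)"
    using prob_space.emeasure_space_1[OF prob_space_std_gaussian] by simp
  finally show ?thesis .
qed

lemma W_tilde_altdef:
  "W_tilde \<kappa> n \<rho> w i = (if i = 0 then of_real (rician_mean \<kappa> * sqrt (real n * \<rho>))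
     + of_real (sqrt (rician_var \<kappa> * (real n * \<rho>) + 1)) * w i else w i)"
  by (simp add: W_tilde_def mult.assoc)

text \<open>For the input \<open>sqrt P * e0\<close>, coordinate 0 of the output has mean
  \<open>mu * sqrt P\<close> and variance \<open>v * P + 1\<close>. Its share of Q collapses to the
  squared normalised deviation, which is |W_0|^2 when Y is written through a standard W_0.\<close>

lemma rotated_metric_identity:
  fixes Y :: complex
  assumes "0 < v" "0 \<le> P"
  shows "(cmod Y)\<^sup>2 + \<mu>\<^sup>2 / v - (cmod (of_real (\<mu> / v) + of_real (sqrt P) * cnj Y))\<^sup>2 / (1 / v + P)
    = (cmod (Y - of_real (\<mu> * sqrt P)))\<^sup>2 / (v * P + 1)"
proof -
  have sP: "sqrt P * sqrt P = P" using assms by simp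
  have B: "1 / v + P = (v * P + 1) / v" using assms by (simp add: field_simps)
  have B0: "0 < v * P + 1" using assms by (simp add: add_nonneg_pos)
  have "(cmod (of_real (\<mu> / v) + of_real (sqrt P) * cnj Y))\<^sup>2 = \<mu>\<^sup>2 / v\<^sup>2 + P * (cmod Y)\<^sup>2 + 2 * (\<mu> / v) * sqrt P * Re Y"
    using cmod_diff_power2[of "of_real (\<mu> / v)" "- of_real (sqrt P) * cnj Y"] assms
    by (simp add: norm_mult power_mult_distrib norm_divide power_divide mult_ac)
  moreover have "(cmod (Y - of_real (\<mu> * sqrt P)))\<^sup>2 = (cmod Y)\<^sup>2 + \<mu>\<^sup>2 * P - 2 * (\<mu> * sqrt P) * Re Y"
    using assms by (simp add: cmod_diff_power2 power_mult_distrib norm_mult)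
  moreover have "a + m / v - (m / v\<^sup>2 + P * a + 2 * c / v) / ((v * P + 1) / v) = (a + m * P - 2 * c) / (v * P + 1)" for a m c
  proof -
    define d where "d = v * P + 1"
    have d: "0 < d" using B0 by (simp add: d_def)
    have "(m / v\<^sup>2 + P * a + 2 * c / v) / (d / v) = ((m / v\<^sup>2 + P * a + 2 * c / v) * v) / d"
      using assms d by simp
    also have "(m / v\<^sup>2 + P * a + 2 * c / v) * v = m / v + P * a * v + 2 * c"
      using assms by (simp add: distrib_right power2_eq_square)
    finally have e: "(m / v\<^sup>2 + P * a + 2 * c / v) / (d / v) = (m / v + P * a * v + 2 * c) / d" .
    have "m / v * d = m * P + m / v" using assms by (simp add: d_def distrib_left)
    then have "(a + m / v) * d = a * d + (m * P + m / v)" by (simp add: distrib_right)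
    then have "a + m / v = (a * d + (m * P + m / v)) / d" using d by (metis nonzero_mult_div_cancel_right less_irrefl)
    then have "a + m / v - (m / v\<^sup>2 + P * a + 2 * c / v) / (d / v) = ((a * d + (m * P + m / v)) - (m / v + P * a * v + 2 * c)) / d"
      by (simp only: e diff_divide_distrib)
    also have "(a * d + (m * P + m / v)) - (m / v + P * a * v + 2 * c) = a + m * P - 2 * c"
      by (simp add: d_def algebra_simps)
    finally show ?thesis unfolding d_def .
  qed
  from this[of "(cmod Y)\<^sup>2" "\<mu>\<^sup>2" "\<mu> * sqrt P * Re Y"] have
   "(cmod Y)\<^sup>2 + \<mu>\<^sup>2 / v - (\<mu>\<^sup>2 / v\<^sup>2 + P * (cmod Y)\<^sup>2 + 2 * (\<mu> / v) * sqrt P * Re Y) / (1 / v + P)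
     = ((cmod Y)\<^sup>2 + \<mu>\<^sup>2 * P - 2 * (\<mu> * sqrt P) * Re Y) / (v * P + 1)"
    unfolding B by (simp add: mult_ac)
  ultimately show ?thesis by simp
qed

text \<open>For fixed h, metric and output norm depend on the noise only through its inner product
  with x and its norm. The rotation lemma therefore moves x to \<open>sqrt P * e0\<close>, after
  which fading affects coordinate 0 alone and merges with the noise there.\<close>

lemma nn_integral_block_law:
  fixes \<Phi> :: "real \<Rightarrow> real \<Rightarrow> ennreal"
  assumes v: "0 < v" and P: "0 \<le> P" and n: "1 \<le> n" and x: "(vnorm n x)\<^sup>2 = P"
    and \<Phi>: "(\<lambda>(q, t). \<Phi> q t) \<in> borel_measurable (borel \<Otimes>\<^sub>M borel)"
  shows "(\<integral>\<^sup>+h. \<integral>\<^sup>+w. \<Phi> (block_metric \<mu> v P n x (\<lambda>i. h * x i + w i)) (vnorm n (\<lambda>i. h * x i + w i))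
      \<partial>std_gaussian_vec {..<n} \<partial>complex_gaussian (of_real \<mu>) v)
    = (\<integral>\<^sup>+w. \<Phi> ((vnorm n w)\<^sup>2) (vnorm n (\<lambda>i. if i = 0 then of_real (\<mu> * sqrt P) + of_real (sqrt (v * P + 1)) * w i else w i))
      \<partial>std_gaussian_vec {..<n})"
proof -
  note [measurable] = \<Phi>
  let ?G = "std_gaussian" and ?CN = "complex_gaussian (of_real \<mu>) v"
  define J where "J = {..<n} - {0}"
  have J: "finite J" "0 \<notin> J" and nJ: "{..<n} = insert 0 J" using n by (auto simp: J_def)
  let ?R = "\<lambda>w::nat \<Rightarrow> complex. \<Sum>i\<in>J. (cmod (w i))\<^sup>2" and ?\<gamma> = "std_gaussian_vec {..<n}"
  let ?L = "\<lambda>w. \<Sum>i<n. cnj (x i) * w i" and ?S = "\<lambda>w::nat \<Rightarrow> complex. \<Sum>i<n. (cmod (w i))\<^sup>2"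
  let ?Y = "\<lambda>z. of_real (\<mu> * sqrt P) + of_real (sqrt (v * P + 1)) * z"
  have CN: "prob_space ?CN" using v by (rule prob_space_complex_gaussian)
  interpret CN: prob_space ?CN by (rule CN)
  \<comment> \<open>The functional after the rotation: Y is coordinate 0 of the output, R the
    squared norm of the other coordinates.\<close>
  define \<Psi> where "\<Psi> Y R = \<Phi> ((cmod Y)\<^sup>2 + R + \<mu>\<^sup>2 / v - (cmod (of_real (\<mu> / v) + of_real (sqrt P) * cnj Y))\<^sup>2 / (1 / v + P)) (sqrt ((cmod Y)\<^sup>2 + R))"
    for Y :: complex and R :: real
  have [measurable]: "(\<lambda>(Y, R). \<Psi> Y R) \<in> borel_measurable (borel \<Otimes>\<^sub>M borel)"
    unfolding \<Psi>_def by measurable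
  \<comment> \<open>The functional before the rotation, at fixed h: a is the inner product of the
    noise with the input, r the squared norm of the noise.\<close>
  define F where "F h a r = \<Phi> (((cmod h)\<^sup>2 * P + r + 2 * Re (cnj h * a)) + \<mu>\<^sup>2 / v - (cmod (of_real (\<mu> / v) + (of_real P * cnj h + cnj a)))\<^sup>2 / (1 / v + P))
      (sqrt ((cmod h)\<^sup>2 * P + r + 2 * Re (cnj h * a)))" for h a :: complex and r :: real
  have [measurable]: "(\<lambda>(a, r). F h a r) \<in> borel_measurable (borel \<Otimes>\<^sub>M borel)" for h
    unfolding F_def by measurable
  have step1: "\<Phi> (block_metric \<mu> v P n x (\<lambda>i. h * x i + w i)) (vnorm n (\<lambda>i. h * x i + w i))
      = F h (?L w) (?S w)" for h w
  proof -
    have xx: "(\<Sum>i<n. x i * cnj (x i)) = of_real P"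
      by (simp only: x[symmetric] vnorm_power2 of_real_sum complex_norm_square)
    have y2: "(vnorm n (\<lambda>i. h * x i + w i))\<^sup>2 = (cmod h)\<^sup>2 * P + (?S w) + 2 * Re (cnj h * (?L w))"
    proof -
      have "(cmod (h * x i + w i))\<^sup>2 = (cmod h)\<^sup>2 * (cmod (x i))\<^sup>2 + (cmod (w i))\<^sup>2 + 2 * Re (cnj h * (cnj (x i) * w i))" for i
        using cmod_diff_power2[of "w i" "- (h * x i)"]
        by (simp add: norm_mult power_mult_distrib add_ac mult_ac)
      then show ?thesis
        by (simp only: vnorm_power2 x[symmetric] sum.distrib sum_distrib_left Re_sum)
    qed
    have v1: "vnorm n (\<lambda>i. h * x i + w i) = sqrt ((cmod h)\<^sup>2 * P + (?S w) + 2 * Re (cnj h * (?L w)))"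
      unfolding y2[symmetric] by simp
    have nonneg: "0 \<le> (cmod h)\<^sup>2 * P + (?S w) + 2 * Re (cnj h * (?L w))"
      unfolding y2[symmetric] by simp
    have xy: "(\<Sum>i<n. x i * cnj (h * x i + w i)) = of_real P * cnj h + cnj (?L w)"
    proof -
      have "x i * cnj (h * x i + w i) = x i * cnj (x i) * cnj h + cnj (cnj (x i) * w i)" for i
        by (simp add: algebra_simps)
      then show ?thesis unfolding xx[symmetric] by (simp only: sum.distrib sum_distrib_right cnj_sum)
    qed
    show ?thesis unfolding block_metric_def F_def v1 xy real_sqrt_pow2_iff[THEN iffD2, OF nonneg] ..
  qed
  have step2: "F h (of_real (sqrt P) * z) ((cmod z)\<^sup>2 + R) = \<Psi> (of_real (sqrt P) * h + z) R" for h z R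
  proof -
    have sP: "of_real P = (of_real (sqrt P) * of_real (sqrt P) :: complex)"
      using P by (simp flip: of_real_mult)
    have 1: "(cmod h)\<^sup>2 * P + ((cmod z)\<^sup>2 + R) + 2 * Re (cnj h * (of_real (sqrt P) * z)) = (cmod (of_real (sqrt P) * h + z))\<^sup>2 + R"
      using cmod_diff_power2[of z "- (of_real (sqrt P) * h)"] P
      by (simp add: norm_mult power_mult_distrib algebra_simps)
    have 2: "of_real P * cnj h + cnj (of_real (sqrt P) * z) = of_real (sqrt P) * cnj (of_real (sqrt P) * h + z)"
      unfolding sP by (simp add: algebra_simps)
    show ?thesis unfolding F_def \<Psi>_def 1 2 ..
  qed
  have [simp]: "(\<Sum>i\<in>J. (cmod (if i = 0 then y else w i))\<^sup>2) = (?R w)" for w y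
    using J by (auto intro!: sum.cong)
  have split: "(\<integral>\<^sup>+w. f (w 0) (?R w) \<partial>?\<gamma>) =
    (\<integral>\<^sup>+w. \<integral>\<^sup>+z. f z (?R w) \<partial>?G \<partial>std_gaussian_vec J)"
    if [measurable]: "(\<lambda>(z, r). f z r) \<in> borel_measurable (borel \<Otimes>\<^sub>M borel)" for f :: "complex \<Rightarrow> real \<Rightarrow> ennreal"
    unfolding nJ using J by (subst std.product_nn_integral_insert) auto
  have sumJ: "(?S w) = (cmod (w 0))\<^sup>2 + (?R w)" for w :: "nat \<Rightarrow> complex"
    unfolding nJ using J by simp
  have "(\<integral>\<^sup>+h. \<integral>\<^sup>+w. \<Phi> (block_metric \<mu> v P n x (\<lambda>i. h * x i + w i)) (vnorm n (\<lambda>i. h * x i + w i))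
      \<partial>?\<gamma> \<partial>?CN)
    = (\<integral>\<^sup>+h. \<integral>\<^sup>+w. F h (?L w) (?S w) \<partial>?\<gamma> \<partial>?CN)"
    by (simp only: step1)
  also have "\<dots> = (\<integral>\<^sup>+h. \<integral>\<^sup>+w. F h (of_real (sqrt P) * w 0) (?S w) \<partial>?\<gamma> \<partial>?CN)"
  proof (rule nn_integral_cong)
    fix h
    have "sqrt (\<Sum>i<n. (cmod (cnj (x i)))\<^sup>2) = sqrt P" by (simp add: x[symmetric] vnorm_power2)
    then show "(\<integral>\<^sup>+w. F h (?L w) (?S w) \<partial>?\<gamma>) =
      (\<integral>\<^sup>+w. F h (of_real (sqrt P) * w 0) (?S w) \<partial>?\<gamma>)"
      using std_vec_rotation[of "{..<n}" 0 "F h" "\<lambda>i. cnj (x i)"] n by simp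
  qed
  also have "\<dots> = (\<integral>\<^sup>+h. \<integral>\<^sup>+w. \<Psi> (of_real (sqrt P) * h + w 0) (?R w) \<partial>?\<gamma> \<partial>?CN)"
    by (simp only: sumJ step2)
  also have "\<dots> = (\<integral>\<^sup>+h. \<integral>\<^sup>+w. \<integral>\<^sup>+z. \<Psi> (of_real (sqrt P) * h + z) (?R w) \<partial>?G \<partial>std_gaussian_vec J \<partial>?CN)"
  proof (rule nn_integral_cong)
    fix h
    show "(\<integral>\<^sup>+w. \<Psi> (of_real (sqrt P) * h + w 0) (?R w) \<partial>?\<gamma>)
      = (\<integral>\<^sup>+w. \<integral>\<^sup>+z. \<Psi> (of_real (sqrt P) * h + z) (?R w) \<partial>?G \<partial>std_gaussian_vec J)"
      by (rule split[of "\<lambda>z R. \<Psi> (of_real (sqrt P) * h + z) R"]) measurable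
  qed
  also have "\<dots> = (\<integral>\<^sup>+w. \<integral>\<^sup>+h. \<integral>\<^sup>+z. \<Psi> (of_real (sqrt P) * h + z) (?R w) \<partial>?G \<partial>?CN \<partial>std_gaussian_vec J)"
  proof (rule nn_integral_swap)
    show "(\<lambda>(h, w). \<integral>\<^sup>+z. \<Psi> (of_real (sqrt P) * h + z) (?R w) \<partial>?G) \<in> borel_measurable (?CN \<Otimes>\<^sub>M std_gaussian_vec J)"
      by measurable
  qed (auto simp: CN prob_space_std_vec)
  also have "\<dots> = (\<integral>\<^sup>+w. \<integral>\<^sup>+z. \<Psi> (?Y z) (?R w) \<partial>?G \<partial>std_gaussian_vec J)"
  proof (rule nn_integral_cong)
    fix w :: "nat \<Rightarrow> complex"
    show "(\<integral>\<^sup>+h. \<integral>\<^sup>+z. \<Psi> (of_real (sqrt P) * h + z) (?R w) \<partial>?G \<partial>?CN) =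
      (\<integral>\<^sup>+z. \<Psi> (?Y z) (?R w) \<partial>?G)"
      by (rule nn_integral_faded_gaussian[OF v P, of "\<lambda>Y. \<Psi> Y (?R w)"]) measurable
  qed
  also have "\<dots> = (\<integral>\<^sup>+w. \<Psi> (?Y (w 0)) (?R w) \<partial>?\<gamma>)"
    by (rule split[of "\<lambda>z R. \<Psi> (?Y z) R", symmetric]) measurable
  also have "\<dots> = (\<integral>\<^sup>+w. \<Phi> ((vnorm n w)\<^sup>2) (vnorm n (\<lambda>i. if i = 0 then ?Y (w i) else w i))
      \<partial>?\<gamma>)"
  proof (rule nn_integral_cong)
    fix w :: "nat \<Rightarrow> complex"
    have vP: "0 < v * P + 1" using v P by (simp add: add_nonneg_pos)
    have "(vnorm n (\<lambda>i. if i = 0 then ?Y (w i) else w i))\<^sup>2 = (cmod (?Y (w 0)))\<^sup>2 + ?R w"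
      unfolding vnorm_power2 sumJ using J by (auto intro!: sum.cong)
    then have 1: "vnorm n (\<lambda>i. if i = 0 then ?Y (w i) else w i) = sqrt ((cmod (?Y (w 0)))\<^sup>2 + ?R w)"
      by (intro real_sqrt_unique[symmetric]) auto
    have "(cmod ((?Y (w 0)) - of_real (\<mu> * sqrt P)))\<^sup>2 / (v * P + 1) = (cmod (w 0))\<^sup>2"
      using vP by (simp add: norm_mult power_mult_distrib)
    then have 2: "(cmod (?Y (w 0)))\<^sup>2 + ?R w + \<mu>\<^sup>2 / v - (cmod (of_real (\<mu> / v) + of_real (sqrt P) * cnj (?Y (w 0))))\<^sup>2 / (1 / v + P) = (vnorm n w)\<^sup>2"
      using rotated_metric_identity[OF v P, of "?Y (w 0)" \<mu>] unfolding vnorm_power2 sumJ by linarith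
    show "\<Psi> (?Y (w 0)) (?R w) = \<Phi> ((vnorm n w)\<^sup>2) (vnorm n (\<lambda>i. if i = 0 then ?Y (w i) else w i))"
      unfolding \<Psi>_def 1 2 ..
  qed
  finally show ?thesis .
qed

text \<open>Coordinate 1 of \<open>W_tilde\<close> is pure noise and hence almost surely nonzero.
  For n = 1 there is no such coordinate, but the exponent n - 1 = 0 makes the division
  harmless.\<close>

lemma AE_vnorm_W_tilde_nonzero:
  assumes "1 \<le> n"
  shows "AE w in std_gaussian_vec {..<n}. vnorm n (W_tilde \<kappa> n \<rho> w) \<noteq> 0 \<or> n = 1"
proof (cases "n = 1")
  case False
  then have n: "1 \<in> {..<n}" using assms by auto
  have "AE w in std_gaussian_vec {..<n}. w 1 \<noteq> 0"
    using n by (intro AE_PiM_component prob_space_std_gaussian AE_std_gaussian_nonzero) auto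
  then show ?thesis
  proof eventually_elim
    case (elim w)
    then have "0 < (cmod (W_tilde \<kappa> n \<rho> w 1))\<^sup>2" by (simp add: W_tilde_def)
    also have "\<dots> \<le> (vnorm n (W_tilde \<kappa> n \<rho> w))\<^sup>2" unfolding vnorm_power2 using n by (intro member_le_sum) auto
    finally show ?case by auto
  qed
qed simp

abbreviation "rician_metric \<kappa> \<rho> n \<equiv> block_metric (rician_mean \<kappa>) (rician_var \<kappa>) (real n * \<rho>) n"

abbreviation "rician_info \<kappa> \<rho> n s \<equiv> info_density (rician_mean \<kappa>) (rician_var \<kappa>) (real n * \<rho>) n s"

lemma nn_integral_info_density_block:
  fixes \<phi> :: "real \<Rightarrow> ennreal"
  assumes \<kappa>: "0 \<le> \<kappa>" and \<rho>: "0 < \<rho>" and n: "1 \<le> n" and s: "0 < s" and x: "(vnorm n x)\<^sup>2 = real n * \<rho>"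
    and [measurable]: "\<phi> \<in> borel_measurable borel"
  shows "(\<integral>\<^sup>+h. \<integral>\<^sup>+w. \<phi> (rician_info \<kappa> \<rho> n s
        (rician_metric \<kappa> \<rho> n x (\<lambda>i. h * x i + w i)) (vnorm n (\<lambda>i. h * x i + w i)))
      \<partial>std_gaussian_vec {..<n} \<partial>complex_gaussian (of_real (rician_mean \<kappa>)) (rician_var \<kappa>))
    = (\<integral>\<^sup>+w. \<phi> (S_term \<kappa> n \<rho> s w) \<partial>std_gaussian_vec {..<n})"
proof -
  have P: "0 \<le> real n * \<rho>" using \<rho> by simp
  have "(\<integral>\<^sup>+h. \<integral>\<^sup>+w. \<phi> (rician_info \<kappa> \<rho> n s
        (rician_metric \<kappa> \<rho> n x (\<lambda>i. h * x i + w i)) (vnorm n (\<lambda>i. h * x i + w i)))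
      \<partial>std_gaussian_vec {..<n} \<partial>complex_gaussian (of_real (rician_mean \<kappa>)) (rician_var \<kappa>))
    = (\<integral>\<^sup>+w. \<phi> (rician_info \<kappa> \<rho> n s ((vnorm n w)\<^sup>2) (vnorm n (W_tilde \<kappa> n \<rho> w))) \<partial>std_gaussian_vec {..<n})"
    unfolding W_tilde_altdef[abs_def] using \<kappa> P n x
    by (intro nn_integral_block_law rician_pos) measurable
  also have "\<dots> = (\<integral>\<^sup>+w. \<phi> (S_term \<kappa> n \<rho> s w) \<partial>std_gaussian_vec {..<n})"
  proof (rule nn_integral_cong_AE)
    show "AE w in std_gaussian_vec {..<n}. \<phi> (rician_info \<kappa> \<rho> n s ((vnorm n w)\<^sup>2) (vnorm n (W_tilde \<kappa> n \<rho> w))) = \<phi> (S_term \<kappa> n \<rho> s w)"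
      using AE_vnorm_W_tilde_nonzero[OF n, of \<kappa> \<rho>]
      by eventually_elim (simp only: S_term_eq_info_density[OF \<kappa> \<rho> n s])
  qed
  finally show ?thesis .
qed

subsection \<open>The information density of several blocks\<close>

text \<open>Equality in law, expressed through all test functions, passes from blocks to sums of
  independent blocks: the rest of the sum acts as an offset inside the test function. The effort
  goes into reordering, since all fading variables are integrated outside all noise variables and
  the two of block j have to be brought together.\<close>

lemma nn_integral_sum_blocks:
  fixes u :: "'k \<Rightarrow> 'a \<Rightarrow> 'b \<Rightarrow> real" and v :: "'k \<Rightarrow> 'b \<Rightarrow> real" and \<phi> :: "real \<Rightarrow> ennreal"
  assumes A: "prob_space A" and B: "prob_space B" and J: "finite J"
    and u: "\<And>k. (\<lambda>(a, b). u k a b) \<in> borel_measurable (A \<Otimes>\<^sub>M B)"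
    and v: "\<And>k. v k \<in> borel_measurable B"
    and eq: "\<And>k \<phi>. k \<in> J \<Longrightarrow> \<phi> \<in> borel_measurable borel \<Longrightarrow>
      (\<integral>\<^sup>+a. \<integral>\<^sup>+b. \<phi> (u k a b) \<partial>B \<partial>A) = (\<integral>\<^sup>+b. (\<phi> (v k b) :: ennreal) \<partial>B)"
    and \<phi>: "\<phi> \<in> borel_measurable borel"
  shows "(\<integral>\<^sup>+a. \<integral>\<^sup>+b. \<phi> (\<Sum>k\<in>J. u k (a k) (b k)) \<partial>Pi\<^sub>M J (\<lambda>_. B) \<partial>Pi\<^sub>M J (\<lambda>_. A))
    = (\<integral>\<^sup>+b. \<phi> (\<Sum>k\<in>J. v k (b k)) \<partial>Pi\<^sub>M J (\<lambda>_. B))"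
  using J eq \<phi>
proof (induction J arbitrary: \<phi>)
  case empty
  have "prob_space (Pi\<^sub>M ({} :: 'k set) (\<lambda>_. A))" by (rule prob_space_PiM) (rule A)
  from prob_space.emeasure_space_1[OF this] show ?case by simp
next
  case (insert j J)
  note [measurable] = u v insert.prems(2)
  interpret A: prob_space A by fact
  interpret B: prob_space B by fact
  interpret As: product_sigma_finite "\<lambda>_. A" by (simp add: product_sigma_finite_def A.sigma_finite_measure_axioms)
  interpret Bs: product_sigma_finite "\<lambda>_. B" by (simp add: product_sigma_finite_def B.sigma_finite_measure_axioms)
  interpret PA: prob_space "Pi\<^sub>M J (\<lambda>_. A)" by (rule prob_space_PiM) (rule A)
  interpret PB: prob_space "Pi\<^sub>M J (\<lambda>_. B)" by (rule prob_space_PiM) (rule B)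
  let ?A = "Pi\<^sub>M J (\<lambda>_. A)" and ?B = "Pi\<^sub>M J (\<lambda>_. B)"
  let ?Bj = "Pi\<^sub>M (insert j J) (\<lambda>_. B)" and ?U = "\<lambda>a b. \<Sum>k\<in>J. u k (a k) (b k)"
  have PIB: "prob_space (?Bj)" by (rule prob_space_PiM) (rule B)
  interpret PIB: prob_space "?Bj" by (rule PIB)
  have fin: "finite J" "j \<notin> J" by fact+
  have section_measurable: "(\<lambda>b. u k (a k) b) \<in> borel_measurable B" if "k \<in> J" "a \<in> space ?A" for a k
  proof -
    have "a k \<in> space A" using that by (auto simp: space_PiM PiE_iff)
    from measurable_Pair2[OF u this] show ?thesis by simp
  qed
  have uJ [simp]: "(\<Sum>k\<in>J. u k (if k = j then a' else a k) (if k = j then b' else b k)) = ?U a b"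
    "(\<Sum>k\<in>J. u k (if k = j then a' else a k) (b k)) = ?U a b"
    "(\<Sum>k\<in>J. u k (a k) (if k = j then b' else b k)) = ?U a b"
    "(\<Sum>k\<in>J. v k (if k = j then b' else b k)) = (\<Sum>k\<in>J. v k (b k))" for a a' b b'
    using fin by (auto intro!: sum.cong)
  have "(\<integral>\<^sup>+a. \<integral>\<^sup>+b. \<phi> (\<Sum>k\<in>insert j J. u k (a k) (b k)) \<partial>?Bj \<partial>Pi\<^sub>M (insert j J) (\<lambda>_. A))
    = (\<integral>\<^sup>+a. \<integral>\<^sup>+a'. \<integral>\<^sup>+b. \<phi> (u j a' (b j) + ?U a b) \<partial>?Bj \<partial>A \<partial>?A)"
    using fin by (subst As.product_nn_integral_insert) auto
  also have "\<dots> = (\<integral>\<^sup>+a. \<integral>\<^sup>+a'. \<integral>\<^sup>+b. \<integral>\<^sup>+b'. \<phi> (u j a' b' + ?U a b) \<partial>B \<partial>?B \<partial>A \<partial>?A)"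
  proof (intro nn_integral_cong)
    fix a a' assume [measurable]: "a \<in> space ?A" "a' \<in> space A"
    have [measurable]: "(\<lambda>b. u k (a k) b) \<in> borel_measurable B" if "k \<in> J" for k
      using that \<open>a \<in> space ?A\<close> by (rule section_measurable)
    have "(\<lambda>b. u j a' b) \<in> borel_measurable B"
      using measurable_Pair2[OF u \<open>a' \<in> space A\<close>] by auto
    note [measurable] = this
    have [measurable]: "(\<lambda>b. \<phi> (u j a' (b j) + ?U a b)) \<in> borel_measurable (?Bj)"
      by measurable
    show "(\<integral>\<^sup>+b. \<phi> (u j a' (b j) + ?U a b) \<partial>?Bj)
       = (\<integral>\<^sup>+b. \<integral>\<^sup>+b'. \<phi> (u j a' b' + ?U a b) \<partial>B \<partial>?B)"
      using fin by (subst Bs.product_nn_integral_insert) auto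
  qed
  also have "\<dots> = (\<integral>\<^sup>+a. \<integral>\<^sup>+b. \<integral>\<^sup>+a'. \<integral>\<^sup>+b'. \<phi> (u j a' b' + ?U a b) \<partial>B \<partial>A \<partial>?B \<partial>?A)"
  proof (intro nn_integral_cong)
    fix a assume "a \<in> space ?A"
    have [measurable]: "(\<lambda>b. u k (a k) b) \<in> borel_measurable B" if "k \<in> J" for k
      using that \<open>a \<in> space ?A\<close> by (rule section_measurable)
    show "(\<integral>\<^sup>+a'. \<integral>\<^sup>+b. \<integral>\<^sup>+b'. \<phi> (u j a' b' + ?U a b) \<partial>B \<partial>?B \<partial>A) =
      (\<integral>\<^sup>+b. \<integral>\<^sup>+a'. \<integral>\<^sup>+b'. \<phi> (u j a' b' + ?U a b) \<partial>B \<partial>A \<partial>?B)"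
      by (rule nn_integral_swap) (simp_all only: A PB.prob_space_axioms simp_thms, measurable)
  qed
  also have "\<dots> = (\<integral>\<^sup>+a. \<integral>\<^sup>+b. \<integral>\<^sup>+b'. \<phi> (v j b' + ?U a b) \<partial>B \<partial>?B \<partial>?A)"
    by (intro nn_integral_cong insert.prems(1)[of j "\<lambda>r. \<phi> (r + _)"]) auto
  also have "\<dots> = (\<integral>\<^sup>+a. \<integral>\<^sup>+b'. \<integral>\<^sup>+b. \<phi> (v j b' + ?U a b) \<partial>?B \<partial>B \<partial>?A)"
  proof (intro nn_integral_cong)
    fix a assume "a \<in> space ?A"
    have [measurable]: "(\<lambda>b. u k (a k) b) \<in> borel_measurable B" if "k \<in> J" for k
      using that \<open>a \<in> space ?A\<close> by (rule section_measurable)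
    show "(\<integral>\<^sup>+b. \<integral>\<^sup>+b'. \<phi> (v j b' + ?U a b) \<partial>B \<partial>?B) =
      (\<integral>\<^sup>+b'. \<integral>\<^sup>+b. \<phi> (v j b' + ?U a b) \<partial>?B \<partial>B)"
      by (rule nn_integral_swap) (simp_all only: B PB.prob_space_axioms simp_thms, measurable)
  qed
  also have "\<dots> = (\<integral>\<^sup>+b'. \<integral>\<^sup>+a. \<integral>\<^sup>+b. \<phi> (v j b' + ?U a b) \<partial>?B \<partial>?A \<partial>B)"
    by (rule nn_integral_swap) (simp_all only: B PA.prob_space_axioms simp_thms, measurable)
  also have "\<dots> = (\<integral>\<^sup>+b'. \<integral>\<^sup>+b. \<phi> (v j b' + (\<Sum>k\<in>J. v k (b k))) \<partial>?B \<partial>B)"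
  proof (rule nn_integral_cong)
    fix b'
    show "(\<integral>\<^sup>+a. \<integral>\<^sup>+b. \<phi> (v j b' + ?U a b) \<partial>?B \<partial>?A) = (\<integral>\<^sup>+b. \<phi> (v j b' + (\<Sum>k\<in>J. v k (b k))) \<partial>?B)"
      by (rule insert.IH[of "\<lambda>r. \<phi> (v j b' + r)"]) (use insert.prems in auto)
  qed
  also have "\<dots> = (\<integral>\<^sup>+b. \<phi> (\<Sum>k\<in>insert j J. v k (b k)) \<partial>?Bj)"
    using fin by (subst Bs.product_nn_integral_insert_rev) auto
  finally show ?case .
qed

section \<open>Metric and information density of a whole codeword\<close>

lemma noise_law_eq: "noise_law l n = Pi\<^sub>M {..<l} (\<lambda>_. std_gaussian_vec {..<n})"
  by (simp add: noise_law_def)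

lemma prob_space_noise_law: "prob_space (noise_law l n)"
  unfolding noise_law_eq by (rule prob_space_PiM) (rule prob_space_std_vec)

lemma prob_space_fading_law: "0 \<le> \<kappa> \<Longrightarrow> prob_space (fading_law \<kappa> l)"
  unfolding fading_law_def by (rule prob_space_PiM) (intro prob_space_complex_gaussian rician_pos)

lemma borel_measurable_S_term: "S_term \<kappa> n \<rho> s \<in> borel_measurable (std_gaussian_vec {..<n})"
proof -
  have W: "(\<lambda>w. W_tilde \<kappa> n \<rho> w i) \<in> borel_measurable (std_gaussian_vec {..<n})" if "i \<in> {..<n}" for i
  proof (cases "i = 0")
    case True
    with that have "0 \<in> {..<n}" by simp
    then show ?thesis unfolding W_tilde_def True if_True by measurable
  next
    case False
    then show ?thesis using that unfolding W_tilde_def by (simp only: if_False) measurable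
  qed
  have t: "(\<lambda>w. vnorm n (W_tilde \<kappa> n \<rho> w)) \<in> borel_measurable (std_gaussian_vec {..<n})"
    unfolding vnorm_def L2_set_def
    by (intro measurable_compose[OF _ borel_measurable_sqrt] borel_measurable_sum borel_measurable_power measurable_compose[OF W borel_measurable_norm])
  have w: "(\<lambda>w. vnorm n w) \<in> borel_measurable (std_gaussian_vec {..<n})"
    unfolding vnorm_def L2_set_def by measurable
  have F: "(\<lambda>(a, t). (real n - 2) * ln s - ln ((1 + rician_var \<kappa> * real n * \<rho>) / rician_var \<kappa>)
       - ln (Gamma (real n)) - s * (a\<^sup>2 - t\<^sup>2) + s * \<bar>rician_mean \<kappa>\<bar>\<^sup>2 / rician_var \<kappa>
       - ln (LINT z:{0<..}|lborel.
               exp (- s * (\<rho> * real n + 1 / rician_var \<kappa>) * z) / (t * sqrt (\<rho> * real n * z)) ^ (n - 1)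
               * bessel_I (n - 1) (2 * s * t * sqrt (\<rho> * real n * z))
               * bessel_I 0 (2 * s * (1 / rician_var \<kappa>) * sqrt (z * \<bar>rician_mean \<kappa>\<bar>\<^sup>2)))) \<in> borel_measurable (borel \<Otimes>\<^sub>M borel)"
    unfolding set_lebesgue_integral_def by measurable
  show ?thesis
    using measurable_compose[OF measurable_Pair[OF w t] F] unfolding S_term_def Let_def split_conv .
qed

definition seq_metric :: "real \<Rightarrow> real \<Rightarrow> nat \<Rightarrow> nat \<Rightarrow> (nat \<Rightarrow> nat \<Rightarrow> complex) \<Rightarrow> (nat \<Rightarrow> nat \<Rightarrow> complex) \<Rightarrow> real" where
  "seq_metric \<kappa> \<rho> l n x y =
    (\<Sum>k<l. rician_metric \<kappa> \<rho> n (x k) (y k))"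

definition seq_info :: "real \<Rightarrow> real \<Rightarrow> nat \<Rightarrow> nat \<Rightarrow> real \<Rightarrow> (nat \<Rightarrow> nat \<Rightarrow> complex) \<Rightarrow> (nat \<Rightarrow> nat \<Rightarrow> complex) \<Rightarrow> real" where
  "seq_info \<kappa> \<rho> l n s x y =
    (\<Sum>k<l. rician_info \<kappa> \<rho> n s
       (rician_metric \<kappa> \<rho> n (x k) (y k)) (vnorm n (y k)))"

text \<open>g is a Gaussian sequence with the law of the noise, so \<open>noise_law\<close> doubles
  as the source of randomness for the codebook.\<close>

definition codeword :: "real \<Rightarrow> nat \<Rightarrow> (nat \<Rightarrow> nat \<Rightarrow> complex) \<Rightarrow> nat \<Rightarrow> nat \<Rightarrow> complex" where
  "codeword \<rho> n g k = sphere_point n (real n * \<rho>) (g k)"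

text \<open>The right side is free of x: every codeword obeying the power constraint sees the same
  law of the information density.\<close>

lemma nn_integral_seq_info:
  fixes \<phi> :: "real \<Rightarrow> ennreal"
  assumes \<kappa>: "0 \<le> \<kappa>" and \<rho>: "0 < \<rho>" and n: "1 \<le> n" and s: "0 < s"
    and x: "\<And>k. k < l \<Longrightarrow> (vnorm n (x k))\<^sup>2 = real n * \<rho>" and \<phi>: "\<phi> \<in> borel_measurable borel"
  shows "(\<integral>\<^sup>+H. \<integral>\<^sup>+W. \<phi> (seq_info \<kappa> \<rho> l n s x (\<lambda>k i. H k * x k i + W k i)) \<partial>noise_law l n \<partial>fading_law \<kappa> l)
    = (\<integral>\<^sup>+W. \<phi> (\<Sum>k<l. S_term \<kappa> n \<rho> s (W k)) \<partial>noise_law l n)"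
  unfolding seq_info_def noise_law_eq fading_law_def
proof (rule nn_integral_sum_blocks[where u="\<lambda>k h w. rician_info \<kappa> \<rho> n s
       (rician_metric \<kappa> \<rho> n (x k) (\<lambda>i. h * x k i + w i)) (vnorm n (\<lambda>i. h * x k i + w i))"
       and v="\<lambda>k. S_term \<kappa> n \<rho> s"])
  show "prob_space (complex_gaussian (complex_of_real (rician_mean \<kappa>)) (rician_var \<kappa>))"
    using \<kappa> by (intro prob_space_complex_gaussian rician_pos)
  show "(\<lambda>(h, w). rician_info \<kappa> \<rho> n s
       (rician_metric \<kappa> \<rho> n (x k) (\<lambda>i. h * x k i + w i)) (vnorm n (\<lambda>i. h * x k i + w i)))
     \<in> borel_measurable (complex_gaussian (complex_of_real (rician_mean \<kappa>)) (rician_var \<kappa>) \<Otimes>\<^sub>M std_gaussian_vec {..<n})" for k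
    unfolding info_density_def block_metric_def vnorm_def L2_set_def by measurable
  show "(\<integral>\<^sup>+h. \<integral>\<^sup>+w. \<phi> (rician_info \<kappa> \<rho> n s
       (rician_metric \<kappa> \<rho> n (x k) (\<lambda>i. h * x k i + w i)) (vnorm n (\<lambda>i. h * x k i + w i)))
      \<partial>std_gaussian_vec {..<n} \<partial>complex_gaussian (complex_of_real (rician_mean \<kappa>)) (rician_var \<kappa>)) =
      (\<integral>\<^sup>+w. \<phi> (S_term \<kappa> n \<rho> s w) \<partial>std_gaussian_vec {..<n})"
    if "k \<in> {..<l}" "\<phi> \<in> borel_measurable borel" for k and \<phi> :: "real \<Rightarrow> ennreal"
    using that x by (intro nn_integral_info_density_block[OF \<kappa> \<rho> n s]) auto
qed (auto simp: prob_space_std_vec borel_measurable_S_term \<phi>)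

subsection \<open>Random coding\<close>

interpretation std_blocks: product_sigma_finite "\<lambda>_. std_gaussian_vec {..<n}" for n :: nat
  by (simp add: product_sigma_finite_def prob_space_imp_sigma_finite[OF prob_space_std_vec])

interpretation noise: prob_space "noise_law l n" for l n
  by (rule prob_space_noise_law)

interpretation noises: product_sigma_finite "\<lambda>_. noise_law l n" for l n :: nat
  by (simp add: product_sigma_finite_def prob_space_imp_sigma_finite[OF prob_space_noise_law])

lemma prob_space_codebook: "prob_space (Pi\<^sub>M I (\<lambda>_. noise_law l n))"
  by (rule prob_space_PiM) (rule prob_space_noise_law)

interpretation codebook: prob_space "Pi\<^sub>M I (\<lambda>_. noise_law l n)" for I l n
  by (rule prob_space_codebook)

lemma measurable_noise_component:
  assumes f: "f \<in> M \<rightarrow>\<^sub>M noise_law l n" and "k < l" "i < n"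
  shows "(\<lambda>\<omega>. f \<omega> k i) \<in> borel_measurable M"
proof -
  have 1: "(\<lambda>w. w k) \<in> noise_law l n \<rightarrow>\<^sub>M std_gaussian_vec {..<n}"
    unfolding noise_law_eq using assms by (intro measurable_component_singleton) auto
  have 2: "(\<lambda>w. w i) \<in> std_gaussian_vec {..<n} \<rightarrow>\<^sub>M std_gaussian"
    using assms by (intro measurable_component_singleton) auto
  have "(\<lambda>w. w k i) \<in> noise_law l n \<rightarrow>\<^sub>M std_gaussian"
    using measurable_compose[OF 1 2] .
  from measurable_compose[OF f this] show ?thesis by (simp cong: measurable_cong_sets)
qed

lemma measurable_fading_component:
  assumes f: "f \<in> M \<rightarrow>\<^sub>M fading_law \<kappa> l" and "k < l"
  shows "(\<lambda>\<omega>. f \<omega> k) \<in> borel_measurable M"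
proof -
  have 1: "(\<lambda>w. w k) \<in> fading_law \<kappa> l \<rightarrow>\<^sub>M complex_gaussian (of_real (rician_mean \<kappa>)) (rician_var \<kappa>)"
    unfolding fading_law_def using assms by (intro measurable_component_singleton) auto
  from measurable_compose[OF f this] show ?thesis by (simp cong: measurable_cong_sets)
qed

lemma borel_measurable_codeword:
  assumes g: "g \<in> M \<rightarrow>\<^sub>M noise_law l n" and "k < l" "i < n"
  shows "(\<lambda>\<omega>. codeword \<rho> n (g \<omega>) k i) \<in> borel_measurable M"
proof -
  have 1: "(\<lambda>w. w k) \<in> noise_law l n \<rightarrow>\<^sub>M std_gaussian_vec {..<n}"
    unfolding noise_law_eq using assms by (intro measurable_component_singleton) auto
  show ?thesis unfolding codeword_def
    using measurable_compose[OF measurable_compose[OF g 1] measurable_sphere_point[OF \<open>i < n\<close>]] .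
qed

lemma borel_measurable_seq_metric:
  assumes X: "\<And>k i. k \<in> {..<l} \<Longrightarrow> i \<in> {..<n} \<Longrightarrow> (\<lambda>\<omega>. X \<omega> k i) \<in> borel_measurable M"
    and Y: "\<And>k i. k \<in> {..<l} \<Longrightarrow> i \<in> {..<n} \<Longrightarrow> (\<lambda>\<omega>. Y \<omega> k i) \<in> borel_measurable M"
  shows "(\<lambda>\<omega>. seq_metric \<kappa> \<rho> l n (X \<omega>) (Y \<omega>)) \<in> borel_measurable M"
proof -
  note [measurable] = X Y
  show ?thesis unfolding seq_metric_def block_metric_def vnorm_def L2_set_def by measurable
qed

lemma nn_integral_seq_metric:
  assumes \<kappa>: "0 \<le> \<kappa>" and \<rho>: "0 < \<rho>" and n: "1 \<le> n" and s: "0 < s"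
  shows "(\<integral>\<^sup>+g. ennreal (exp (- s * seq_metric \<kappa> \<rho> l n (codeword \<rho> n g) y)) \<partial>noise_law l n)
    = (\<Prod>k<l. metric_transform (rician_mean \<kappa>) (rician_var \<kappa>) (real n * \<rho>) n s (vnorm n (y k)))"
proof -
  let ?P = "real n * \<rho>"
  let ?f = "\<lambda>k w. ennreal (exp (- s * block_metric (rician_mean \<kappa>) (rician_var \<kappa>) ?P n (sphere_point n ?P w) (y k)))"
  have f: "?f k \<in> borel_measurable (std_gaussian_vec {..<n})" for k
  proof -
    have "(\<lambda>x. ennreal (exp (- s * x))) \<in> borel_measurable borel" by measurable
    from measurable_compose[OF borel_measurable_block_metric this] show ?thesis .
  qed
  have "ennreal (exp (- s * seq_metric \<kappa> \<rho> l n (codeword \<rho> n g) y)) = (\<Prod>k<l. ?f k (g k))" for g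
    by (simp only: seq_metric_def codeword_def sum_distrib_left exp_sum[OF finite_lessThan] prod_ennreal exp_ge_zero)
  then have "(\<integral>\<^sup>+g. ennreal (exp (- s * seq_metric \<kappa> \<rho> l n (codeword \<rho> n g) y)) \<partial>noise_law l n) =
    (\<Prod>k<l. \<integral>\<^sup>+w. ?f k w \<partial>std_gaussian_vec {..<n})"
    unfolding noise_law_eq
    by (simp only:) (rule std_blocks.product_nn_integral_prod[where f="?f", OF finite_lessThan f])
  also have "\<dots> = (\<Prod>k<l. metric_transform (rician_mean \<kappa>) (rician_var \<kappa>) ?P n s (vnorm n (y k)))"
    using \<kappa> \<rho> n s by (intro prod.cong refl nn_integral_metric_transform rician_pos) auto
  finally show ?thesis .
qed

text \<open>Markov's inequality with exponent \<open>s\<close> (Chernoff bound).\<close>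

lemma pairwise_error_bound:
  assumes \<kappa>: "0 \<le> \<kappa>" and \<rho>: "0 < \<rho>" and n: "1 \<le> n" and s: "0 < s"
  shows "(\<integral>\<^sup>+g. (if seq_metric \<kappa> \<rho> l n (codeword \<rho> n g) y \<le> seq_metric \<kappa> \<rho> l n x y then 1 else 0) \<partial>noise_law l n)
    \<le> ennreal (exp (- seq_info \<kappa> \<rho> l n s x y))"
proof -
  let ?q = "\<lambda>g. seq_metric \<kappa> \<rho> l n (codeword \<rho> n g) y" and ?c = "seq_metric \<kappa> \<rho> l n x y"
  let ?mt = "\<lambda>k. metric_transform (rician_mean \<kappa>) (rician_var \<kappa>) (real n * \<rho>) n s (vnorm n (y k))"
  have [measurable]: "?q \<in> borel_measurable (noise_law l n)"
    by (rule borel_measurable_seq_metric) (auto intro!: borel_measurable_codeword measurable_ident_sets)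
  have "(\<integral>\<^sup>+g. (if ?q g \<le> ?c then 1 else 0) \<partial>noise_law l n) \<le> (\<integral>\<^sup>+g. ennreal (exp (s * ?c)) * ennreal (exp (- s * ?q g)) \<partial>noise_law l n)"
  proof (rule nn_integral_mono)
    fix g
    show "(if ?q g \<le> ?c then 1 else 0) \<le> ennreal (exp (s * ?c)) * ennreal (exp (- s * ?q g))"
    proof (cases "?q g \<le> ?c")
      case True
      then have "0 \<le> s * ?c + - s * ?q g" using s by (simp add: mult_left_mono)
      then have "1 \<le> ennreal (exp (s * ?c + - s * ?q g))" by simp
      then show ?thesis using True by (simp only: exp_add ennreal_mult exp_ge_zero if_True)
    qed simp
  qed
  also have "\<dots> = ennreal (exp (s * ?c)) * (\<Prod>k<l. ?mt k)"
    unfolding nn_integral_seq_metric[OF assms, symmetric] by (rule nn_integral_cmult) measurable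
  also have "(\<Prod>k<l. ?mt k) = (\<Prod>k<l. ennreal (enn2real (?mt k)))"
    using \<kappa> \<rho> n s by (intro prod.cong refl enn2real_metric_transform(2)[symmetric] rician_pos) auto
  also have "\<dots> = ennreal (\<Prod>k<l. enn2real (?mt k))" by (rule prod_ennreal) auto
  also have "(\<Prod>k<l. enn2real (?mt k)) = (\<Prod>k<l. exp (ln (enn2real (?mt k))))"
    using \<kappa> \<rho> n s by (intro prod.cong refl exp_ln[symmetric] enn2real_metric_transform(1) rician_pos) auto
  also have "\<dots> = exp (\<Sum>k<l. ln (enn2real (?mt k)))" by (rule exp_sum[symmetric]) simp
  also have "ennreal (exp (s * ?c)) * ennreal (exp (\<Sum>k<l. ln (enn2real (?mt k)))) = ennreal (exp (- seq_info \<kappa> \<rho> l n s x y))"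
    by (subst ennreal_mult[symmetric])
      (auto simp: exp_add[symmetric] seq_info_def info_density_def seq_metric_def sum_subtractf sum_distrib_left sum_negf)
  finally show ?thesis .
qed

text \<open>For positive m, \<open>exp (- max 0 (r - ln m))\<close> is the minimum of 1 and
  \<open>m * exp (- r)\<close>.\<close>

lemma rcu_exponential:
  fixes r m :: real
  assumes "0 < m" "e \<le> 1" "e \<le> ennreal m * ennreal (exp (- r))"
  shows "e \<le> ennreal (exp (- max 0 (r - ln m)))"
proof -
  have "m * exp (- r) = exp (- (r - ln m))" using assms(1) by (simp add: exp_diff exp_minus field_simps)
  then have "e \<le> ennreal (exp (- (r - ln m)))" using assms by (simp add: ennreal_mult[symmetric])
  then show ?thesis using assms(2) by (simp add: max_def)
qed

text \<open>Union bound over the competitors, cut off at 1. The competitors are independent of the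
  transmitted codeword and of the output, so x and y are held fixed here.\<close>

lemma random_codebook_error_bound:
  assumes \<kappa>: "0 \<le> \<kappa>" and \<rho>: "0 < \<rho>" and n: "1 \<le> n" and s: "0 < s" and I: "finite I" "I \<noteq> {}"
  shows "(\<integral>\<^sup>+C. (if \<exists>i\<in>I. seq_metric \<kappa> \<rho> l n (codeword \<rho> n (C i)) y \<le> seq_metric \<kappa> \<rho> l n x y then 1 else 0)
      \<partial>Pi\<^sub>M I (\<lambda>_. noise_law l n))
    \<le> ennreal (exp (- max 0 (seq_info \<kappa> \<rho> l n s x y - ln (real (card I)))))" (is "?E \<le> _")
proof (rule rcu_exponential)
  let ?B = "Pi\<^sub>M I (\<lambda>_. noise_law l n)" and ?q = "\<lambda>g. seq_metric \<kappa> \<rho> l n (codeword \<rho> n g) y" and ?c = "seq_metric \<kappa> \<rho> l n x y"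
  let ?g = "\<lambda>g. (if ?q g \<le> ?c then 1 else 0) :: ennreal"
  show "0 < real (card I)" using I by (simp add: card_gt_0_iff)
  have "?E \<le> (\<integral>\<^sup>+C. 1 \<partial>?B)" by (intro nn_integral_mono) auto
  then show "?E \<le> 1" by (simp add: codebook.emeasure_space_1)
  have "(\<lambda>g. seq_metric \<kappa> \<rho> l n (codeword \<rho> n g) y) \<in> borel_measurable (noise_law l n)"
    by (rule borel_measurable_seq_metric) (auto intro!: borel_measurable_codeword measurable_ident_sets)
  then have g: "?g \<in> borel_measurable (noise_law l n)" by measurable
  have gi: "(\<lambda>C. ?g (C i)) \<in> borel_measurable (?B)" if "i \<in> I" for i
    using measurable_compose[OF measurable_component_singleton[OF that] g] .
  have "?E \<le> (\<integral>\<^sup>+C. (\<Sum>i\<in>I. ?g (C i)) \<partial>?B)"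
  proof (rule nn_integral_mono)
    fix C
    show "(if \<exists>i\<in>I. ?q (C i) \<le> ?c then 1 else 0) \<le> (\<Sum>i\<in>I. ?g (C i))"
    proof (cases "\<exists>i\<in>I. ?q (C i) \<le> ?c")
      case True
      then obtain i where i: "i \<in> I" "?g (C i) = 1" by auto
      then have "?g (C i) \<le> (\<Sum>i\<in>I. ?g (C i))" using I by (intro member_le_sum) auto
      then show ?thesis using True i by simp
    qed simp
  qed
  also have "\<dots> = (\<Sum>i\<in>I. \<integral>\<^sup>+C. ?g (C i) \<partial>?B)"
    using gi by (rule nn_integral_sum)
  also have "\<dots> = (\<Sum>i\<in>I. \<integral>\<^sup>+g. ?g g \<partial>noise_law l n)"
  proof (rule sum.cong[OF refl])
    fix i assume i: "i \<in> I"
    have "(\<integral>\<^sup>+g. ?g g \<partial>distr (?B) (noise_law l n) (\<lambda>C. C i)) = (\<integral>\<^sup>+C. ?g (C i) \<partial>?B)"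
      using g by (subst nn_integral_distr[OF measurable_component_singleton[OF i, of "\<lambda>_. noise_law l n"]]) (simp_all only: measurable_distr_eq1)
    moreover have "distr (?B) (noise_law l n) (\<lambda>C. C i) = noise_law l n"
      using i by (rule distr_PiM_component[OF prob_space_noise_law])
    ultimately show "(\<integral>\<^sup>+C. ?g (C i) \<partial>?B) = (\<integral>\<^sup>+g. ?g g \<partial>noise_law l n)" by simp
  qed
  also have "\<dots> \<le> (\<Sum>i\<in>I. ennreal (exp (- seq_info \<kappa> \<rho> l n s x y)))"
    by (intro sum_mono pairwise_error_bound assms)
  finally show "?E \<le> ennreal (real (card I)) * ennreal (exp (- seq_info \<kappa> \<rho> l n s x y))"
    by (simp add: ennreal_of_nat_eq_real_of_nat)
qed

text \<open>A tie counts as confusion, so the event contains every error of a minimum-metric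
  decoder, however ties are broken. The transmitted g is kept apart from the competitors C because
  the two are integrated separately.\<close>

definition confusable :: "real \<Rightarrow> real \<Rightarrow> nat \<Rightarrow> nat \<Rightarrow> nat set \<Rightarrow> (nat \<Rightarrow> nat \<Rightarrow> nat \<Rightarrow> complex) \<Rightarrow> (nat \<Rightarrow> nat \<Rightarrow> complex)
    \<Rightarrow> (nat \<Rightarrow> complex) \<Rightarrow> (nat \<Rightarrow> nat \<Rightarrow> complex) \<Rightarrow> ennreal" where
  "confusable \<kappa> \<rho> l n I C g H W =
    (if \<exists>i\<in>I. seq_metric \<kappa> \<rho> l n (codeword \<rho> n (C i)) (\<lambda>k i. H k * codeword \<rho> n g k i + W k i)
        \<le> seq_metric \<kappa> \<rho> l n (codeword \<rho> n g) (\<lambda>k i. H k * codeword \<rho> n g k i + W k i) then 1 else 0)"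

lemma borel_measurable_confusable [measurable (raw)]:
  assumes I: "finite I"
    and C: "C \<in> \<Omega> \<rightarrow>\<^sub>M Pi\<^sub>M I (\<lambda>_. noise_law l n)" and g: "g \<in> \<Omega> \<rightarrow>\<^sub>M noise_law l n"
    and H: "H \<in> \<Omega> \<rightarrow>\<^sub>M fading_law \<kappa> l" and W: "W \<in> \<Omega> \<rightarrow>\<^sub>M noise_law l n"
  shows "(\<lambda>\<omega>. confusable \<kappa> \<rho> l n I (C \<omega>) (g \<omega>) (H \<omega>) (W \<omega>)) \<in> borel_measurable \<Omega>"
proof -
  have Y: "(\<lambda>\<omega>. H \<omega> k * codeword \<rho> n (g \<omega>) k i + W \<omega> k i) \<in> borel_measurable \<Omega>" if "k \<in> {..<l}" "i \<in> {..<n}" for k i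
    using that by (intro borel_measurable_add borel_measurable_times borel_measurable_codeword[OF g]
      measurable_fading_component[OF H] measurable_noise_component[OF W]) auto
  have Ci: "(\<lambda>\<omega>. C \<omega> j) \<in> \<Omega> \<rightarrow>\<^sub>M noise_law l n" if "j \<in> I" for j
    using measurable_compose[OF C measurable_component_singleton[OF that]] .
  have [measurable]: "(\<lambda>\<omega>. seq_metric \<kappa> \<rho> l n (codeword \<rho> n (C \<omega> j)) (\<lambda>k i. H \<omega> k * codeword \<rho> n (g \<omega>) k i + W \<omega> k i)) \<in> borel_measurable \<Omega>"
    if "j \<in> I" for j
    using that Y by (intro borel_measurable_seq_metric borel_measurable_codeword[OF Ci]) auto
  have [measurable]: "(\<lambda>\<omega>. seq_metric \<kappa> \<rho> l n (codeword \<rho> n (g \<omega>)) (\<lambda>k i. H \<omega> k * codeword \<rho> n (g \<omega>) k i + W \<omega> k i)) \<in> borel_measurable \<Omega>"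
    using Y by (intro borel_measurable_seq_metric borel_measurable_codeword[OF g]) auto
  show ?thesis unfolding confusable_def using I by measurable
qed

text \<open>Given the transmitted codeword, the fading and the noise, the competitors are averaged
  first. What remains has the same mean for each transmitted codeword, so the outermost average is
  over a constant.\<close>

lemma average_confusion_bound:
  assumes \<kappa>: "0 \<le> \<kappa>" and \<rho>: "0 < \<rho>" and n: "1 \<le> n" and s: "0 < s" and I: "finite I" "I \<noteq> {}"
  shows "(\<integral>\<^sup>+g. \<integral>\<^sup>+C. \<integral>\<^sup>+H. \<integral>\<^sup>+W. confusable \<kappa> \<rho> l n I C g H W
      \<partial>noise_law l n \<partial>fading_law \<kappa> l \<partial>Pi\<^sub>M I (\<lambda>_. noise_law l n) \<partial>noise_law l n)
    \<le> (\<integral>\<^sup>+W. ennreal (exp (- max 0 ((\<Sum>k<l. S_term \<kappa> n \<rho> s (W k)) - ln (real (card I))))) \<partial>noise_law l n)"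
    (is "_ \<le> ?R")
proof -
  interpret F: prob_space "fading_law \<kappa> l" using \<kappa> by (rule prob_space_fading_law)
  let ?N = "noise_law l n" and ?F = "fading_law \<kappa> l" and ?B = "Pi\<^sub>M I (\<lambda>_. noise_law l n)"
  note [measurable (raw)] = borel_measurable_confusable[OF I(1)]
  have "(\<integral>\<^sup>+C. \<integral>\<^sup>+H. \<integral>\<^sup>+W. confusable \<kappa> \<rho> l n I C g H W \<partial>?N \<partial>?F \<partial>?B) \<le> ?R" if g: "g \<in> space ?N" for g
  proof -
    note [measurable] = g
    let ?x = "codeword \<rho> n g"
    have "(\<integral>\<^sup>+C. \<integral>\<^sup>+H. \<integral>\<^sup>+W. confusable \<kappa> \<rho> l n I C g H W \<partial>?N \<partial>?F \<partial>?B) =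
      (\<integral>\<^sup>+H. \<integral>\<^sup>+C. \<integral>\<^sup>+W. confusable \<kappa> \<rho> l n I C g H W \<partial>?N \<partial>?B \<partial>?F)"
      by (rule nn_integral_swap) (simp_all only: F.prob_space_axioms prob_space_codebook simp_thms, measurable)
    also have "\<dots> = (\<integral>\<^sup>+H. \<integral>\<^sup>+W. \<integral>\<^sup>+C. confusable \<kappa> \<rho> l n I C g H W \<partial>?B \<partial>?N \<partial>?F)"
    proof (rule nn_integral_cong)
      fix H assume [measurable]: "H \<in> space ?F"
      show "(\<integral>\<^sup>+C. \<integral>\<^sup>+W. confusable \<kappa> \<rho> l n I C g H W \<partial>?N \<partial>?B) = (\<integral>\<^sup>+W. \<integral>\<^sup>+C. confusable \<kappa> \<rho> l n I C g H W \<partial>?B \<partial>?N)"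
        by (rule nn_integral_swap) (simp_all only: prob_space_noise_law prob_space_codebook simp_thms, measurable)
    qed
    also have "\<dots> \<le> (\<integral>\<^sup>+H. \<integral>\<^sup>+W. ennreal (exp (- max 0 (seq_info \<kappa> \<rho> l n s ?x (\<lambda>k i. H k * ?x k i + W k i) - ln (real (card I))))) \<partial>?N \<partial>?F)"
      unfolding confusable_def by (intro nn_integral_mono random_codebook_error_bound assms)
    also have "\<dots> = ?R"
      using n \<rho> by (intro nn_integral_seq_info[OF \<kappa> \<rho> n s, of l ?x "\<lambda>r. ennreal (exp (- max 0 (r - ln (real (card I)))))"])
        (simp_all add: codeword_def vnorm_sphere_point)
    finally show ?thesis .
  qed
  then have "(\<integral>\<^sup>+g. \<integral>\<^sup>+C. \<integral>\<^sup>+H. \<integral>\<^sup>+W. confusable \<kappa> \<rho> l n I C g H W \<partial>?N \<partial>?F \<partial>?B \<partial>?N) \<le> (\<integral>\<^sup>+g. ?R \<partial>?N)"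
    by (intro nn_integral_mono) auto
  then show ?thesis by (simp add: noise.emeasure_space_1)
qed

section \<open>The channel law and the minimum-metric decoder\<close>

lemma measurable_output_component:
  assumes "k < l" "i < n"
  shows "(\<lambda>y. y k i) \<in> borel_measurable (output_space l n)"
proof -
  have 1: "(\<lambda>y. y k) \<in> output_space l n \<rightarrow>\<^sub>M Pi\<^sub>M {..<n} (\<lambda>_. borel :: complex measure)"
    unfolding output_space_def using assms by (intro measurable_component_singleton) auto
  have 2: "(\<lambda>w. w i) \<in> Pi\<^sub>M {..<n} (\<lambda>_. borel :: complex measure) \<rightarrow>\<^sub>M borel"
    using assms by (intro measurable_component_singleton) auto
  show ?thesis using measurable_compose[OF 1 2] .
qed

abbreviation "channel_output l n x H W \<equiv> \<lambda>k\<in>{..<l}. \<lambda>i\<in>{..<n}. H k * x k i + W k i"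

abbreviation "error_event l n g j \<equiv> {y \<in> space (output_space l n). g y \<noteq> j}"

lemma measurable_channel_map:
  assumes H: "H \<in> \<Omega> \<rightarrow>\<^sub>M fading_law \<kappa> l" and W: "W \<in> \<Omega> \<rightarrow>\<^sub>M noise_law l n"
  shows "(\<lambda>\<omega>. \<lambda>k\<in>{..<l}. \<lambda>i\<in>{..<n}. H \<omega> k * x k i + W \<omega> k i) \<in> \<Omega> \<rightarrow>\<^sub>M output_space l n"
  unfolding output_space_def
  by (intro measurable_restrict borel_measurable_add borel_measurable_times borel_measurable_const
      measurable_fading_component[OF H] measurable_noise_component[OF W]) auto

lemma emeasure_channel_law:
  assumes \<kappa>: "0 \<le> \<kappa>" and A: "A \<in> sets (output_space l n)"
  shows "emeasure (channel_law \<kappa> l n x) A =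
    (\<integral>\<^sup>+H. \<integral>\<^sup>+W. indicator A (channel_output l n x H W) \<partial>noise_law l n \<partial>fading_law \<kappa> l)"
proof -
  let ?T = "\<lambda>(H, W). channel_output l n x H W"
  have T: "?T \<in> fading_law \<kappa> l \<Otimes>\<^sub>M noise_law l n \<rightarrow>\<^sub>M output_space l n"
    unfolding split_beta' by (intro measurable_channel_map) measurable
  have "emeasure (channel_law \<kappa> l n x) A = (\<integral>\<^sup>+y. indicator A y \<partial>channel_law \<kappa> l n x)"
    using A by (simp add: channel_law_def)
  also have "\<dots> = (\<integral>\<^sup>+p. indicator A (?T p) \<partial>(fading_law \<kappa> l \<Otimes>\<^sub>M noise_law l n))"
    unfolding channel_law_def using A by (intro nn_integral_distr[OF T]) simp
  also have "\<dots> = (\<integral>\<^sup>+H. \<integral>\<^sup>+W. indicator A (?T (H, W)) \<partial>noise_law l n \<partial>fading_law \<kappa> l)"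
  proof (rule noise.nn_integral_fst[symmetric])
    have "(indicator A :: _ \<Rightarrow> ennreal) \<in> borel_measurable (output_space l n)" using A by simp
    from measurable_compose[OF T this]
    show "(\<lambda>p. indicator A (?T p) :: ennreal) \<in> borel_measurable (fading_law \<kappa> l \<Otimes>\<^sub>M noise_law l n)" .
  qed
  finally show ?thesis by simp
qed

lemma prob_space_channel_law: "0 \<le> \<kappa> \<Longrightarrow> prob_space (channel_law \<kappa> l n x)"
proof -
  assume "0 \<le> \<kappa>"
  then interpret F: prob_space "fading_law \<kappa> l" by (rule prob_space_fading_law)
  interpret FN: pair_prob_space "fading_law \<kappa> l" "noise_law l n" ..
  show ?thesis unfolding channel_law_def split_beta'
    by (intro FN.prob_space_distr measurable_channel_map) measurable
qed

lemma sets_channel_law: "sets (channel_law \<kappa> l n x) = sets (output_space l n)"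
  "space (channel_law \<kappa> l n x) = space (output_space l n)"
  by (simp_all add: channel_law_def)

text \<open>The channel restricts its output to the index ranges, while the estimates use
  unrestricted functions; both agree on the indices that the metric reads.\<close>

lemma seq_metric_cong:
  "(\<And>k i. k < l \<Longrightarrow> i < n \<Longrightarrow> y k i = y' k i) \<Longrightarrow> seq_metric \<kappa> \<rho> l n x y = seq_metric \<kappa> \<rho> l n x y'"
  unfolding seq_metric_def block_metric_def vnorm_def L2_set_def by simp

text \<open>\<open>LEAST\<close> breaks ties by index and gives measurability, as the least number
  satisfying measurable predicates.\<close>

definition nearest :: "real \<Rightarrow> real \<Rightarrow> nat \<Rightarrow> nat \<Rightarrow> nat \<Rightarrow> (nat \<Rightarrow> nat \<Rightarrow> nat \<Rightarrow> complex) \<Rightarrow> (nat \<Rightarrow> nat \<Rightarrow> complex) \<Rightarrow> nat" where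
  "nearest \<kappa> \<rho> l n M f y =
    (LEAST m. m \<in> {1..M} \<and> (\<forall>i\<in>{1..M}. seq_metric \<kappa> \<rho> l n (f m) y \<le> seq_metric \<kappa> \<rho> l n (f i) y))"

lemma nearest:
  assumes "1 \<le> M"
  shows "nearest \<kappa> \<rho> l n M f y \<in> {1..M}"
    "i \<in> {1..M} \<Longrightarrow> seq_metric \<kappa> \<rho> l n (f (nearest \<kappa> \<rho> l n M f y)) y \<le> seq_metric \<kappa> \<rho> l n (f i) y"
proof -
  let ?q = "\<lambda>m. seq_metric \<kappa> \<rho> l n (f m) y"
  have "finite (?q ` {1..M})" "?q ` {1..M} \<noteq> {}" using assms by auto
  then have "Min (?q ` {1..M}) \<in> ?q ` {1..M}" by (rule Min_in)
  then obtain m where m: "m \<in> {1..M}" "Min (?q ` {1..M}) = ?q m" by (rule imageE)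
  have "?q m \<le> ?q i" if "i \<in> {1..M}" for i
    unfolding m(2)[symmetric] by (rule Min_le) (use that in auto)
  with m(1) have "m \<in> {1..M} \<and> (\<forall>i\<in>{1..M}. ?q m \<le> ?q i)" by blast
  then have *: "nearest \<kappa> \<rho> l n M f y \<in> {1..M} \<and> (\<forall>i\<in>{1..M}. ?q (nearest \<kappa> \<rho> l n M f y) \<le> ?q i)"
    unfolding nearest_def by (rule LeastI)
  then show "nearest \<kappa> \<rho> l n M f y \<in> {1..M}" by simp
  show "i \<in> {1..M} \<Longrightarrow> seq_metric \<kappa> \<rho> l n (f (nearest \<kappa> \<rho> l n M f y)) y \<le> seq_metric \<kappa> \<rho> l n (f i) y"
    using * by blast
qed

lemma measurable_nearest:
  assumes "1 \<le> M"
  shows "nearest \<kappa> \<rho> l n M f \<in> output_space l n \<rightarrow>\<^sub>M count_space {1..M}"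
proof -
  have q: "(\<lambda>y. seq_metric \<kappa> \<rho> l n (f m) y) \<in> borel_measurable (output_space l n)" for m
    by (rule borel_measurable_seq_metric) (auto intro: measurable_output_component)
  have p: "Measurable.pred (output_space l n) (\<lambda>y. m \<in> {1..M} \<and> (\<forall>i\<in>{1..M}. seq_metric \<kappa> \<rho> l n (f m) y \<le> seq_metric \<kappa> \<rho> l n (f i) y))" for m
    by (intro pred_intros_logic pred_intros_finite) (auto simp: pred_def intro: borel_measurable_le q)
  have "nearest \<kappa> \<rho> l n M f \<in> output_space l n \<rightarrow>\<^sub>M count_space UNIV"
    unfolding nearest_def[abs_def] by (rule measurable_Least) (rule p)
  then have "nearest \<kappa> \<rho> l n M f -` {m} \<inter> space (output_space l n) \<in> sets (output_space l n)" for m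
    by (rule measurable_sets) simp
  then show ?thesis using nearest(1)[OF assms] by (subst measurable_count_space_eq2) auto
qed

section \<open>Choosing a codebook\<close>

lemma exists_le_nn_integral:
  assumes M: "prob_space M" and f: "f \<in> borel_measurable M" and K: "(\<integral>\<^sup>+x. f x \<partial>M) \<le> ennreal K"
  shows "\<exists>x\<in>space M. f x \<le> ennreal K"
proof (rule ccontr)
  interpret prob_space M by fact
  assume "\<not> ?thesis"
  then have gt: "ennreal K < f x" if "x \<in> space M" for x using that by (auto simp: not_le)
  have "(\<integral>\<^sup>+x. ennreal K \<partial>M) < (\<integral>\<^sup>+x. f x \<partial>M)"
  proof (rule nn_integral_less)
    show "AE x in M. ennreal K \<le> f x" using gt by (intro AE_I2) (simp add: less_imp_le)
    show "\<not> (AE x in M. f x \<le> ennreal K)"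
    proof
      assume "AE x in M. f x \<le> ennreal K"
      then have "AE x in M. False" using AE_space by eventually_elim (use gt in \<open>auto simp: not_le[symmetric]\<close>)
      then show False by simp
    qed
  qed (auto simp: f emeasure_space_1)
  then show False using K by (simp add: emeasure_space_1)
qed

lemma rcu_integral:
  assumes M: "2 \<le> M"
  shows "(\<integral>\<^sup>+W. ennreal (exp (- max 0 ((\<Sum>k<l. S_term \<kappa> n \<rho> s (W k)) - ln (real M - 1)))) \<partial>noise_law l n)
    = ennreal (LINT W|noise_law l n. (if M = 1 then 0 else exp (- max 0 ((\<Sum>k<l. S_term \<kappa> n \<rho> s (W k)) - ln (real M - 1)))))"
proof -
  have "(\<lambda>W. S_term \<kappa> n \<rho> s (W k)) \<in> borel_measurable (noise_law l n)" if "k \<in> {..<l}" for k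
    unfolding noise_law_eq using measurable_compose[OF measurable_component_singleton[OF that] borel_measurable_S_term] .
  note [measurable] = this
  have "integrable (noise_law l n) (\<lambda>W. exp (- max 0 ((\<Sum>k<l. S_term \<kappa> n \<rho> s (W k)) - ln (real M - 1))))"
  proof (rule noise.integrable_const_bound[where B=1])
    show "(\<lambda>W. exp (- max 0 ((\<Sum>k<l. S_term \<kappa> n \<rho> s (W k)) - ln (real M - 1)))) \<in> borel_measurable (noise_law l n)"
      by measurable
  qed auto
  then show ?thesis using M by (simp add: nn_integral_eq_integral)
qed

lemma code_exists:
  assumes \<kappa>: "0 \<le> \<kappa>" and \<rho>: "0 < \<rho>" and n: "1 \<le> n" and \<epsilon>: "0 < \<epsilon>" and M: "1 \<le> M" and eps: "eps_ub \<kappa> l n M \<rho> \<le> \<epsilon>"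
  shows "\<exists>f g. is_code \<kappa> l n M \<epsilon> \<rho> f g"
proof (cases "M = 1")
  case True
  have "(vnorm n (codeword \<rho> n (\<lambda>_ _. 0) k))\<^sup>2 = real n * \<rho>" for k
    using n \<rho> by (simp add: codeword_def vnorm_sphere_point)
  \<comment> \<open>With a single message the constant decoder never errs.\<close>
  then have "is_code \<kappa> l n M \<epsilon> \<rho> (\<lambda>_. codeword \<rho> n (\<lambda>_ _. 0)) (\<lambda>_. 1)"
    using True \<epsilon> by (simp add: is_code_def)
  then show ?thesis by blast
next
  case False
  with M have M2: "2 \<le> M" by simp
  let ?e = "\<lambda>s W. exp (- max 0 ((\<Sum>k<l. S_term \<kappa> n \<rho> s (W k)) - ln (real M - 1)))"
  interpret F: prob_space "fading_law \<kappa> l" using \<kappa> by (rule prob_space_fading_law)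
  let ?N = "noise_law l n" and ?F = "fading_law \<kappa> l" and ?CB = "Pi\<^sub>M {1..M} (\<lambda>_. noise_law l n)"
  define I where "I j = {1..M} - {j}" for j
  have I: "finite (I j)" "j \<notin> I j" for j by (auto simp: I_def)
  have insI: "insert j (I j) = {1..M}" "card (I j) = M - 1" "I j \<noteq> {}" if "j \<in> {1..M}" for j
  proof -
    show "insert j (I j) = {1..M}" using that by (auto simp: I_def)
    show c: "card (I j) = M - 1" using that by (simp add: I_def)
    show "I j \<noteq> {}" using c M2 by auto
  qed
  \<comment> \<open>The probability, for a given codebook C, that message j is confusable with
    another message; it dominates the error probability of j.\<close>
  define U where "U j C = (\<integral>\<^sup>+H. \<integral>\<^sup>+W. confusable \<kappa> \<rho> l n (I j) (restrict C (I j)) (C j) H W \<partial>?N \<partial>?F)" for j C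
  have U_measurable: "U j \<in> borel_measurable ?CB" if j: "j \<in> {1..M}" for j
  proof -
    have r: "(\<lambda>C. restrict C (I j)) \<in> ?CB \<rightarrow>\<^sub>M Pi\<^sub>M (I j) (\<lambda>_. ?N)"
      by (rule measurable_restrict_subset) (auto simp: I_def)
    have c: "(\<lambda>C. C j) \<in> ?CB \<rightarrow>\<^sub>M ?N" using j by (rule measurable_component_singleton)
    have "(\<lambda>p. confusable \<kappa> \<rho> l n (I j) (restrict (fst (fst p)) (I j)) (fst (fst p) j) (snd (fst p)) (snd p)) \<in> borel_measurable ((?CB \<Otimes>\<^sub>M ?F) \<Otimes>\<^sub>M ?N)"
      using measurable_compose[OF measurable_compose[OF measurable_fst measurable_fst] r]
        measurable_compose[OF measurable_compose[OF measurable_fst measurable_fst] c]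
      by (intro borel_measurable_confusable[OF I(1)]) (auto intro: measurable_compose[OF measurable_fst measurable_snd])
    then show ?thesis unfolding U_def
      by (intro F.borel_measurable_nn_integral noise.borel_measurable_nn_integral) (simp_all add: split_beta')
  qed
  have U_avg: "(\<integral>\<^sup>+C. U j C \<partial>?CB) \<le> ennreal (LINT W|?N. (if M = 1 then 0 else ?e s W))"
    if j: "j \<in> {1..M}" and s: "0 < s" for j s
  proof -
    \<comment> \<open>Component j of the codebook is split off as the transmitted codeword,
      independent of the others.\<close>
    have "integral\<^sup>N (Pi\<^sub>M (insert j (I j)) (\<lambda>_. ?N)) (U j) = (\<integral>\<^sup>+g. \<integral>\<^sup>+C. U j (C(j := g)) \<partial>Pi\<^sub>M (I j) (\<lambda>_. ?N) \<partial>?N)"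
      by (rule noises.product_nn_integral_insert_rev[OF I]) (use U_measurable[OF j] insI(1)[OF j] in simp)
    then have "(\<integral>\<^sup>+C. U j C \<partial>?CB) = (\<integral>\<^sup>+g. \<integral>\<^sup>+C. U j (C(j := g)) \<partial>Pi\<^sub>M (I j) (\<lambda>_. ?N) \<partial>?N)"
      unfolding insI(1)[OF j] .
    also have "\<dots> = (\<integral>\<^sup>+g. \<integral>\<^sup>+C. \<integral>\<^sup>+H. \<integral>\<^sup>+W. confusable \<kappa> \<rho> l n (I j) C g H W \<partial>?N \<partial>?F \<partial>Pi\<^sub>M (I j) (\<lambda>_. ?N) \<partial>?N)"
    proof -
      have "confusable \<kappa> \<rho> l n (I j) (restrict (C(j := g)) (I j)) g = confusable \<kappa> \<rho> l n (I j) C g" for C g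
        using I(2)[of j] unfolding confusable_def by (intro ext if_cong bex_cong refl) auto
      then show ?thesis unfolding U_def by simp
    qed
    also have "\<dots> \<le> (\<integral>\<^sup>+W. ennreal (exp (- max 0 ((\<Sum>k<l. S_term \<kappa> n \<rho> s (W k)) - ln (real (card (I j)))))) \<partial>?N)"
      by (rule average_confusion_bound[OF \<kappa> \<rho> n s I(1) insI(3)[OF j]])
    also have "real (card (I j)) = real M - 1" using insI(2)[OF j] M by (simp add: of_nat_diff)
    finally show ?thesis unfolding rcu_integral[OF M2] .
  qed
  \<comment> \<open>The averaged total is free of s, so it lies below the bound for each s and hence
    below the infimum, attained or not. Summing over messages before a codebook is picked ensures
    that one codebook serves all messages on average.\<close>
  define a where "a = (\<integral>\<^sup>+C. (\<Sum>j\<in>{1..M}. U j C) \<partial>?CB)"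
  have a_sum: "a = (\<Sum>j\<in>{1..M}. \<integral>\<^sup>+C. U j C \<partial>?CB)"
    unfolding a_def using U_measurable by (rule nn_integral_sum)
  have a_le: "a \<le> ennreal (real M * (LINT W|?N. (if M = 1 then 0 else ?e s W)))"
    (is "_ \<le> ennreal (_ * ?L s)") if s: "0 < s" for s
  proof -
    have "a \<le> (\<Sum>j\<in>{1..M}. ennreal (?L s))" unfolding a_sum by (intro sum_mono U_avg s)
    also have "\<dots> = ennreal (real M * ?L s)" by (simp add: ennreal_mult' ennreal_of_nat_eq_real_of_nat)
    finally show ?thesis .
  qed
  have a_fin: "ennreal (enn2real a) = a"
    using a_le[of 1] by (intro ennreal_enn2real) (auto intro: le_less_trans)
  have "enn2real a / real M \<le> eps_ub \<kappa> l n M \<rho>" unfolding eps_ub_def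
  proof (rule cINF_greatest)
    fix s :: real assume "s \<in> {0<..}"
    then have s: "0 < s" by simp
    have L0: "0 \<le> ?L s" by (intro integral_nonneg_AE AE_I2) auto
    have "ennreal (enn2real a) \<le> ennreal (real M * ?L s)" unfolding a_fin by (rule a_le[OF s])
    then have "enn2real a \<le> real M * ?L s" using L0 by (subst (asm) ennreal_le_iff) auto
    then show "enn2real a / real M \<le> ?L s" using M by (simp add: field_simps)
  qed auto
  with eps have "enn2real a / real M \<le> \<epsilon>" by (rule order_trans[rotated])
  then have "enn2real a \<le> real M * \<epsilon>" using M by (simp add: field_simps)
  then have a_eps: "a \<le> ennreal (real M * \<epsilon>)" by (subst a_fin[symmetric]) (rule ennreal_leI)
  have "\<exists>C\<in>space ?CB. (\<Sum>j\<in>{1..M}. U j C) \<le> ennreal (real M * \<epsilon>)"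
    using a_eps U_measurable unfolding a_def by (intro exists_le_nn_integral prob_space_codebook borel_measurable_sum) auto
  then obtain C where C: "(\<Sum>j\<in>{1..M}. U j C) \<le> ennreal (real M * \<epsilon>)" by blast
  define f where "f m = codeword \<rho> n (C m)" for m
  define g where "g = nearest \<kappa> \<rho> l n M f"
  have g_measurable: "g \<in> output_space l n \<rightarrow>\<^sub>M count_space {1..M}"
    unfolding g_def using M by (rule measurable_nearest)
  have err: "ennreal (measure (channel_law \<kappa> l n (f j)) (error_event l n g j)) \<le> U j C" if j: "j \<in> {1..M}" for j
  proof -
    interpret Ch: prob_space "channel_law \<kappa> l n (f j)" using \<kappa> by (rule prob_space_channel_law)
    let ?E = "error_event l n g j"
    have "?E = g -` ({1..M} - {j}) \<inter> space (output_space l n)"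
      using nearest(1)[OF M] by (auto simp: g_def)
    also have "\<dots> \<in> sets (output_space l n)" by (rule measurable_sets[OF g_measurable]) auto
    finally have E: "?E \<in> sets (output_space l n)" .
    have "ennreal (measure (channel_law \<kappa> l n (f j)) ?E) = emeasure (channel_law \<kappa> l n (f j)) ?E"
      by (simp add: Ch.emeasure_eq_measure)
    also have "\<dots> = (\<integral>\<^sup>+H. \<integral>\<^sup>+W. indicator ?E (channel_output l n (f j) H W) \<partial>?N \<partial>?F)"
      by (rule emeasure_channel_law[OF \<kappa> E])
    also have "\<dots> \<le> U j C" unfolding U_def
    proof (intro nn_integral_mono)
      fix H W
      let ?y = "\<lambda>k i. H k * f j k i + W k i"
      let ?y' = "channel_output l n (f j) H W"
      have cong: "seq_metric \<kappa> \<rho> l n x ?y' = seq_metric \<kappa> \<rho> l n x ?y" for x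
        by (rule seq_metric_cong) simp
      show "indicator ?E ?y' \<le> confusable \<kappa> \<rho> l n (I j) (restrict C (I j)) (C j) H W"
      proof (cases "g ?y' = j")
        case False
        then have i: "g ?y' \<in> I j" using nearest(1)[OF M] by (simp add: g_def I_def)
        have "seq_metric \<kappa> \<rho> l n (f (g ?y')) ?y \<le> seq_metric \<kappa> \<rho> l n (f j) ?y"
          using nearest(2)[OF M j, of \<kappa> \<rho> l n f ?y'] unfolding cong g_def .
        then have "\<exists>i\<in>I j. seq_metric \<kappa> \<rho> l n (codeword \<rho> n (restrict C (I j) i)) ?y \<le> seq_metric \<kappa> \<rho> l n (codeword \<rho> n (C j)) ?y"
          using i by (intro bexI[of _ "g ?y'"]) (simp_all add: f_def)
        then have "confusable \<kappa> \<rho> l n (I j) (restrict C (I j)) (C j) H W = 1"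
          unfolding confusable_def f_def by (rule if_P)
        then show ?thesis by (simp add: indicator_def)
      qed simp
    qed
    finally show ?thesis .
  qed
  have "ennreal (\<Sum>j=1..M. measure (channel_law \<kappa> l n (f j)) (error_event l n g j))
    = (\<Sum>j=1..M. ennreal (measure (channel_law \<kappa> l n (f j)) (error_event l n g j)))"
    by (rule sum_ennreal[symmetric]) simp
  also have "\<dots> \<le> (\<Sum>j\<in>{1..M}. U j C)" by (intro sum_mono err)
  also have "\<dots> \<le> ennreal (real M * \<epsilon>)" by (rule C)
  finally have "(\<Sum>j=1..M. measure (channel_law \<kappa> l n (f j)) (error_event l n g j)) \<le> real M * \<epsilon>"
    using \<epsilon> by (subst (asm) ennreal_le_iff) auto
  then have "is_code \<kappa> l n M \<epsilon> \<rho> f g"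
    using M n \<rho> g_measurable by (simp add: is_code_def f_def codeword_def vnorm_sphere_point field_simps)
  then show ?thesis by blast
qed

subsection \<open>Finiteness of codes with small error probability\<close>

text \<open>A hybrid argument: coordinates are switched from T to S one at a time, and each switch
  costs a factor c.\<close>

lemma nn_integral_PiM_dominated:
  fixes T :: "'i \<Rightarrow> 'a \<Rightarrow> 'b" and S :: "'a \<Rightarrow> 'b" and c :: ennreal and F :: "('i \<Rightarrow> 'b) \<Rightarrow> ennreal"
  assumes A: "prob_space A" and J: "finite J"
    and T: "\<And>i. T i \<in> A \<rightarrow>\<^sub>M B" and S: "S \<in> A \<rightarrow>\<^sub>M B"
    and dom: "\<And>i f. i \<in> J \<Longrightarrow> f \<in> borel_measurable B \<Longrightarrow> (\<integral>\<^sup>+w. f (T i w) \<partial>A) \<le> c * (\<integral>\<^sup>+w. f (S w) \<partial>A)"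
    and F: "F \<in> borel_measurable (Pi\<^sub>M J (\<lambda>_. B))"
  shows "(\<integral>\<^sup>+w. F (\<lambda>i\<in>J. T i (w i)) \<partial>Pi\<^sub>M J (\<lambda>_. A)) \<le> c ^ card J * (\<integral>\<^sup>+w. F (\<lambda>i\<in>J. S (w i)) \<partial>Pi\<^sub>M J (\<lambda>_. A))"
  using J dom F
proof (induction J arbitrary: F)
  case empty
  then show ?case by simp
next
  case (insert j J F)
  interpret A: prob_space A by fact
  interpret As: product_sigma_finite "\<lambda>_. A" by (simp add: product_sigma_finite_def A.sigma_finite_measure_axioms)
  interpret PA: prob_space "Pi\<^sub>M J (\<lambda>_. A)" by (rule prob_space_PiM) (rule A)
  let ?A = "Pi\<^sub>M J (\<lambda>_. A)"
  let ?TS = "\<lambda>w y. (\<lambda>i\<in>J. T i (w i))(j := S y)" and ?SS = "\<lambda>w y. (\<lambda>i\<in>J. S (w i))(j := S y)"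
  have fin: "finite J" "j \<notin> J" by fact+
  have restr: "(\<lambda>w. \<lambda>i\<in>K. R i (w i)) \<in> Pi\<^sub>M K (\<lambda>_. A) \<rightarrow>\<^sub>M Pi\<^sub>M K (\<lambda>_. B)" if R: "\<And>i. R i \<in> A \<rightarrow>\<^sub>M B" for R :: "'i \<Rightarrow> 'a \<Rightarrow> 'b" and K
  proof (rule measurable_restrict)
    fix i assume i: "i \<in> K"
    have "(\<lambda>w. w i) \<in> Pi\<^sub>M K (\<lambda>_. A) \<rightarrow>\<^sub>M A" using measurable_component_singleton[OF i, of "\<lambda>_. A"] .
    from measurable_compose[OF this R] show "(\<lambda>w. R i (w i)) \<in> Pi\<^sub>M K (\<lambda>_. A) \<rightarrow>\<^sub>M B" .
  qed
  have upd: "(\<lambda>i\<in>insert j J. R i ((w(j := y)) i)) = (\<lambda>i\<in>J. R i (w i))(j := R j y)" for R :: "'i \<Rightarrow> 'a \<Rightarrow> 'b" and w y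
    using fin by (auto simp: restrict_def fun_eq_iff)
  have joint: "(\<lambda>(w, y). F ((\<lambda>i\<in>J. R i (w i))(j := Q y))) \<in> borel_measurable (?A \<Otimes>\<^sub>M A)"
    if R: "\<And>i. R i \<in> A \<rightarrow>\<^sub>M B" and Q: "Q \<in> A \<rightarrow>\<^sub>M B" for R :: "'i \<Rightarrow> 'a \<Rightarrow> 'b" and Q
  proof -
    have "(\<lambda>p. ((\<lambda>i\<in>J. R i (fst p i)), Q (snd p))) \<in> ?A \<Otimes>\<^sub>M A \<rightarrow>\<^sub>M Pi\<^sub>M J (\<lambda>_. B) \<Otimes>\<^sub>M B"
      by (intro measurable_Pair measurable_compose[OF measurable_fst restr[of R, OF R]] measurable_compose[OF measurable_snd Q])
    from measurable_compose[OF measurable_compose[OF this measurable_add_dim[of j J "\<lambda>_. B"]] insert.prems(2)]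
    show ?thesis by (simp add: split_beta' fun_upd_def cong: if_cong)
  qed
  have space: "(\<lambda>i\<in>J. R i (w i)) \<in> space (Pi\<^sub>M J (\<lambda>_. B))" if "w \<in> space ?A" "\<And>i. R i \<in> A \<rightarrow>\<^sub>M B" for R :: "'i \<Rightarrow> 'a \<Rightarrow> 'b" and w
    using measurable_space[OF restr[of R, OF that(2)] that(1)] .
  have "(\<integral>\<^sup>+w. F (\<lambda>i\<in>insert j J. T i (w i)) \<partial>Pi\<^sub>M (insert j J) (\<lambda>_. A)) =
    (\<integral>\<^sup>+w. \<integral>\<^sup>+y. F ((\<lambda>i\<in>J. T i (w i))(j := T j y)) \<partial>A \<partial>?A)"
    using As.product_nn_integral_insert[OF fin measurable_compose[OF restr[of T, OF T] insert.prems(2)]] unfolding upd .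
  also have "\<dots> \<le> (\<integral>\<^sup>+w. c * (\<integral>\<^sup>+y. F (?TS w y) \<partial>A) \<partial>?A)"
  proof (rule nn_integral_mono)
    fix w assume w: "w \<in> space ?A"
    have "(\<lambda>b. F ((\<lambda>i\<in>J. T i (w i))(j := b))) \<in> borel_measurable B"
      using measurable_compose[OF measurable_component_update[OF space[OF w, of T, OF T] fin(2)] insert.prems(2)] .
    then show "(\<integral>\<^sup>+y. F ((\<lambda>i\<in>J. T i (w i))(j := T j y)) \<partial>A) \<le> c * (\<integral>\<^sup>+y. F (?TS w y) \<partial>A)"
      by (intro insert.prems(1)[of j "\<lambda>b. F ((\<lambda>i\<in>J. T i (w i))(j := b))"]) auto
  qed
  also have "\<dots> = c * (\<integral>\<^sup>+w. \<integral>\<^sup>+y. F (?TS w y) \<partial>A \<partial>?A)"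
    by (intro nn_integral_cmult A.borel_measurable_nn_integral joint[of T S, OF T S])
  also have "(\<integral>\<^sup>+w. \<integral>\<^sup>+y. F (?TS w y) \<partial>A \<partial>?A) = (\<integral>\<^sup>+y. \<integral>\<^sup>+w. F (?TS w y) \<partial>?A \<partial>A)"
    by (rule nn_integral_swap) (simp_all only: A PA.prob_space_axioms simp_thms joint[of T S, OF T S])
  also have "\<dots> \<le> (\<integral>\<^sup>+y. c ^ card J * (\<integral>\<^sup>+w. F (?SS w y) \<partial>?A) \<partial>A)"
  proof (rule nn_integral_mono)
    fix y assume y: "y \<in> space A"
    have "(\<lambda>b. b(j := S y)) \<in> Pi\<^sub>M J (\<lambda>_. B) \<rightarrow>\<^sub>M Pi\<^sub>M (insert j J) (\<lambda>_. B)"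
    proof -
      have "(\<lambda>b. (b, S y)) \<in> Pi\<^sub>M J (\<lambda>_. B) \<rightarrow>\<^sub>M Pi\<^sub>M J (\<lambda>_. B) \<Otimes>\<^sub>M B"
        using measurable_space[OF S y] by measurable
      from measurable_compose[OF this measurable_add_dim[of j J "\<lambda>_. B"]] show ?thesis by simp
    qed
    from measurable_compose[OF this insert.prems(2)]
    show "(\<integral>\<^sup>+w. F (?TS w y) \<partial>?A) \<le> c ^ card J * (\<integral>\<^sup>+w. F (?SS w y) \<partial>?A)"
      by (intro insert.IH[of "\<lambda>b. F (b(j := S y))"] insert.prems(1)) (auto simp: fun_upd_def)
  qed
  also have "\<dots> = c ^ card J * (\<integral>\<^sup>+y. \<integral>\<^sup>+w. F (?SS w y) \<partial>?A \<partial>A)"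
  proof (intro nn_integral_cmult PA.borel_measurable_nn_integral)
    have "(\<lambda>(w, y). F (?SS w y)) \<in> borel_measurable (?A \<Otimes>\<^sub>M A)" by (rule joint[of "\<lambda>_. S" S, OF S S])
    from measurable_compose[OF measurable_pair_swap' this]
    show "(\<lambda>(y, w). F (?SS w y)) \<in> borel_measurable (A \<Otimes>\<^sub>M ?A)" by (simp add: split_beta' fun_upd_def cong: if_cong)
  qed
  also have "(\<integral>\<^sup>+y. \<integral>\<^sup>+w. F (?SS w y) \<partial>?A \<partial>A) = (\<integral>\<^sup>+w. \<integral>\<^sup>+y. F (?SS w y) \<partial>A \<partial>?A)"
    by (rule nn_integral_swap[symmetric]) (simp_all only: A PA.prob_space_axioms simp_thms joint[of "\<lambda>_. S" S, OF S S])
  also have "\<dots> = (\<integral>\<^sup>+w. F (\<lambda>i\<in>insert j J. S (w i)) \<partial>Pi\<^sub>M (insert j J) (\<lambda>_. A))"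
    using As.product_nn_integral_insert[OF fin measurable_compose[OF restr[of "\<lambda>_. S", OF S] insert.prems(2)]] unfolding upd[of "\<lambda>_. S"] by (rule sym)
  \<comment> \<open>Chaining inequalities beneath the left factor c leaves its monotonicity as a
    premise, discharged at the end.\<close>
  finally have step: "(\<And>x y. x \<le> y \<Longrightarrow> c * x \<le> c * y) \<Longrightarrow>
    (\<integral>\<^sup>+w. F (\<lambda>i\<in>insert j J. T i (w i)) \<partial>Pi\<^sub>M (insert j J) (\<lambda>_. A)) \<le>
    c * (c ^ card J * (\<integral>\<^sup>+w. F (\<lambda>i\<in>insert j J. S (w i)) \<partial>Pi\<^sub>M (insert j J) (\<lambda>_. A)))" .
  have "c ^ card (insert j J) = c * c ^ card J" using fin by simp
  then show ?case unfolding mult.assoc by (simp only: mult.assoc) (rule step, rule mult_left_mono, simp_all)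
qed

text \<open>Doubling the variance absorbs every bounded shift. Since |z|^2 \<le> 2|z - a|^2 +
  2|a|^2, the ratio of the densities is at most \<open>2 * exp (r^2)\<close>, with 2 the quotient of
  the normalisers 2 pi and pi.\<close>

lemma std_gaussian_shift_dominated:
  assumes a: "cmod a \<le> r" and [measurable]: "f \<in> borel_measurable borel"
  shows "(\<integral>\<^sup>+w. f (a + w) \<partial>std_gaussian) \<le> ennreal (2 * exp (r\<^sup>2)) * (\<integral>\<^sup>+w. f (of_real (sqrt 2) * w) \<partial>std_gaussian)"
proof -
  have "(\<integral>\<^sup>+w. f (a + w) \<partial>std_gaussian) = (\<integral>\<^sup>+z. f z \<partial>complex_gaussian a 1)"
    by (subst complex_gaussian_affine) auto
  also have "\<dots> = (\<integral>\<^sup>+z. ennreal (exp (- (cmod (z - a))\<^sup>2 / 1) / (pi * 1)) * f z \<partial>lborel)"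
    by (rule nn_integral_complex_gaussian) measurable
  also have "\<dots> \<le> (\<integral>\<^sup>+z. ennreal (2 * exp (r\<^sup>2)) * (ennreal (exp (- (cmod (z - 0))\<^sup>2 / 2) / (pi * 2)) * f z) \<partial>lborel)"
  proof (rule nn_integral_mono)
    fix z :: complex
    have "(cmod z)\<^sup>2 \<le> (cmod (z - a) + cmod a)\<^sup>2"
      using norm_triangle_sub[of z a] by (intro power_mono) (auto simp: add.commute)
    also have "\<dots> \<le> 2 * (cmod (z - a))\<^sup>2 + 2 * (cmod a)\<^sup>2"
      using sum_squares_bound[of "cmod (z - a)" "cmod a"] by (simp add: power2_sum)
    also have "(cmod a)\<^sup>2 \<le> r\<^sup>2" using a by (intro power_mono) auto
    finally have "- (cmod (z - a))\<^sup>2 \<le> r\<^sup>2 + - (cmod z)\<^sup>2 / 2" by simp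
    then have "exp (- (cmod (z - a))\<^sup>2) \<le> exp (r\<^sup>2) * exp (- (cmod z)\<^sup>2 / 2)"
      by (simp only: exp_add[symmetric] exp_le_cancel_iff)
    then have "exp (- (cmod (z - a))\<^sup>2 / 1) / (pi * 1) \<le> 2 * exp (r\<^sup>2) * (exp (- (cmod (z - 0))\<^sup>2 / 2) / (pi * 2))"
      by (simp add: divide_right_mono)
    then have "ennreal (exp (- (cmod (z - a))\<^sup>2 / 1) / (pi * 1)) \<le> ennreal (2 * exp (r\<^sup>2)) * ennreal (exp (- (cmod (z - 0))\<^sup>2 / 2) / (pi * 2))"
      by (subst ennreal_mult[symmetric]) (auto intro: ennreal_leI)
    then show "ennreal (exp (- (cmod (z - a))\<^sup>2 / 1) / (pi * 1)) * f z \<le> ennreal (2 * exp (r\<^sup>2)) * (ennreal (exp (- (cmod (z - 0))\<^sup>2 / 2) / (pi * 2)) * f z)"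
      by (simp only: mult.assoc[symmetric]) (rule mult_right_mono, auto)
  qed
  also have "\<dots> = ennreal (2 * exp (r\<^sup>2)) * (\<integral>\<^sup>+z. f z \<partial>complex_gaussian 0 2)"
    by (subst nn_integral_cmult, measurable, subst nn_integral_complex_gaussian) auto
  also have "(\<integral>\<^sup>+z. f z \<partial>complex_gaussian 0 2) = (\<integral>\<^sup>+w. f (of_real (sqrt 2) * w) \<partial>std_gaussian)"
    by (subst complex_gaussian_affine) auto
  finally show ?thesis .
qed

text \<open>Domination is lifted twice, from entries to a block and from blocks to the sequence. The
  dominating law on the right does not involve the shift a, so it serves all codewords at
  once.\<close>

lemma noise_shift_dominated:
  assumes a: "\<And>k i. k < l \<Longrightarrow> i < n \<Longrightarrow> cmod (a k i) \<le> r" and F: "F \<in> borel_measurable (output_space l n)"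
  shows "(\<integral>\<^sup>+W. F (\<lambda>k\<in>{..<l}. \<lambda>i\<in>{..<n}. a k i + W k i) \<partial>noise_law l n) \<le>
    (ennreal (2 * exp (r\<^sup>2)) ^ n) ^ l * (\<integral>\<^sup>+W. F (\<lambda>k\<in>{..<l}. \<lambda>i\<in>{..<n}. of_real (sqrt 2) * W k i) \<partial>noise_law l n)"
proof -
  let ?B = "Pi\<^sub>M {..<n} (\<lambda>_. borel :: complex measure)" and ?c = "ennreal (2 * exp (r\<^sup>2))"
  let ?T = "\<lambda>k w. \<lambda>i\<in>{..<n}. a k i + w i" and ?S = "\<lambda>w. \<lambda>i\<in>{..<n}. of_real (sqrt 2) * w i"
  have comp: "(\<lambda>w. w i) \<in> std_gaussian_vec {..<n} \<rightarrow>\<^sub>M borel" if "i \<in> {..<n}" for i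
    using measurable_component_singleton[OF that, of "\<lambda>_. std_gaussian"] by (simp cong: measurable_cong_sets)
  have T: "?T k \<in> std_gaussian_vec {..<n} \<rightarrow>\<^sub>M ?B" for k
    by (intro measurable_restrict borel_measurable_add borel_measurable_const comp)
  have S: "?S \<in> std_gaussian_vec {..<n} \<rightarrow>\<^sub>M ?B"
    by (intro measurable_restrict borel_measurable_times borel_measurable_const comp)
  have dom: "(\<integral>\<^sup>+w. f (?T k w) \<partial>std_gaussian_vec {..<n}) \<le> ?c ^ n * (\<integral>\<^sup>+w. f (?S w) \<partial>std_gaussian_vec {..<n})"
    if k: "k \<in> {..<l}" and f: "f \<in> borel_measurable ?B" for k and f :: "(nat \<Rightarrow> complex) \<Rightarrow> ennreal"
  proof -
    have add: "(\<lambda>w. a k i + w) \<in> std_gaussian \<rightarrow>\<^sub>M borel" for i by measurable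
    have mult: "(\<lambda>w. of_real (sqrt 2) * w :: complex) \<in> std_gaussian \<rightarrow>\<^sub>M borel" by measurable
    have d: "(\<integral>\<^sup>+w. h (a k i + w) \<partial>std_gaussian) \<le> ?c * (\<integral>\<^sup>+w. h (of_real (sqrt 2) * w) \<partial>std_gaussian)"
      if "i \<in> {..<n}" "h \<in> borel_measurable borel" for i and h :: "complex \<Rightarrow> ennreal"
      using that k by (intro std_gaussian_shift_dominated a) auto
    show ?thesis
      using nn_integral_PiM_dominated[where A="std_gaussian" and J="{..<n}" and B=borel and c="?c" and F=f
          and T="\<lambda>i w. a k i + w" and S="\<lambda>w. of_real (sqrt 2) * w", OF prob_space_std_gaussian finite_lessThan add mult d f]
      unfolding card_lessThan .
  qed
  show ?thesis
    using nn_integral_PiM_dominated[where A="std_gaussian_vec {..<n}" and J="{..<l}" and B="?B" and c="?c ^ n" and F=F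
        and T="?T" and S="?S", OF prob_space_std_vec finite_lessThan T S dom F[unfolded output_space_def]]
    unfolding noise_law_eq card_lessThan .
qed

section \<open>Bounded fading and the number of messages\<close>

lemma fading_tail:
  assumes \<kappa>: "0 \<le> \<kappa>" and \<delta>: "0 < \<delta>"
  shows "\<exists>R\<ge>0. emeasure (fading_law \<kappa> l) {H \<in> space (fading_law \<kappa> l). R < (\<Sum>k<l. cmod (H k))} \<le> ennreal \<delta>"
proof -
  let ?F = "fading_law \<kappa> l"
  interpret F: prob_space ?F using \<kappa> by (rule prob_space_fading_law)
  let ?A = "\<lambda>m::nat. {H \<in> space ?F. real m < (\<Sum>k<l. cmod (H k))}"
  have "(\<lambda>H. \<Sum>k<l. cmod (H k)) \<in> borel_measurable ?F"
    by (intro borel_measurable_sum measurable_compose[OF _ borel_measurable_norm] measurable_fading_component) (auto intro: measurable_ident_sets)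
  then have A: "?A m \<in> sets ?F" for m by measurable
  \<comment> \<open>Continuity from above: the tail events decrease to the empty set.\<close>
  have "(\<lambda>m. measure ?F (?A m)) \<longlonglongrightarrow> measure ?F (\<Inter>m. ?A m)"
    using A by (intro F.finite_Lim_measure_decseq) (auto simp: decseq_def)
  moreover have "(\<Inter>m. ?A m) = {}"
  proof (rule equals0I)
    fix H assume H: "H \<in> (\<Inter>m. ?A m)"
    obtain m :: nat where "(\<Sum>k<l. cmod (H k)) \<le> real m" using real_arch_simple by blast
    moreover have "real m < (\<Sum>k<l. cmod (H k))" using H by blast
    ultimately show False by simp
  qed
  ultimately have "(\<lambda>m. measure ?F (?A m)) \<longlonglongrightarrow> 0" by simp
  then have "eventually (\<lambda>m. measure ?F (?A m) < \<delta>) sequentially" using \<delta> by (rule order_tendstoD)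
  then obtain m where "measure ?F (?A m) < \<delta>" by (auto simp: eventually_sequentially)
  then show ?thesis by (intro exI[of _ "real m"]) (auto simp: F.emeasure_eq_measure intro: ennreal_leI)
qed

text \<open>Message j succeeds with probability at most \<delta> + c \<nu>_j: large fading accounts
  for \<delta>, and \<nu>_j is the mass of its decoding region under the fixed Gaussian law. As the
  \<nu>_j sum to at most 1, M (1 - \<epsilon>) \<le> M \<delta> + c, and 1 - \<epsilon> = 2 \<delta>
  leaves M \<le> c / \<delta>.\<close>

lemma code_size_bounded:
  assumes \<kappa>: "0 \<le> \<kappa>" and \<rho>: "0 < \<rho>" and \<epsilon>: "\<epsilon> < 1"
  shows "\<exists>K. \<forall>M f g. is_code \<kappa> l n M \<epsilon> \<rho> f g \<longrightarrow> real M \<le> K"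
proof -
  let ?N = "noise_law l n" and ?F = "fading_law \<kappa> l"
  interpret F: prob_space ?F using \<kappa> by (rule prob_space_fading_law)
  define \<delta> where "\<delta> = (1 - \<epsilon>) / 2"
  have \<delta>: "0 < \<delta>" using \<epsilon> by (simp add: \<delta>_def)
  obtain R where R: "0 \<le> R" and bad: "emeasure ?F {H \<in> space ?F. R < (\<Sum>k<l. cmod (H k))} \<le> ennreal \<delta>"
    using fading_tail[OF \<kappa> \<delta>] by blast
  define Bad where "Bad = {H \<in> space ?F. R < (\<Sum>k<l. cmod (H k))}"
  have "(\<lambda>H. \<Sum>k<l. cmod (H k)) \<in> borel_measurable ?F"
    by (intro borel_measurable_sum measurable_compose[OF _ borel_measurable_norm] measurable_fading_component) (auto intro: measurable_ident_sets)
  then have Bad: "Bad \<in> sets ?F" unfolding Bad_def by measurable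
  \<comment> \<open>Each codeword entry has modulus at most \<open>sqrt (real n * \<rho>)\<close>,
    so r bounds every shift \<open>H k * f j k i\<close> outside the event of large fading.\<close>
  define r where "r = R * sqrt (real n * \<rho>)"
  define c where "c = ((2 * exp (r\<^sup>2)) ^ n) ^ l"
  have c: "(ennreal (2 * exp (r\<^sup>2)) ^ n) ^ l = ennreal c" and c0: "0 \<le> c" by (simp_all add: c_def ennreal_power)
  have "real M \<le> c / \<delta>" if code: "is_code \<kappa> l n M \<epsilon> \<rho> f g" for M f g
  proof -
    have M: "1 \<le> M" and power: "\<And>m k. m \<in> {1..M} \<Longrightarrow> k < l \<Longrightarrow> (vnorm n (f m k))\<^sup>2 = real n * \<rho>"
      and g: "g \<in> output_space l n \<rightarrow>\<^sub>M count_space {1..M}"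
      and err: "(1 / real M) * (\<Sum>j=1..M. measure (channel_law \<kappa> l n (f j)) (error_event l n g j)) \<le> \<epsilon>"
      using code by (auto simp: is_code_def)
    let ?p = "\<lambda>j. measure (channel_law \<kappa> l n (f j)) (error_event l n g j)"
    let ?Z = "\<lambda>W. \<lambda>k\<in>{..<l}. \<lambda>i\<in>{..<n}. of_real (sqrt 2) * W k i :: complex"
    define D where "D j = {y \<in> space (output_space l n). g y = j}" for j
    have D: "D j \<in> sets (output_space l n)" if "j \<in> {1..M}" for j
    proof -
      have "D j = g -` {j} \<inter> space (output_space l n)" by (auto simp: D_def)
      also have "\<dots> \<in> sets (output_space l n)" using that by (intro measurable_sets[OF g]) auto
      finally show ?thesis .
    qed
    define \<nu> where "\<nu> j = (\<integral>\<^sup>+W. indicator (D j) (?Z W) \<partial>?N)" for j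
    have Z: "?Z \<in> ?N \<rightarrow>\<^sub>M output_space l n"
      unfolding output_space_def
      by (intro measurable_restrict borel_measurable_times borel_measurable_const measurable_noise_component)
        (auto intro: measurable_ident_sets)
    have success: "ennreal (1 - ?p j) \<le> ennreal \<delta> + ennreal c * \<nu> j" if j: "j \<in> {1..M}" for j
    proof -
      interpret Ch: prob_space "channel_law \<kappa> l n (f j)" using \<kappa> by (rule prob_space_channel_law)
      have "(error_event l n g j) = space (channel_law \<kappa> l n (f j)) - D j"
        by (auto simp: D_def sets_channel_law)
      then have "1 - ?p j = measure (channel_law \<kappa> l n (f j)) (D j)"
        using Ch.prob_compl[of "D j"] D[OF j] by (simp add: sets_channel_law)
      then have "ennreal (1 - ?p j) = emeasure (channel_law \<kappa> l n (f j)) (D j)"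
        by (simp add: Ch.emeasure_eq_measure)
      also have "\<dots> = (\<integral>\<^sup>+H. \<integral>\<^sup>+W. indicator (D j) (channel_output l n (f j) H W) \<partial>?N \<partial>?F)"
        by (rule emeasure_channel_law[OF \<kappa> D[OF j]])
      also have "\<dots> \<le> (\<integral>\<^sup>+H. indicator Bad H + ennreal c * \<nu> j \<partial>?F)"
      proof (rule nn_integral_mono)
        fix H assume H: "H \<in> space ?F"
        show "(\<integral>\<^sup>+W. indicator (D j) (channel_output l n (f j) H W) \<partial>?N) \<le> indicator Bad H + ennreal c * \<nu> j"
        proof (cases "H \<in> Bad")
          case True
          have "(\<integral>\<^sup>+W. indicator (D j) (channel_output l n (f j) H W) \<partial>?N) \<le> (\<integral>\<^sup>+W. 1 \<partial>?N)"
            by (intro nn_integral_mono) (simp add: indicator_def)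
          then show ?thesis using True by (simp add: noise.emeasure_space_1 add_increasing2)
        next
          case False
          then have sum: "(\<Sum>k<l. cmod (H k)) \<le> R" using H by (simp add: Bad_def)
          have "cmod (H k * f j k i) \<le> r" if k: "k < l" and i: "i < n" for k i
          proof -
            have "cmod (H k) \<le> (\<Sum>k<l. cmod (H k))" using k by (intro member_le_sum) auto
            moreover have "(cmod (f j k i))\<^sup>2 \<le> real n * \<rho>"
              unfolding power[OF j k, symmetric] vnorm_power2 using i by (intro member_le_sum) auto
            then have "cmod (f j k i) \<le> sqrt (real n * \<rho>)" by (rule real_le_rsqrt)
            ultimately show ?thesis unfolding norm_mult r_def using sum R by (intro mult_mono) auto
          qed
          then have "(\<integral>\<^sup>+W. indicator (D j) (channel_output l n (f j) H W) \<partial>?N)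
             \<le> (ennreal (2 * exp (r\<^sup>2)) ^ n) ^ l * \<nu> j"
            unfolding \<nu>_def using D[OF j] by (intro noise_shift_dominated[of l n "\<lambda>k i. H k * f j k i" r]) auto
          then show ?thesis using False unfolding c by simp
        qed
      qed
      also have "\<dots> = emeasure ?F Bad + ennreal c * \<nu> j"
        using Bad by (subst nn_integral_add) (auto simp: F.emeasure_space_1)
      also have "\<dots> \<le> ennreal \<delta> + ennreal c * \<nu> j"
        using bad unfolding Bad_def by (intro add_right_mono)
      finally show ?thesis .
    qed
    have "(\<Sum>j=1..M. \<nu> j) = (\<integral>\<^sup>+W. (\<Sum>j=1..M. indicator (D j) (?Z W)) \<partial>?N)"
      unfolding \<nu>_def
    proof (rule nn_integral_sum[symmetric])
      fix j assume "j \<in> {1..M}"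
      then have "(indicator (D j) :: _ \<Rightarrow> ennreal) \<in> borel_measurable (output_space l n)" using D by simp
      from measurable_compose[OF Z this] show "(\<lambda>W. indicator (D j) (?Z W) :: ennreal) \<in> borel_measurable ?N" .
    qed
    also have "\<dots> \<le> (\<integral>\<^sup>+W. 1 \<partial>?N)"
    proof (rule nn_integral_mono)
      fix W
      have "(\<Sum>j=1..M. indicator (D j) (?Z W) :: ennreal) \<le> (\<Sum>j=1..M. if j = g (?Z W) then 1 else 0)"
        by (intro sum_mono) (auto simp: D_def indicator_def)
      also have "\<dots> \<le> 1" by (simp add: sum.delta)
      finally show "(\<Sum>j=1..M. indicator (D j) (?Z W) :: ennreal) \<le> 1" .
    qed
    finally have \<nu>_sum: "(\<Sum>j=1..M. \<nu> j) \<le> 1" by (simp add: noise.emeasure_space_1)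
    have p1: "0 \<le> 1 - ?p j" for j
    proof -
      interpret Ch: prob_space "channel_law \<kappa> l n (f j)" using \<kappa> by (rule prob_space_channel_law)
      show ?thesis by simp
    qed
    have "ennreal (\<Sum>j=1..M. 1 - ?p j) = (\<Sum>j=1..M. ennreal (1 - ?p j))"
      using p1 by (intro sum_ennreal[symmetric]) auto
    also have "\<dots> \<le> (\<Sum>j=1..M. ennreal \<delta> + ennreal c * \<nu> j)" by (intro sum_mono success)
    also have "\<dots> = ennreal (real M * \<delta>) + ennreal c * (\<Sum>j=1..M. \<nu> j)"
      by (simp add: sum.distrib sum_distrib_left[symmetric] ennreal_mult' ennreal_of_nat_eq_real_of_nat)
    also have "\<dots> \<le> ennreal (real M * \<delta>) + ennreal c * 1"
      by (intro add_left_mono mult_left_mono \<nu>_sum) auto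
    also have "\<dots> = ennreal (real M * \<delta> + c)" using c0 \<delta> by simp
    finally have "(\<Sum>j=1..M. 1 - ?p j) \<le> real M * \<delta> + c"
      using c0 \<delta> by (subst (asm) ennreal_le_iff) auto
    then have "real M - (\<Sum>j=1..M. ?p j) \<le> real M * \<delta> + c" by (simp add: sum_subtractf)
    moreover have "(\<Sum>j=1..M. ?p j) \<le> real M * \<epsilon>" using err M by (simp add: field_simps)
    moreover have "real M * \<epsilon> = real M - 2 * (real M * \<delta>)" by (simp add: \<delta>_def field_simps)
    ultimately have "real M * \<delta> \<le> c" by linarith
    then show ?thesis using \<delta> by (simp add: field_simps)
  qed
  then show ?thesis by blast
qed

text \<open>\<open>Max\<close> has its intended meaning only on a finite nonempty set, so finiteness
  belongs to the conclusion, and the implication expresses the convention on an empty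
  maximum.\<close>

theorem theorem2:
  fixes \<kappa> \<rho> \<epsilon> :: real and l n :: nat
  assumes "0 \<le> \<kappa>" and "1 \<le> l" and "1 \<le> n" and "0 < \<rho>" and "0 < \<epsilon>" and "\<epsilon> < 1"
  shows "let A = {log 2 (real M) / (real n * real l) | M :: nat.
                    1 \<le> M \<and> eps_ub \<kappa> l n M \<rho> \<le> \<epsilon>}
         in finite A \<and> (A \<noteq> {} \<longrightarrow> ereal (Max A) \<le> max_coding_rate \<kappa> l n \<epsilon> \<rho>)"
proof -
  let ?A = "{log 2 (real M) / (real n * real l) | M :: nat. 1 \<le> M \<and> eps_ub \<kappa> l n M \<rho> \<le> \<epsilon>}"
  have code: "\<exists>f g. is_code \<kappa> l n M \<epsilon> \<rho> f g" if "1 \<le> M" "eps_ub \<kappa> l n M \<rho> \<le> \<epsilon>" for M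
    using assms that by (intro code_exists) auto
  obtain K where K: "\<And>M f g. is_code \<kappa> l n M \<epsilon> \<rho> f g \<Longrightarrow> real M \<le> K"
    using code_size_bounded[OF assms(1,4,6), of l n] by blast
  have "?A \<subseteq> (\<lambda>M. log 2 (real M) / (real n * real l)) ` {..nat \<lfloor>K\<rfloor>}"
  proof
    fix a assume "a \<in> ?A"
    then obtain M where M: "a = log 2 (real M) / (real n * real l)" "1 \<le> M" "eps_ub \<kappa> l n M \<rho> \<le> \<epsilon>" by blast
    then obtain f g where "is_code \<kappa> l n M \<epsilon> \<rho> f g" using code by blast
    then have "real M \<le> K" by (rule K)
    then have "M \<le> nat \<lfloor>K\<rfloor>" by (simp add: le_nat_floor)
    then show "a \<in> (\<lambda>M. log 2 (real M) / (real n * real l)) ` {..nat \<lfloor>K\<rfloor>}" using M(1) by blast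
  qed
  then have fin: "finite ?A" by (rule finite_subset) simp
  have "ereal (Max ?A) \<le> max_coding_rate \<kappa> l n \<epsilon> \<rho>" if "?A \<noteq> {}"
  proof -
    have "Max ?A \<in> ?A" using fin that by (rule Max_in)
    then obtain M where M: "Max ?A = log 2 (real M) / (real n * real l)" "1 \<le> M" "eps_ub \<kappa> l n M \<rho> \<le> \<epsilon>" by blast
    have "ereal (log 2 (real M) / (real l * real n)) \<in>
      {ereal (log 2 (real M) / (real l * real n)) | M. \<exists>f g. is_code \<kappa> l n M \<epsilon> \<rho> f g}"
      using code[OF M(2,3)] by blast
    then show ?thesis unfolding M(1) unfolding max_coding_rate_def mult.commute[of "real n"] by (rule Sup_upper)
  qed
  with fin show ?thesis unfolding Let_def by blast
qed

end
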